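(* Let $K=\frac{(N-2)p-N}{p-1}$. 1. If $p>1$ and $q=\frac{2p}{p+1}$, there always exist (for suitable $M\in\mathbb{R}$) nonradial positive singular solutions of $$-\Delta u=|u|^{p-1}u+M|\nabla u|^q\quad\text{in }\mathbb{R}^N\setminus\{0\}$$ of the form $u(r,\sigma)=r^{-\frac{2}{p-1}}\omega(\sigma)$, $(r,\sigma)\in(0,\infty)\times S^{N-1}$. 2. If $N\ge4$ and $p>\frac{N+1}{N-3}$, the functions $\omega$ are obtained by bifurcation from the constant solution $X_M$ with $M>0$. 3. If $N\ge3$ and $\frac{N}{N-2}\le p<\frac{N+1}{N-3}$, the functions $\omega$ are obtained by bifurcation from the constant solution $X_M$ with $M<0$. 4. If $N=1,2$ and $p>1$, or $N\ge3$ and $1<p<\frac N{N-2}$, the functions $\omega$ are obtained by bifurcation from $(M_k,X_{2,M_k})$ with $M_k<-\mu^*$ and $k\ge1$, where $\mu^*=(p+1)\big(\frac{N-(N-2)p}{2p}\big)^{\frac{p}{p+1}}$.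
   Context: Throughout, $p>1$ and $q=\frac{2p}{p+1}$. A function $u=r^{-\frac{2}{p-1}}\omega(\sigma)$ with $\omega>0$ solves the equation iff $\omega$ solves on $S^{N-1}$ $$-\Delta'\omega+\frac{2K}{p-1}\omega=\omega^p+M\left(\Big(\frac{2}{p-1}\Big)^2\omega^2+|\nabla'\omega|^2\right)^{\frac{p}{p+1}},\qquad(\ast)$$ $\Delta'$ being the Laplace–Beltrami operator and $\nabla'$ the tangential gradient; $u$ is nonradial iff $\omega$ is nonconstant. Positive constant solutions of $(\ast)$ are the positive roots $X$ of $$X^{p-1}+M\Big(\frac{2}{p-1}\Big)^{\frac{2p}{p+1}}X^{\frac{p-1}{p+1}}-\frac{2K}{p-1}=0 .$$ If $N\ge 3$ and $p>\frac N{N-2}$ (any $M$), or $p=\frac N{N-2}$ and $M<0$, there is a unique positive root, denoted $X_M$. In the situation of item 4, for $M<-\mu^*$ there are exactly two positive roots $X_{1,M}<X_{2,M}$. The points $M_k$ in item 4 are defined by $M_k\big(\frac{2}{p-1}\big)^{\frac{2p}{p+1}}X_{2,M_k}^{\frac{p-1}{p+1}}=\frac{p+1}{p(p-1)}\big(2K-k(k+N-2)\big)$. "Obtained by bifurcation from $(M_0,X)$" means: there is a continuous curve $s\mapsto(M(s),\omega_s)\in\mathbb{R}\times C^1(S^{N-1})$, defined for $s$ near $0$, of positive solutions of $(\ast)$ with $M=M(s)$, equal to $(M_0,X)$ at $s=0$ and with $\omega_s$ nonconstant for $s\neq0$. Convention: $\frac{N+1}{N-3}=\infty$ if $N=3$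.
   Formalization: In item 4 with N=1 the claim of bifurcation from (M_k, X_{2,M_k}) with M_k<-μ* is false (on the two-point sphere such X_{2,M} is isolated); it is replaced by k=1, where M_1=-μ* is the point at which the two roots coincide. *)

theory Defs
  imports "HOL-Analysis.Analysis"
begin

text \<open>
  The space \<open>\<real>\<^sup>N\<close> is a type \<open>'a :: euclidean_space\<close> with \<open>N = DIM('a)\<close>, and \<open>S\<^sup>N\<^sup>-\<^sup>1\<close> is
  \<open>sphere (0::'a) 1\<close> (two points if \<open>N = 1\<close>). Only the values on \<open>sphere 0 1\<close> of a function
  \<open>\<omega> :: 'a \<Rightarrow> real\<close> that represents a function on the sphere are ever used.
\<close>

definition partial_deriv :: "'a::euclidean_space \<Rightarrow> ('a \<Rightarrow> real) \<Rightarrow> 'a \<Rightarrow> real" where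
  "partial_deriv b f x = frechet_derivative f (at x) b"

definition grad :: "('a::euclidean_space \<Rightarrow> real) \<Rightarrow> 'a \<Rightarrow> 'a" where
  "grad f x = (\<Sum>b\<in>Basis. partial_deriv b f x *\<^sub>R b)"

definition laplacian :: "('a::euclidean_space \<Rightarrow> real) \<Rightarrow> 'a \<Rightarrow> real" where
  "laplacian f x = (\<Sum>b\<in>Basis. partial_deriv b (partial_deriv b f) x)"

text \<open>Intended for open \<open>S\<close>.\<close>

definition C2_on :: "'a::euclidean_space set \<Rightarrow> ('a \<Rightarrow> real) \<Rightarrow> bool" where
  "C2_on S f \<longleftrightarrow>
     (\<forall>x\<in>S. f differentiable (at x)) \<and>
     (\<forall>b\<in>Basis. \<forall>x\<in>S. partial_deriv b f differentiable (at x)) \<and>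
     (\<forall>b\<in>Basis. \<forall>c\<in>Basis. continuous_on S (partial_deriv c (partial_deriv b f)))"

text \<open>
  Differential calculus on the unit sphere goes through the extension that is constant on rays:
  on the sphere, the gradient of this extension is tangential and equals the tangential gradient
  \<open>\<nabla>'\<omega>\<close>, and its Laplacian equals the Laplace--Beltrami operator \<open>\<Delta>'\<omega>\<close>; moreover \<open>\<omega>\<close> is of class
  \<open>C\<^sup>2\<close> on the sphere iff the extension is of class \<open>C\<^sup>2\<close> away from the origin.
\<close>

definition radial_ext :: "('a::euclidean_space \<Rightarrow> real) \<Rightarrow> 'a \<Rightarrow> real" where
  "radial_ext \<omega> x = \<omega> (x /\<^sub>R norm x)"

definition sphere_grad :: "('a::euclidean_space \<Rightarrow> real) \<Rightarrow> 'a \<Rightarrow> 'a" where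
  "sphere_grad \<omega> = grad (radial_ext \<omega>)"

definition sphere_laplacian :: "('a::euclidean_space \<Rightarrow> real) \<Rightarrow> 'a \<Rightarrow> real" where
  "sphere_laplacian \<omega> = laplacian (radial_ext \<omega>)"

definition C2_sphere :: "('a::euclidean_space \<Rightarrow> real) \<Rightarrow> bool" where
  "C2_sphere \<omega> \<longleftrightarrow> C2_on (- {0}) (radial_ext \<omega>)"

definition K_const :: "nat \<Rightarrow> real \<Rightarrow> real" where
  "K_const N p = ((real N - 2) * p - real N) / (p - 1)"

definition mu_star :: "nat \<Rightarrow> real \<Rightarrow> real" where
  "mu_star N p = (p + 1) * ((real N - (real N - 2) * p) / (2 * p)) powr (p / (p + 1))"

definition emden_solution :: "real \<Rightarrow> real \<Rightarrow> ('a::euclidean_space \<Rightarrow> real) \<Rightarrow> bool" where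
  "emden_solution p M u \<longleftrightarrow> C2_on (- {0}) u \<and>
     (\<forall>x. x \<noteq> 0 \<longrightarrow>
        - laplacian u x = \<bar>u x\<bar> powr (p - 1) * u x + M * norm (grad u x) powr (2 * p / (p + 1)))"

definition nonradial :: "('a::euclidean_space \<Rightarrow> real) \<Rightarrow> bool" where
  "nonradial u \<longleftrightarrow> \<not> (\<exists>g. \<forall>x. x \<noteq> 0 \<longrightarrow> u x = g (norm x))"

text \<open>No continuous extension to the origin; the value of \<open>u\<close> at \<open>0\<close> is irrelevant.\<close>

definition singular_at_origin :: "('a::euclidean_space \<Rightarrow> real) \<Rightarrow> bool" where
  "singular_at_origin u \<longleftrightarrow> \<not> (\<exists>l. (u \<longlongrightarrow> l) (at 0))"

text \<open>Positive solutions \<open>\<omega>\<close> of the equation on the sphere satisfied by the angular profile of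
  \<open>u(r,\<sigma>) = r\<^bsup>-2/(p-1)\<^esup> \<omega>(\<sigma>)\<close>.\<close>

definition sphere_solution :: "real \<Rightarrow> real \<Rightarrow> ('a::euclidean_space \<Rightarrow> real) \<Rightarrow> bool" where
  "sphere_solution p M \<omega> \<longleftrightarrow> C2_sphere \<omega> \<and>
     (\<forall>\<sigma>\<in>sphere 0 1. \<omega> \<sigma> > 0 \<and>
        - sphere_laplacian \<omega> \<sigma> + 2 * K_const DIM('a) p / (p - 1) * \<omega> \<sigma> =
        \<omega> \<sigma> powr p +
        M * ((2 / (p - 1))\<^sup>2 * (\<omega> \<sigma>)\<^sup>2 + (norm (sphere_grad \<omega> \<sigma>))\<^sup>2) powr (p / (p + 1)))"

definition constant_solutions :: "nat \<Rightarrow> real \<Rightarrow> real \<Rightarrow> real set" where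
  "constant_solutions N p M =
     {X. X > 0 \<and>
         X powr (p - 1) + M * (2 / (p - 1)) powr (2 * p / (p + 1)) * X powr ((p - 1) / (p + 1))
           - 2 * K_const N p / (p - 1) = 0}"

text \<open>\<open>X_M\<close> is used where there is exactly one positive constant solution.\<close>

definition X_M :: "nat \<Rightarrow> real \<Rightarrow> real \<Rightarrow> real" where
  "X_M N p M = (THE X. X \<in> constant_solutions N p M)"

text \<open>
  If \<open>1 < p\<close> and \<open>(N - 2) p < N\<close>, there are two positive constant solutions for \<open>M < - mu_star N p\<close>,
  one for \<open>M = - mu_star N p\<close> and none for \<open>M > - mu_star N p\<close>. So \<open>X2_M\<close> is the larger of the two
  solutions in the first case, and the unique (double) one in the second.
\<close>

definition X2_M :: "nat \<Rightarrow> real \<Rightarrow> real \<Rightarrow> real" where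
  "X2_M N p M = Max (constant_solutions N p M)"

definition M_k :: "nat \<Rightarrow> real \<Rightarrow> nat \<Rightarrow> real" where
  "M_k N p k = (THE M. constant_solutions N p M \<noteq> {} \<and>
     M * (2 / (p - 1)) powr (2 * p / (p + 1)) * X2_M N p M powr ((p - 1) / (p + 1)) =
     (p + 1) / (p * (p - 1)) * (2 * K_const N p - real k * (real k + real N - 2)))"

text \<open>
  The two \<open>uniform_limit\<close> conditions say that \<open>s \<mapsto> w s\<close> is continuous into \<open>C\<^sup>1(S\<^sup>N\<^sup>-\<^sup>1)\<close> with its
  usual norm. The first argument only fixes the dimension.
\<close>

definition bifurcates_from :: "'a::euclidean_space itself \<Rightarrow> real \<Rightarrow> real \<Rightarrow> real \<Rightarrow> bool" where
  "bifurcates_from _ p M0 X0 \<longleftrightarrow>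
     (\<exists>\<epsilon>>0. \<exists>(M :: real \<Rightarrow> real) (w :: real \<Rightarrow> 'a \<Rightarrow> real).
        continuous_on {-\<epsilon><..<\<epsilon>} M \<and>
        (\<forall>s\<in>{-\<epsilon><..<\<epsilon>}.
           uniform_limit (sphere 0 1) w (w s) (at s) \<and>
           uniform_limit (sphere 0 1) (\<lambda>t. sphere_grad (w t)) (sphere_grad (w s)) (at s)) \<and>
        (\<forall>s\<in>{-\<epsilon><..<\<epsilon>}. sphere_solution p (M s) (w s)) \<and>
        M 0 = M0 \<and> (\<forall>\<sigma>\<in>sphere 0 1. w 0 \<sigma> = X0) \<and>
        (\<forall>s\<in>{-\<epsilon><..<\<epsilon>}. s \<noteq> 0 \<longrightarrow> \<not> w s constant_on sphere 0 1))"

end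

theory Submission
  imports Defs
begin

text \<open>
  Solutions are sought among the zonal functions \<open>\<omega>(\<sigma>) = X (1 + s \<phi>(\<sigma> \<bullet> e))\<close>. The branch of constant
  solutions is parametrized by \<open>m = M (2/(p-1))\<^bsup>2p/(p+1)\<^esup> X\<^bsup>(p-1)/(p+1)\<^esup>\<close>, which makes
  \<open>X\<^bsup>p-1\<^esup> = \<kappa> - m\<close> with \<open>\<kappa> = 2K/(p-1)\<close> and turns the equation for \<open>V = 1 + s \<phi>\<close> into
  \<open>- L V + \<kappa> V = (\<kappa> - m) V\<^bsup>p\<^esup> + m (V\<^sup>2 + ((p-1)/2)\<^sup>2 (1 - t\<^sup>2) V'\<^sup>2)\<^bsup>p/(p+1)\<^esup>\<close>, where
  \<open>L = (1 - t\<^sup>2) d\<^sup>2/dt\<^sup>2 - (N - 1) t d/dt\<close>. Dividing by \<open>s\<close> leaves \<open>(L + \<lambda>\<^sub>k) \<phi> = \<nu> \<phi> + O(s)\<close> with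
  \<open>\<nu>\<close> a multiple of \<open>m - m\<^sub>k\<close>. On power series in \<open>t/R\<close> with absolutely summable coefficients, which form
  a Banach algebra, \<open>L + \<lambda>\<^sub>k\<close> is an upper triangular matrix: the diagonal \<open>\<lambda>\<^sub>k - \<lambda>\<^sub>n\<close> plus a shift by
  two whose size relative to the diagonal is \<open>O(R\<^bsup>-2\<^esup>)\<close>. So for large \<open>R\<close> the pair \<open>(\<phi>, \<nu>)\<close> is found by
  the contraction principle, with \<open>\<phi>\<close> normalized by its \<open>k\<close>-th coefficient, and no analysis at the
  singular points \<open>t = \<plusminus>1\<close> is needed. On \<open>S\<^sup>0\<close> the curve consists of pairs of constant solutions
  for the same \<open>M\<close>.
\<close>


subsection \<open>The Banach algebra of absolutely summable power series\<close>

text \<open>For \<open>N >= 2\<close> the spherical harmonics of degree \<open>k >= 1\<close> span a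
  space of dimension at least two, but up to scale only one of them depends on
  \<open>\<sigma> \<bullet> e\<close> alone; restricting to zonal functions makes the kernel
  one-dimensional. The value m_k comes from linearizing at V = 1. The gradient enters through a
  square and drops out, and the two powers contribute p (\<kappa> - m) + 2 m p/(p+1); equating this
  with \<kappa> + lambda_k gives (p-1) \<kappa> - p (p-1)/(p+1) m = lambda_k. The parameter m is
  preferred to M because for K < 0 two constants X can share one M, whereas X and M are
  single-valued functions of m < \<kappa>. That inequality, which says X > 0, is the only
  restriction on \<open>k\<close>: it always holds for \<open>k = 1\<close>, and for every
  \<open>k\<close> if K < 0. The sign of M is that of m, hence for \<open>k = 1\<close> that of 2K -
  (N-1). The exponents are not integers in general, so the nonlinearity is no polynomial; near V = 1
  both powers are binomial series in the Banach algebra. On the two-point sphere lambda_1 = 0, and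
  the bifurcation point is the fold M = - mu_star of the constant solutions.\<close>

typedef l1 = "{f :: real fps. summable (\<lambda>n. \<bar>fps_nth f n\<bar>)}"
  morphisms fps_of_l1 Abs_l1
  by (rule exI[of _ 0]) simp

setup_lifting type_definition_l1

abbreviation l1_coeff :: "l1 \<Rightarrow> nat \<Rightarrow> real" where
  "l1_coeff f n \<equiv> fps_nth (fps_of_l1 f) n"

lemma summable_l1_coeff: "summable (\<lambda>n. \<bar>l1_coeff f n\<bar>)"
  using fps_of_l1[of f] by simp

lemma l1_eqI: "(\<And>n. l1_coeff f n = l1_coeff g n) \<Longrightarrow> f = g"
  by (simp add: fps_eq_iff flip: fps_of_l1_inject)

lemma abs_fps_mult_le:
  fixes f g :: "real fps"
  shows "\<bar>fps_nth (f * g) n\<bar> \<le> (\<Sum>i\<le>n. \<bar>fps_nth f i\<bar> * \<bar>fps_nth g (n - i)\<bar>)"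
proof -
  have "fps_nth (f * g) n = (\<Sum>i\<le>n. fps_nth f i * fps_nth g (n - i))"
    by (simp add: fps_mult_nth atLeast0AtMost)
  also have "\<bar>\<dots>\<bar> \<le> (\<Sum>i\<le>n. \<bar>fps_nth f i * fps_nth g (n - i)\<bar>)"
    by (rule sum_abs)
  finally show ?thesis by (simp add: abs_mult)
qed

lemma summable_abs_fps_mult:
  fixes f g :: "real fps"
  assumes "summable (\<lambda>n. \<bar>fps_nth f n\<bar>)" "summable (\<lambda>n. \<bar>fps_nth g n\<bar>)"
  shows "summable (\<lambda>n. \<bar>fps_nth (f * g) n\<bar>)"
proof (rule summable_comparison_test')
  show "summable (\<lambda>n. \<Sum>i\<le>n. \<bar>fps_nth f i\<bar> * \<bar>fps_nth g (n - i)\<bar>)"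
    using assms by (intro summable_Cauchy_product) auto
qed (use abs_fps_mult_le in auto)

instantiation l1 :: comm_ring_1
begin

lift_definition zero_l1 :: l1 is 0 by simp
lift_definition one_l1 :: l1 is 1
  by (rule summable_finite[of "{0}"]) auto
lift_definition plus_l1 :: "l1 \<Rightarrow> l1 \<Rightarrow> l1" is "(+)"
  subgoal for f g
    by (rule summable_comparison_test'[of "\<lambda>n. \<bar>fps_nth f n\<bar> + \<bar>fps_nth g n\<bar>" 0])
       (auto simp: abs_triangle_ineq intro: summable_add)
  done
lift_definition minus_l1 :: "l1 \<Rightarrow> l1 \<Rightarrow> l1" is "(-)"
  subgoal for f g
    by (rule summable_comparison_test'[of "\<lambda>n. \<bar>fps_nth f n\<bar> + \<bar>fps_nth g n\<bar>" 0])
       (auto simp: abs_triangle_ineq4 intro: summable_add)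
  done
lift_definition uminus_l1 :: "l1 \<Rightarrow> l1" is uminus by simp
lift_definition times_l1 :: "l1 \<Rightarrow> l1 \<Rightarrow> l1" is "(*)"
  by (rule summable_abs_fps_mult)

instance by standard (transfer; simp add: algebra_simps)+

end

lemmas fps_of_l1_simps [simp] =
  zero_l1.rep_eq one_l1.rep_eq plus_l1.rep_eq minus_l1.rep_eq uminus_l1.rep_eq times_l1.rep_eq

lemma fps_of_l1_power [simp]: "fps_of_l1 (f ^ n) = fps_of_l1 f ^ n"
  by (induction n) auto

instantiation l1 :: real_algebra_1
begin

lift_definition scaleR_l1 :: "real \<Rightarrow> l1 \<Rightarrow> l1" is "\<lambda>c f. fps_const c * f"
  by (simp add: abs_mult summable_mult)

instance
proof
  fix a b :: real and f g :: l1
  show "a *\<^sub>R (f + g) = a *\<^sub>R f + a *\<^sub>R g" by transfer (simp add: algebra_simps)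
  show "(a + b) *\<^sub>R f = a *\<^sub>R f + b *\<^sub>R f"
    by transfer (simp add: algebra_simps flip: fps_const_add)
  show "a *\<^sub>R b *\<^sub>R f = (a * b) *\<^sub>R f" by transfer (simp add: algebra_simps flip: fps_const_mult)
  show "1 *\<^sub>R f = f" by transfer simp
  show "a *\<^sub>R f * g = a *\<^sub>R (f * g)" by transfer (simp add: algebra_simps)
  show "f * a *\<^sub>R g = a *\<^sub>R (f * g)" by transfer (simp add: algebra_simps)
qed

end

lemma fps_of_l1_scaleR [simp]: "fps_of_l1 (c *\<^sub>R f) = fps_const c * fps_of_l1 f"
  by (rule scaleR_l1.rep_eq)

lemma fps_of_l1_of_real [simp]: "fps_of_l1 (of_real c) = fps_const c"
  by (simp add: of_real_def)

instantiation l1 :: real_normed_algebra_1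
begin

definition norm_l1 :: "l1 \<Rightarrow> real" where "norm_l1 f = (\<Sum>n. \<bar>l1_coeff f n\<bar>)"
definition dist_l1 :: "l1 \<Rightarrow> l1 \<Rightarrow> real" where "dist_l1 f g = norm (f - g)"
definition sgn_l1 :: "l1 \<Rightarrow> l1" where "sgn_l1 f = inverse (norm f) *\<^sub>R f"
definition uniformity_l1 :: "(l1 \<times> l1) filter" where
  "uniformity_l1 = (INF e\<in>{0<..}. principal {(x, y). dist x y < e})"
definition open_l1 :: "l1 set \<Rightarrow> bool" where
  "open_l1 U = (\<forall>x\<in>U. eventually (\<lambda>(x', y). x' = x \<longrightarrow> y \<in> U) uniformity)"

instance
proof
  fix a :: real and f g :: l1
  show "dist f g = norm (f - g)" by (simp add: dist_l1_def)
  show "sgn f = f /\<^sub>R norm f" by (simp add: sgn_l1_def)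
  show "(uniformity :: (l1 \<times> l1) filter) = (INF e\<in>{0<..}. principal {(x, y). dist x y < e})"
    by (simp add: uniformity_l1_def)
  show "open U = (\<forall>x\<in>U. eventually (\<lambda>(x', y). x' = x \<longrightarrow> y \<in> U) uniformity)" for U :: "l1 set"
    by (simp add: open_l1_def)
  show "norm f = 0 \<longleftrightarrow> f = 0"
    using suminf_eq_zero_iff[OF summable_l1_coeff, of f]
    by (auto simp: norm_l1_def intro: l1_eqI)
  show "norm (a *\<^sub>R f) = \<bar>a\<bar> * norm f"
    by (simp add: norm_l1_def scaleR_l1.rep_eq abs_mult suminf_mult summable_l1_coeff)
  have "norm (f + g) \<le> (\<Sum>n. \<bar>l1_coeff f n\<bar> + \<bar>l1_coeff g n\<bar>)"
    unfolding norm_l1_def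
    by (intro suminf_le summable_add summable_l1_coeff) (auto simp: abs_triangle_ineq)
  then show "norm (f + g) \<le> norm f + norm g"
    by (simp add: norm_l1_def suminf_add summable_l1_coeff)
  have "norm (f * g) \<le> (\<Sum>n. \<Sum>i\<le>n. \<bar>l1_coeff f i\<bar> * \<bar>l1_coeff g (n - i)\<bar>)"
    unfolding norm_l1_def
    by (intro suminf_le summable_Cauchy_product summable_l1_coeff)
       (auto simp: summable_l1_coeff abs_fps_mult_le)
  also have "\<dots> = norm f * norm g"
    unfolding norm_l1_def by (intro Cauchy_product[symmetric]) (auto simp: summable_l1_coeff)
  finally show "norm (f * g) \<le> norm f * norm g" .
  have "norm (1 :: l1) = (\<Sum>n\<in>{0}. \<bar>l1_coeff 1 n\<bar>)"
    unfolding norm_l1_def by (rule suminf_finite) auto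
  then show "norm (1 :: l1) = 1" by simp
qed

end

lemma sum_abs_l1_coeff_le: "(\<Sum>i<n. \<bar>l1_coeff f i\<bar>) \<le> norm f"
  unfolding norm_l1_def by (intro sum_le_suminf summable_l1_coeff) auto

lemma abs_l1_coeff_le: "\<bar>l1_coeff f n\<bar> \<le> norm f"
proof -
  have "\<bar>l1_coeff f n\<bar> \<le> (\<Sum>i<Suc n. \<bar>l1_coeff f i\<bar>)"
    by (rule member_le_sum) auto
  also have "\<dots> \<le> norm f" by (rule sum_abs_l1_coeff_le)
  finally show ?thesis .
qed

lemma bounded_linear_l1_coeff: "bounded_linear (\<lambda>f. l1_coeff f n)"
  by (rule bounded_linear_intro[of _ 1]) (auto simp: abs_l1_coeff_le)

definition l1_of :: "(nat \<Rightarrow> real) \<Rightarrow> l1" where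
  "l1_of a = Abs_l1 (Abs_fps a)"

lemma l1_coeff_l1_of: "summable (\<lambda>n. \<bar>a n\<bar>) \<Longrightarrow> l1_coeff (l1_of a) n = a n"
  by (simp add: l1_of_def Abs_l1_inverse)

lemma norm_l1_leI:
  assumes "\<And>n. (\<Sum>i<n. \<bar>l1_coeff f i\<bar>) \<le> C"
  shows "norm f \<le> C"
  unfolding norm_l1_def using assms by (intro suminf_le_const summable_l1_coeff)

text \<open>Each coefficient is a bounded functional, so a Cauchy sequence converges
  coefficientwise. The Cauchy estimate is kept on finite partial sums, where the limit may be taken
  term by term, and is turned into a norm estimate only at the end.\<close>

instance l1 :: banach
proof
  fix X :: "nat \<Rightarrow> l1"
  assume C: "Cauchy X"
  have "Cauchy (\<lambda>m. l1_coeff (X m) n)" for n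
    by (rule bounded_linear.Cauchy[OF bounded_linear_l1_coeff C])
  then have "\<exists>l. (\<lambda>m. l1_coeff (X m) n) \<longlonglongrightarrow> l" for n
    using Cauchy_convergent convergent_def by blast
  then obtain a where a: "\<And>n. (\<lambda>m. l1_coeff (X m) n) \<longlonglongrightarrow> a n" by metis
  have part: "\<exists>M. \<forall>m\<ge>M. \<forall>n. (\<Sum>i<n. \<bar>l1_coeff (X m) i - a i\<bar>) \<le> e" if "e > 0" for e
  proof -
    obtain M where M: "\<And>m m'. m \<ge> M \<Longrightarrow> m' \<ge> M \<Longrightarrow> dist (X m) (X m') < e"
      using C \<open>e > 0\<close> unfolding Cauchy_def by blast
    have "(\<Sum>i<n. \<bar>l1_coeff (X m) i - a i\<bar>) \<le> e" if "m \<ge> M" for m n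
    proof (rule LIMSEQ_le_const2)
      show "(\<lambda>m'. \<Sum>i<n. \<bar>l1_coeff (X m) i - l1_coeff (X m') i\<bar>)
              \<longlonglongrightarrow> (\<Sum>i<n. \<bar>l1_coeff (X m) i - a i\<bar>)"
        by (intro tendsto_intros a)
      have "(\<Sum>i<n. \<bar>l1_coeff (X m) i - l1_coeff (X m') i\<bar>) \<le> e" if "m' \<ge> M" for m'
        using sum_abs_l1_coeff_le[of "X m - X m'" n] M[OF \<open>m \<ge> M\<close> that]
        by (simp add: dist_norm)
      then show "\<exists>N. \<forall>m'\<ge>N. (\<Sum>i<n. \<bar>l1_coeff (X m) i - l1_coeff (X m') i\<bar>) \<le> e" by blast
    qed
    then show ?thesis by blast
  qed
  obtain M where M: "\<And>n. (\<Sum>i<n. \<bar>l1_coeff (X M) i - a i\<bar>) \<le> 1"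
    using part[of 1] by auto
  have "summable (\<lambda>i. \<bar>l1_coeff (X M) i - a i\<bar>)"
    by (rule summableI_nonneg_bounded[OF _ M]) auto
  then have "summable (\<lambda>i. \<bar>l1_coeff (X M) i - a i\<bar> + \<bar>l1_coeff (X M) i\<bar>)"
    by (intro summable_add summable_l1_coeff)
  then have sa: "summable (\<lambda>i. \<bar>a i\<bar>)"
    by (rule summable_comparison_test'[of _ 0]) auto
  have "X \<longlonglongrightarrow> l1_of a"
  proof (rule metric_LIMSEQ_I)
    fix r :: real assume "r > 0"
    then obtain M where M: "\<And>m n. m \<ge> M \<Longrightarrow> (\<Sum>i<n. \<bar>l1_coeff (X m) i - a i\<bar>) \<le> r / 2"
      using part[of "r / 2"] by auto
    have "dist (X m) (l1_of a) < r" if "m \<ge> M" for m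
    proof -
      have "norm (X m - l1_of a) \<le> r / 2"
        using M[OF that] by (intro norm_l1_leI) (simp add: l1_coeff_l1_of sa)
      then show ?thesis using \<open>r > 0\<close> by (simp add: dist_norm)
    qed
    then show "\<exists>M. \<forall>m\<ge>M. dist (X m) (l1_of a) < r" by blast
  qed
  then show "convergent X" by (auto simp: convergent_def)
qed

section \<open>Evaluation at a point of modulus less than one, a homomorphism of norm at most
  one\<close>

lemma l1_conv_radius: "1 \<le> fps_conv_radius (fps_of_l1 f)"
  unfolding fps_conv_radius_def
proof (rule conv_radius_geI_ex)
  fix r :: real assume r: "0 < r" "ereal r < 1"
  have "summable (\<lambda>n. l1_coeff f n * r ^ n)"
    by (rule summable_comparison_test'[OF summable_l1_coeff[of f], of 0])
       (use r in \<open>auto simp: abs_mult power_le_one mult_left_le\<close>)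
  then show "\<exists>z. norm z = r \<and> summable (\<lambda>n. l1_coeff f n * z ^ n)"
    using r by (intro exI[of _ r]) auto
qed

lemma in_l1_conv_radius: "\<bar>x :: real\<bar> < 1 \<Longrightarrow> ereal (norm x) < fps_conv_radius (fps_of_l1 f)"
  by (rule less_le_trans[OF _ l1_conv_radius]) (simp add: one_ereal_def)

definition l1_eval :: "real \<Rightarrow> l1 \<Rightarrow> real" where
  "l1_eval x f = eval_fps (fps_of_l1 f) x"

lemma
  assumes x: "\<bar>x\<bar> < 1"
  shows l1_eval_add: "l1_eval x (f + g) = l1_eval x f + l1_eval x g"
    and l1_eval_diff: "l1_eval x (f - g) = l1_eval x f - l1_eval x g"
    and l1_eval_mult: "l1_eval x (f * g) = l1_eval x f * l1_eval x g"
    and l1_eval_scaleR: "l1_eval x (c *\<^sub>R f) = c * l1_eval x f"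
    and l1_eval_of_real: "l1_eval x (of_real c) = c"
    and l1_eval_1: "l1_eval x 1 = 1"
    and l1_eval_power: "l1_eval x (f ^ n) = l1_eval x f ^ n"
proof -
  have r: "ereal (norm x) < fps_conv_radius (fps_const c)" for c :: real by simp
  note c = in_l1_conv_radius[OF x]
  show m: "l1_eval x (f * g) = l1_eval x f * l1_eval x g" for f g
    by (simp add: l1_eval_def eval_fps_mult[OF c c])
  show "l1_eval x (f + g) = l1_eval x f + l1_eval x g"
       "l1_eval x (f - g) = l1_eval x f - l1_eval x g"
       "l1_eval x (c *\<^sub>R f) = c * l1_eval x f" "l1_eval x (of_real c) = c"
    by (simp_all add: l1_eval_def eval_fps_add[OF c c] eval_fps_diff[OF c c] eval_fps_mult[OF r c])
  show 1: "l1_eval x 1 = 1" by (simp add: l1_eval_def)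
  show "l1_eval x (f ^ n) = l1_eval x f ^ n"
    by (induction n) (simp_all only: m 1 power_0 power_Suc)
qed

lemma abs_l1_eval_le:
  assumes x: "\<bar>x\<bar> < 1"
  shows "\<bar>l1_eval x f\<bar> \<le> norm f"
proof -
  have "\<bar>l1_coeff f n * x ^ n\<bar> \<le> \<bar>l1_coeff f n\<bar>" for n
    using x by (simp add: abs_mult power_abs power_le_one mult_left_le)
  then have "(\<Sum>n. \<bar>l1_coeff f n * x ^ n\<bar>) \<le> norm f" "summable (\<lambda>n. \<bar>l1_coeff f n * x ^ n\<bar>)"
    unfolding norm_l1_def
    using norm_summable_fps[OF in_l1_conv_radius[OF x], of f]
    by (auto intro!: suminf_le summable_l1_coeff)
  then show ?thesis
    unfolding l1_eval_def eval_fps_def using summable_rabs by (metis order_trans)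
qed

lemma bounded_linear_l1_eval: "\<bar>x\<bar> < 1 \<Longrightarrow> bounded_linear (l1_eval x)"
  by (rule bounded_linear_intro[of _ 1])
     (auto simp: l1_eval_add l1_eval_scaleR abs_l1_eval_le)

text \<open>The common shape of the inverse diagonal (\<open>d = 0\<close>) and of the first and
  second derivative composed with it (\<open>d = 1\<close>, \<open>d = 2\<close>). The derivatives
  alone have unbounded weights; the composites do not.\<close>

definition wshift :: "(nat \<Rightarrow> real) \<Rightarrow> nat \<Rightarrow> l1 \<Rightarrow> l1" where
  "wshift b d f = l1_of (\<lambda>n. b n * l1_coeff f (n + d))"

context
  fixes b :: "nat \<Rightarrow> real" and C :: real
  assumes b: "\<And>n. \<bar>b n\<bar> \<le> C"
begin

lemma l1_coeff_wshift: "l1_coeff (wshift b d f) n = b n * l1_coeff f (n + d)"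
proof -
  have "summable (\<lambda>n. C * \<bar>l1_coeff f (n + d)\<bar>)"
    by (intro summable_mult summable_ignore_initial_segment summable_l1_coeff)
  then have "summable (\<lambda>n. \<bar>b n * l1_coeff f (n + d)\<bar>)"
    by (rule summable_comparison_test'[of _ 0]) (simp add: abs_mult b mult_right_mono)
  then show ?thesis
    by (simp add: wshift_def l1_coeff_l1_of)
qed

lemma norm_wshift_le: "norm (wshift b d f) \<le> C * norm f"
proof (rule norm_l1_leI)
  fix n
  have C: "0 \<le> C" using b[of 0] by linarith
  have "(\<Sum>i<n. \<bar>l1_coeff (wshift b d f) i\<bar>) \<le> (\<Sum>i<n. C * \<bar>l1_coeff f (i + d)\<bar>)"
    by (intro sum_mono) (simp add: l1_coeff_wshift abs_mult b mult_right_mono)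
  also have "\<dots> = C * (\<Sum>i\<in>{d..<n + d}. \<bar>l1_coeff f i\<bar>)"
    using sum.shift_bounds_nat_ivl[of "\<lambda>i. \<bar>l1_coeff f i\<bar>" 0 d n]
    by (simp add: sum_distrib_left atLeast0LessThan)
  also have "\<dots> \<le> C * (\<Sum>i<n + d. \<bar>l1_coeff f i\<bar>)"
    by (intro mult_left_mono sum_mono2) (auto simp: C)
  also have "\<dots> \<le> C * norm f"
    by (intro mult_left_mono sum_abs_l1_coeff_le C)
  finally show "(\<Sum>i<n. \<bar>l1_coeff (wshift b d f) i\<bar>) \<le> C * norm f" .
qed

lemma bounded_linear_wshift: "bounded_linear (wshift b d)"
  by (rule bounded_linear_intro[of _ C])
     (auto intro!: l1_eqI norm_wshift_le simp: l1_coeff_wshift algebra_simps mult.commute[of _ C])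

end

definition l1_X :: l1 where "l1_X = Abs_l1 fps_X"

lemma fps_of_l1_X [simp]: "fps_of_l1 l1_X = fps_X"
  unfolding l1_X_def by (rule Abs_l1_inverse) (auto intro!: summable_finite[of "{1}"])

lemma norm_l1_X: "norm l1_X = 1"
proof -
  have "norm l1_X = (\<Sum>n\<in>{1}. \<bar>l1_coeff l1_X n\<bar>)"
    unfolding norm_l1_def by (rule suminf_finite) (auto simp: fps_X_def)
  then show ?thesis by (simp add: fps_X_def)
qed

lemma norm_l1_X_power: "norm (l1_X ^ k) \<le> 1"
  using norm_power_ineq[of l1_X k] by (simp add: norm_l1_X)

subsection \<open>Binomial series and local Lipschitz estimates\<close>

lemma norm_power_diff_le:
  fixes x y :: "'a::real_normed_algebra_1"
  assumes x: "norm x \<le> r" and y: "norm y \<le> r"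
  shows "norm (x ^ Suc n - y ^ Suc n) \<le> real (Suc n) * r ^ n * norm (x - y)"
proof (induction n)
  case (Suc n)
  have r: "0 \<le> r" using x norm_ge_zero order_trans by blast
  have yn: "norm (y ^ Suc n) \<le> r ^ Suc n"
    by (meson norm_ge_zero norm_power_ineq order_trans power_mono y)
  have "x ^ Suc (Suc n) - y ^ Suc (Suc n) = x * (x ^ Suc n - y ^ Suc n) + (x - y) * y ^ Suc n"
    by (simp add: algebra_simps)
  also have "norm \<dots> \<le> norm x * norm (x ^ Suc n - y ^ Suc n) + norm (x - y) * norm (y ^ Suc n)"
    by (meson add_mono norm_mult_ineq norm_triangle_le)
  also have "\<dots> \<le> r * (real (Suc n) * r ^ n * norm (x - y)) + norm (x - y) * r ^ Suc n"
    by (intro add_mono mult_mono Suc x yn) (use r in auto)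
  also have "\<dots> = real (Suc (Suc n)) * r ^ Suc n * norm (x - y)"
    by (simp add: algebra_simps)
  finally show ?case .
qed simp

text \<open>The derived series, summed with absolute values at \<open>r\<close>, serves as Lipschitz
  constant. It converges because \<open>r < K\<close> leaves room for an intermediate
  \<open>r'\<close> at which the differentiated series still converges.\<close>

lemma powser_bounded_lipschitz:
  fixes c :: "nat \<Rightarrow> real"
  assumes K: "summable (\<lambda>n. c n * K ^ n)" and r: "0 \<le> r" "r < K"
  obtains C where "C \<ge> 0"
    and "\<And>x::'a::{real_normed_algebra_1,banach}. norm x \<le> r \<Longrightarrow> summable (\<lambda>n. c n *\<^sub>R x ^ n)"
    and "\<And>x::'a. norm x \<le> r \<Longrightarrow> norm (\<Sum>n. c n *\<^sub>R x ^ n) \<le> C"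
    and "\<And>x y::'a. norm x \<le> r \<Longrightarrow> norm y \<le> r \<Longrightarrow>
      norm ((\<Sum>n. c n *\<^sub>R x ^ n) - (\<Sum>n. c n *\<^sub>R y ^ n)) \<le> C * norm (x - y)"
proof -
  have sc: "summable (\<lambda>n. \<bar>c n\<bar> * r ^ n)"
    using powser_insidea[OF K, of r] r by (simp add: abs_mult)
  obtain r' where r': "r < r'" "r' < K" using dense r by blast
  have "summable (\<lambda>n. diffs c n * r' ^ n)"
  proof (rule termdiff_converges[of _ K])
    show "norm r' < K" using r r' by simp
    show "summable (\<lambda>n. c n * x ^ n)" if "norm x < K" for x
      using powser_inside[OF K, of x] that by simp
  qed
  from powser_insidea[OF this, of r] r r'
  have sd: "summable (\<lambda>n. \<bar>diffs c n\<bar> * r ^ n)" by (simp add: abs_mult)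
  define C where "C = max (\<Sum>n. \<bar>c n\<bar> * r ^ n) (\<Sum>n. \<bar>diffs c n\<bar> * r ^ n)"
  have b: "norm (c n *\<^sub>R x ^ n) \<le> \<bar>c n\<bar> * r ^ n" if "norm x \<le> r" for x :: 'a and n
  proof -
    have "norm (x ^ n) \<le> r ^ n"
      by (meson norm_ge_zero norm_power_ineq order_trans power_mono that)
    then show ?thesis by (simp add: mult_left_mono)
  qed
  have sx: "summable (\<lambda>n. c n *\<^sub>R x ^ n)" if "norm x \<le> r" for x :: 'a
    by (rule summable_comparison_test'[OF sc, of 0]) (rule b[OF that])
  have bd: "norm (\<Sum>n. c n *\<^sub>R x ^ n) \<le> C" if "norm x \<le> r" for x :: 'a
    using norm_suminf_le[of "\<lambda>n. c n *\<^sub>R x ^ n", OF b[OF that] sc] by (simp add: C_def)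
  have lip: "norm ((\<Sum>n. c n *\<^sub>R x ^ n) - (\<Sum>n. c n *\<^sub>R y ^ n)) \<le> C * norm (x - y)"
    if x: "norm x \<le> r" and y: "norm y \<le> r" for x y :: 'a
  proof -
    have s: "summable (\<lambda>n. c n *\<^sub>R (x ^ n - y ^ n))"
      using summable_diff[OF sx[OF x] sx[OF y]] by (simp add: scaleR_diff_right)
    have b': "norm (c (Suc n) *\<^sub>R (x ^ Suc n - y ^ Suc n)) \<le> \<bar>diffs c n\<bar> * r ^ n * norm (x - y)" for n
    proof -
      have "norm (c (Suc n) *\<^sub>R (x ^ Suc n - y ^ Suc n))
          \<le> \<bar>c (Suc n)\<bar> * (real (Suc n) * r ^ n * norm (x - y))"
        unfolding norm_scaleR by (rule mult_left_mono[OF norm_power_diff_le[OF x y]]) simp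
      then show ?thesis by (simp only: diffs_def abs_mult abs_of_nat mult.assoc mult.left_commute)
    qed
    have "(\<Sum>n. c n *\<^sub>R x ^ n) - (\<Sum>n. c n *\<^sub>R y ^ n) = (\<Sum>n. c n *\<^sub>R (x ^ n - y ^ n))"
      by (simp add: suminf_diff[OF sx[OF x] sx[OF y]] scaleR_diff_right)
    also have "\<dots> = (\<Sum>n. c (Suc n) *\<^sub>R (x ^ Suc n - y ^ Suc n))"
      using suminf_split_head[OF s] by simp
    also have "norm \<dots> \<le> (\<Sum>n. \<bar>diffs c n\<bar> * r ^ n * norm (x - y))"
      by (rule norm_suminf_le[OF b']) (intro summable_mult2 sd)
    also have "\<dots> = (\<Sum>n. \<bar>diffs c n\<bar> * r ^ n) * norm (x - y)"
      by (rule suminf_mult2[OF sd, symmetric])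
    also have "\<dots> \<le> C * norm (x - y)"
      by (intro mult_right_mono) (auto simp: C_def)
    finally show ?thesis .
  qed
  have "C \<ge> 0" using order_trans[OF norm_ge_zero bd[of 0]] r by simp
  from that[OF this sx bd lip] show ?thesis by blast
qed

text \<open>The second-order Taylor remainder of \<open>(1 + y) powr r\<close> divided by
  \<open>y^2\<close>. With \<open>y\<close> a multiple of \<open>s\<close>, the remainder carries
  the factor \<open>s^2\<close>, so one factor \<open>s\<close> survives the division of the
  equation by \<open>s\<close>.\<close>

definition pow_tail :: "real \<Rightarrow> l1 \<Rightarrow> l1" where
  "pow_tail r y = (\<Sum>n. (r gchoose (n + 2)) *\<^sub>R y ^ n)"

lemma gbinomial_tail_summable: "summable (\<lambda>n. (r gchoose (n + 2)) * (3/4 :: real) ^ n)"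
proof -
  have "summable (\<lambda>n. (r gchoose n) * (3/4 :: real) ^ n)"
    using gen_binomial_real[of "3/4" r] by (simp add: sums_iff)
  \<comment> \<open>The factor 16/9 is the inverse square of 3/4 and undoes the index shift; 3/4
    itself is just a number between the radius 1/2 used below and the convergence radius 1.\<close>
  then have "summable (\<lambda>n. (r gchoose (n + 2)) * (3/4 :: real) ^ (n + 2) * (16/9))"
    by (intro summable_mult2 summable_ignore_initial_segment)
  then show ?thesis by (simp add: power2_eq_square power_add algebra_simps)
qed

lemma pow_tail_bounded_lipschitz:
  obtains C where "C \<ge> 0" and "\<And>x. norm x \<le> 1/2 \<Longrightarrow> norm (pow_tail r x) \<le> C"
    and "\<And>x y. norm x \<le> 1/2 \<Longrightarrow> norm y \<le> 1/2 \<Longrightarrow>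
      norm (pow_tail r x - pow_tail r y) \<le> C * norm (x - y)"
proof (rule powser_bounded_lipschitz[OF gbinomial_tail_summable[of r], of "1/2", where ?'a = l1])
  fix C
  assume "C \<ge> 0"
    and "\<And>x::l1. norm x \<le> 1/2 \<Longrightarrow> norm (\<Sum>n. (r gchoose (n + 2)) *\<^sub>R x ^ n) \<le> C"
    and "\<And>x y::l1. norm x \<le> 1/2 \<Longrightarrow> norm y \<le> 1/2 \<Longrightarrow>
      norm ((\<Sum>n. (r gchoose (n + 2)) *\<^sub>R x ^ n) - (\<Sum>n. (r gchoose (n + 2)) *\<^sub>R y ^ n))
        \<le> C * norm (x - y)"
  then show thesis by (intro that[of C]) (auto simp: pow_tail_def)
qed auto

text \<open>Evaluation is a continuous algebra homomorphism, so it carries the series in the algebra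
  to the real binomial series; \<open>norm y <= 1/2\<close> puts the value inside the interval of
  convergence.\<close>

lemma l1_eval_pow_tail:
  assumes x: "\<bar>x\<bar> < 1" and y: "norm y \<le> 1/2"
  defines "v \<equiv> l1_eval x y"
  shows "(1 + v) powr r = 1 + r * v + v\<^sup>2 * l1_eval x (pow_tail r y)"
proof -
  have v: "\<bar>v\<bar> < 1" using abs_l1_eval_le[OF x, of y] y by (simp add: v_def)
  have s: "summable (\<lambda>n. (r gchoose (n + 2)) *\<^sub>R y ^ n)"
    using powser_bounded_lipschitz[OF gbinomial_tail_summable[of r], of "1/2", where ?'a = l1] y
    by (simp, blast)
  have e: "(\<lambda>n. (r gchoose (n + 2)) * v ^ n) sums l1_eval x (pow_tail r y)"
    using bounded_linear.sums[OF bounded_linear_l1_eval[OF x] summable_sums[OF s]]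
    by (simp add: l1_eval_scaleR l1_eval_power x v_def pow_tail_def)
  have "(\<lambda>n. (r gchoose (n + 2)) * v ^ (n + 2)) sums (v\<^sup>2 * l1_eval x (pow_tail r y))"
    using sums_mult[OF e, of "v\<^sup>2"] by (simp add: power_add power2_eq_square algebra_simps)
  moreover have "(\<lambda>n. (r gchoose (n + 2)) * v ^ (n + 2)) sums ((1 + v) powr r - (\<Sum>n<2. (r gchoose n) * v ^ n))"
    by (intro sums_split_initial_segment gen_binomial_real v)
  ultimately have "v\<^sup>2 * l1_eval x (pow_tail r y) = (1 + v) powr r - (\<Sum>n<2. (r gchoose n) * v ^ n)"
    by (rule sums_unique2)
  then show ?thesis by (simp add: numeral_2_eq_2)
qed

text \<open>Only the range of \<open>s\<close> is allowed to shrink. The ball for \<open>u\<close>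
  stays fixed, since the contraction runs on a ball whose radius must not depend on the nonlinear
  remainder.\<close>

abbreviation near_box :: "real \<Rightarrow> (real \<times> l1) set" where
  "near_box e \<equiv> cball 0 e \<times> cball 0 1"

text \<open>
  The estimates are joint in \<open>(s, u)\<close>: for fixed \<open>s\<close> they give the contraction in \<open>u\<close>, for fixed \<open>u\<close> the
  continuity of the fixed point in \<open>s\<close>.
\<close>

definition near_lip :: "(real \<times> l1 \<Rightarrow> 'b::real_normed_vector) \<Rightarrow> bool" where
  "near_lip f \<longleftrightarrow> (\<exists>e>0. \<exists>C\<ge>0. \<forall>x \<in> near_box e. \<forall>y \<in> near_box e.
     norm (f x) \<le> C \<and> norm (f x - f y) \<le> C * norm (x - y))"

lemma near_lipE:
  assumes "near_lip f"
  obtains e C where "e > 0" "C \<ge> 0"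
    and "\<And>x. x \<in> near_box e \<Longrightarrow> norm (f x) \<le> C"
    and "\<And>x y. x \<in> near_box e \<Longrightarrow> y \<in> near_box e \<Longrightarrow>
      norm (f x - f y) \<le> C * norm (x - y)"
  using assms unfolding near_lip_def by metis

lemma near_lipI:
  assumes "e > 0" "C \<ge> 0"
    and "\<And>x. x \<in> near_box e \<Longrightarrow> norm (f x) \<le> C"
    and "\<And>x y. x \<in> near_box e \<Longrightarrow> y \<in> near_box e \<Longrightarrow>
      norm (f x - f y) \<le> C * norm (x - y)"
  shows "near_lip f"
  using assms unfolding near_lip_def by blast

lemma near_lip2E:
  assumes "near_lip f" "near_lip g"
  obtains e C where "e > 0" "C \<ge> 0"
    and "\<And>x. x \<in> near_box e \<Longrightarrow> norm (f x) \<le> C"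
    and "\<And>x y. x \<in> near_box e \<Longrightarrow> y \<in> near_box e \<Longrightarrow>
      norm (f x - f y) \<le> C * norm (x - y)"
    and "\<And>x. x \<in> near_box e \<Longrightarrow> norm (g x) \<le> C"
    and "\<And>x y. x \<in> near_box e \<Longrightarrow> y \<in> near_box e \<Longrightarrow>
      norm (g x - g y) \<le> C * norm (x - y)"
proof -
  obtain e C where f: "e > 0" "C \<ge> 0" "\<And>x. x \<in> near_box e \<Longrightarrow> norm (f x) \<le> C"
    "\<And>x y. x \<in> near_box e \<Longrightarrow> y \<in> near_box e \<Longrightarrow>
      norm (f x - f y) \<le> C * norm (x - y)"
    using near_lipE[OF assms(1)] by blast
  obtain e' C' where g: "e' > 0" "C' \<ge> 0" "\<And>x. x \<in> near_box e' \<Longrightarrow> norm (g x) \<le> C'"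
    "\<And>x y. x \<in> near_box e' \<Longrightarrow> y \<in> near_box e' \<Longrightarrow>
      norm (g x - g y) \<le> C' * norm (x - y)"
    using near_lipE[OF assms(2)] by blast
  have sub: "x \<in> near_box e" "x \<in> near_box e'"
    if "x \<in> near_box (min e e')" for x
    using that by (auto simp: mem_Times_iff)
  have le: "C * norm z \<le> max C C' * norm z" "C' * norm z \<le> max C C' * norm z" for z :: "real \<times> l1"
    by (auto intro: mult_right_mono)
  show ?thesis
  proof (rule that[of "min e e'" "max C C'"])
    fix x y assume x: "x \<in> near_box (min e e')" and y: "y \<in> near_box (min e e')"
    show "norm (f x - f y) \<le> max C C' * norm (x - y)"
      using f(4)[OF sub(1)[OF x] sub(1)[OF y]] le(1)[of "x - y"] by linarith
    show "norm (g x - g y) \<le> max C C' * norm (x - y)"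
      using g(4)[OF sub(2)[OF x] sub(2)[OF y]] le(2)[of "x - y"] by linarith
  next
    fix x assume x: "x \<in> near_box (min e e')"
    show "norm (f x) \<le> max C C'" "norm (g x) \<le> max C C'"
      using f(3)[OF sub(1)[OF x]] g(3)[OF sub(2)[OF x]] by auto
  qed (use f g in auto)
qed

lemma near_lip_add:
  assumes "near_lip f" "near_lip g"
  shows "near_lip (\<lambda>x. f x + g x)"
proof (rule near_lip2E[OF assms])
  fix e C assume *: "e > 0" "C \<ge> 0"
    "\<And>x. x \<in> near_box e \<Longrightarrow> norm (f x) \<le> C"
    "\<And>x y. x \<in> near_box e \<Longrightarrow> y \<in> near_box e \<Longrightarrow>
      norm (f x - f y) \<le> C * norm (x - y)"
    "\<And>x. x \<in> near_box e \<Longrightarrow> norm (g x) \<le> C"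
    "\<And>x y. x \<in> near_box e \<Longrightarrow> y \<in> near_box e \<Longrightarrow>
      norm (g x - g y) \<le> C * norm (x - y)"
  show ?thesis
  proof (rule near_lipI[of e "2 * C"])
    fix x y assume x: "x \<in> near_box e" and y: "y \<in> near_box e"
    have "norm (f x + g x - (f y + g y)) \<le> norm (f x - f y) + norm (g x - g y)"
      by (rule norm_diff_triangle_ineq)
    also have "\<dots> \<le> 2 * C * norm (x - y)" using *(4)[OF x y] *(6)[OF x y] by linarith
    finally show "norm (f x + g x - (f y + g y)) \<le> 2 * C * norm (x - y)" .
  next
    fix x assume x: "x \<in> near_box e"
    show "norm (f x + g x) \<le> 2 * C"
      using norm_triangle_ineq[of "f x" "g x"] *(3)[OF x] *(5)[OF x] by linarith
  qed (use * in auto)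
qed

lemma near_lip_mult:
  fixes f g :: "real \<times> l1 \<Rightarrow> 'b::real_normed_algebra"
  assumes "near_lip f" "near_lip g"
  shows "near_lip (\<lambda>x. f x * g x)"
proof (rule near_lip2E[OF assms])
  fix e C assume *: "e > 0" "C \<ge> 0"
    "\<And>x. x \<in> near_box e \<Longrightarrow> norm (f x) \<le> C"
    "\<And>x y. x \<in> near_box e \<Longrightarrow> y \<in> near_box e \<Longrightarrow>
      norm (f x - f y) \<le> C * norm (x - y)"
    "\<And>x. x \<in> near_box e \<Longrightarrow> norm (g x) \<le> C"
    "\<And>x y. x \<in> near_box e \<Longrightarrow> y \<in> near_box e \<Longrightarrow>
      norm (g x - g y) \<le> C * norm (x - y)"
  define D where "D = 2 * C * C"
  have D: "C * C \<le> D" "0 \<le> D" using *(2) by (auto simp: D_def)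
  show ?thesis
  proof (rule near_lipI[of e D])
    fix x y assume x: "x \<in> near_box e" and y: "y \<in> near_box e"
    have "f x * g x - f y * g y = f x * (g x - g y) + (f x - f y) * g y" by (simp add: algebra_simps)
    also have "norm \<dots> \<le> norm (f x) * norm (g x - g y) + norm (f x - f y) * norm (g y)"
      by (meson add_mono norm_mult_ineq norm_triangle_le)
    also have "\<dots> \<le> C * (C * norm (x - y)) + (C * norm (x - y)) * C"
      by (intro add_mono mult_mono *(3)[OF x] *(4)[OF x y] *(5)[OF y] *(6)[OF x y]) (use * in auto)
    finally show "norm (f x * g x - f y * g y) \<le> D * norm (x - y)"
      by (simp add: D_def algebra_simps)
  next
    fix x assume x: "x \<in> near_box e"
    have "norm (f x * g x) \<le> norm (f x) * norm (g x)" by (rule norm_mult_ineq)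
    also have "\<dots> \<le> C * C" by (intro mult_mono *(3)[OF x] *(5)[OF x]) (use * in auto)
    finally show "norm (f x * g x) \<le> D" using D by linarith
  qed (use * D in auto)
qed

lemma near_lip_const: "near_lip (\<lambda>x. c)"
  by (rule near_lipI[of 1 "norm c"]) (simp_all add: zero_le_mult_iff)

lemma near_lip_linear:
  assumes T: "bounded_linear T" and f: "near_lip f"
  shows "near_lip (\<lambda>x. T (f x))"
proof (rule near_lipE[OF f])
  fix e C assume *: "e > 0" "C \<ge> 0"
    "\<And>x. x \<in> near_box e \<Longrightarrow> norm (f x) \<le> C"
    "\<And>x y. x \<in> near_box e \<Longrightarrow> y \<in> near_box e \<Longrightarrow>
      norm (f x - f y) \<le> C * norm (x - y)"
  obtain K where K: "K \<ge> 0" "\<And>z. norm (T z) \<le> norm z * K"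
    using bounded_linear.nonneg_bounded[OF T] by blast
  have d: "T (f x) - T (f y) = T (f x - f y)" for x y
    by (simp add: bounded_linear.linear[OF T] linear_diff)
  show ?thesis
  proof (rule near_lipI[of e "C * K"])
    fix x y assume x: "x \<in> near_box e" and y: "y \<in> near_box e"
    have "norm (T (f x - f y)) \<le> norm (f x - f y) * K" by (rule K)
    also have "\<dots> \<le> C * norm (x - y) * K" by (intro mult_right_mono *(4) x y K)
    finally show "norm (T (f x) - T (f y)) \<le> C * K * norm (x - y)"
      by (simp add: d algebra_simps)
  next
    fix x assume x: "x \<in> near_box e"
    show "norm (T (f x)) \<le> C * K" using K(2)[of "f x"] mult_right_mono[OF *(3)[OF x] K(1)] by linarith
  qed (use * K in auto)
qed

lemma near_lip_fst: "near_lip (\<lambda>x. of_real (fst x) :: l1)"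
proof (rule near_lipI[of 1 1])
  fix x y :: "real \<times> l1"
  show "norm (of_real (fst x) - of_real (fst y) :: l1) \<le> 1 * norm (x - y)"
    using norm_fst_le[of "fst (x - y)" "snd (x - y)"]
    unfolding prod.collapse by (simp flip: of_real_diff)
qed auto

lemma near_lip_snd: "near_lip snd"
proof (rule near_lipI[of 1 1])
  fix x y :: "real \<times> l1"
  show "norm (snd x - snd y) \<le> 1 * norm (x - y)"
    using norm_snd_le[of "snd (x - y)" "fst (x - y)"]
    unfolding prod.collapse by (simp)
qed auto

text \<open>The factor \<open>s\<close> compensates any bound on \<open>f\<close>. This places the
  arguments of the binomial series in the half ball on which \<open>pow_tail\<close> is bounded and
  Lipschitz.\<close>

lemma near_lip_small:
  fixes f :: "real \<times> l1 \<Rightarrow> l1"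
  assumes "near_lip f"
  obtains e where "e > 0" "\<And>x. x \<in> near_box e \<Longrightarrow> norm (of_real (fst x) * f x) \<le> 1/2"
proof (rule near_lipE[OF assms])
  fix e C assume *: "e > 0" "C \<ge> 0"
    "\<And>x. x \<in> near_box e \<Longrightarrow> norm (f x) \<le> C"
  define e' where "e' = min e (1 / (2 * (C + 1)))"
  show ?thesis
  proof (rule that[of e'])
    show "e' > 0" using * by (simp add: e'_def)
    fix x assume x: "x \<in> near_box e'"
    have "\<bar>fst x\<bar> \<le> e'" "e' \<le> e" using x by (auto simp: e'_def mem_Times_iff)
    have "norm (of_real (fst x) * f x) \<le> \<bar>fst x\<bar> * norm (f x)"
      using norm_mult_ineq[of "of_real (fst x)" "f x"] by simp
    also have "\<dots> \<le> e' * C"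
      using \<open>\<bar>fst x\<bar> \<le> e'\<close> \<open>e' \<le> e\<close> *(3)[of x] x * by (intro mult_mono) (auto simp: mem_Times_iff)
    also have "\<dots> \<le> (1 / (2 * (C + 1))) * C" using * by (intro mult_right_mono) (auto simp: e'_def)
    also have "\<dots> \<le> 1 / 2" using * by (simp add: field_simps)
    finally show "norm (of_real (fst x) * f x) \<le> 1/2" .
  qed
qed

lemma near_lip_pow_tail:
  assumes f: "near_lip f"
  shows "near_lip (\<lambda>x. pow_tail r (of_real (fst x) * f x))"
proof -
  obtain e1 where e1: "e1 > 0" "\<And>x. x \<in> near_box e1 \<Longrightarrow> norm (of_real (fst x) * f x) \<le> 1/2"
    using near_lip_small[OF f] by blast
  obtain e2 C where e2: "e2 > 0" "C \<ge> 0"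
    "\<And>x. x \<in> near_box e2 \<Longrightarrow> norm (of_real (fst x) * f x) \<le> C"
    "\<And>x y. x \<in> near_box e2 \<Longrightarrow> y \<in> near_box e2 \<Longrightarrow>
      norm (of_real (fst x) * f x - of_real (fst y) * f y) \<le> C * norm (x - y)"
    using near_lipE[OF near_lip_mult[OF near_lip_fst f]] by blast
  obtain L where L: "L \<ge> 0" "\<And>x. norm x \<le> 1/2 \<Longrightarrow> norm (pow_tail r x) \<le> L"
    "\<And>x y. norm x \<le> 1/2 \<Longrightarrow> norm y \<le> 1/2 \<Longrightarrow> norm (pow_tail r x - pow_tail r y) \<le> L * norm (x - y)"
    using pow_tail_bounded_lipschitz by blast
  show ?thesis
  proof (rule near_lipI[of "min e1 e2" "max L (L * C)"])
    fix x y assume "x \<in> near_box (min e1 e2)" "y \<in> near_box (min e1 e2)"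
    then have x: "x \<in> near_box e1" "x \<in> near_box e2"
      and y: "y \<in> near_box e1" "y \<in> near_box e2"
      by (auto simp: mem_Times_iff)
    have "norm (pow_tail r (of_real (fst x) * f x) - pow_tail r (of_real (fst y) * f y))
        \<le> L * (C * norm (x - y))"
      by (rule order_trans[OF L(3)[OF e1(2)[OF x(1)] e1(2)[OF y(1)]] mult_left_mono[OF e2(4)[OF x(2) y(2)] L(1)]])
    also have "\<dots> \<le> max L (L * C) * norm (x - y)"
      by (simp add: mult_right_mono flip: mult.assoc)
    finally show "norm (pow_tail r (of_real (fst x) * f x) - pow_tail r (of_real (fst y) * f y))
        \<le> max L (L * C) * norm (x - y)" .
  next
    fix x assume "x \<in> near_box (min e1 e2)"
    then have "x \<in> near_box e1" by (auto simp: mem_Times_iff)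
    from L(2)[OF e1(2)[OF this]]
    show "norm (pow_tail r (of_real (fst x) * f x)) \<le> max L (L * C)" by simp
  qed (use e1 e2 L in auto)
qed

text \<open>\<open>A\<close> uses three quarters of the radius and has Lipschitz constant 1/2; for
  small \<open>s\<close> the perturbation adds at most \<open>r/4\<close> to the norm and 1/4 to the
  constant, so Banach's theorem applies with constant 3/4. The bound \<open>r <= 1\<close> keeps the
  ball inside \<open>near_box\<close>.\<close>

lemma contraction_branch:
  fixes A :: "l1 \<Rightarrow> l1"
  assumes G: "near_lip G" and r: "0 < r" "r \<le> 1"
    and A1: "\<And>u. norm u \<le> r \<Longrightarrow> norm (A u) \<le> 3/4 * r"
    and A2: "\<And>u v. norm u \<le> r \<Longrightarrow> norm v \<le> r \<Longrightarrow> norm (A u - A v) \<le> norm (u - v) / 2"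
  obtains e U where "e > 0"
    and "\<And>s. \<bar>s\<bar> < e \<Longrightarrow> norm (U s) \<le> r \<and> U s = A (U s) + s *\<^sub>R G (s, U s)"
    and "continuous_on {-e<..<e} U"
proof (rule near_lipE[OF G])
  fix e0 C assume *: "e0 > 0" "C \<ge> 0"
    "\<And>x. x \<in> near_box e0 \<Longrightarrow> norm (G x) \<le> C"
    "\<And>x y. x \<in> near_box e0 \<Longrightarrow> y \<in> near_box e0 \<Longrightarrow>
      norm (G x - G y) \<le> C * norm (x - y)"
  \<comment> \<open>Makes \<open>e * C <= r/4\<close>; the summand 1 avoids division by zero when
    \<open>C = 0\<close>.\<close>
  define e where "e = min e0 (r / (4 * (C + 1)))"
  have e: "e > 0" "e \<le> e0" using * r by (auto simp: e_def)
  have eC: "e * C \<le> r / 4"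
  proof -
    have "e * C \<le> r / (4 * (C + 1)) * C" using * by (intro mult_right_mono) (auto simp: e_def)
    also have "\<dots> \<le> r / 4" using * r by (simp add: field_simps)
    finally show ?thesis .
  qed
  have dom: "(s, u) \<in> near_box e0" if "\<bar>s\<bar> < e" "norm u \<le> r" for s u
    using that e r by auto
  define F where "F s u = A u + s *\<^sub>R G (s, u)" for s u
  have F1: "norm (F s u) \<le> r" if s: "\<bar>s\<bar> < e" and u: "norm u \<le> r" for s u
  proof -
    have "norm (F s u) \<le> norm (A u) + \<bar>s\<bar> * norm (G (s, u))"
      unfolding F_def by (metis norm_scaleR norm_triangle_ineq)
    also have "\<dots> \<le> 3/4 * r + e * C"
      using s e * by (intro add_mono A1 u mult_mono *(3)[OF dom[OF s u]]) auto
    finally show ?thesis using eC by linarith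
  qed
  have F2: "norm (F s u - F s v) \<le> 3/4 * norm (u - v)"
    if s: "\<bar>s\<bar> < e" and u: "norm u \<le> r" and v: "norm v \<le> r" for s u v
  proof -
    have "F s u - F s v = (A u - A v) + s *\<^sub>R (G (s, u) - G (s, v))"
      by (simp add: F_def algebra_simps)
    then have "norm (F s u - F s v) \<le> norm (A u - A v) + \<bar>s\<bar> * norm (G (s, u) - G (s, v))"
      by (metis norm_scaleR norm_triangle_ineq)
    also have "\<dots> \<le> norm (u - v) / 2 + e * (C * norm ((s, u) - (s, v)))"
      using s e * by (intro add_mono A2 u v mult_mono *(4)[OF dom[OF s u] dom[OF s v]]) auto
    also have "\<dots> = norm (u - v) / 2 + e * C * norm (u - v)" by (simp add: norm_Pair)
    also have "\<dots> \<le> norm (u - v) / 2 + r / 4 * norm (u - v)"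
      by (intro add_left_mono mult_right_mono eC) auto
    also have "r / 4 * norm (u - v) \<le> 1 / 4 * norm (u - v)"
      using r by (intro mult_right_mono) auto
    finally show ?thesis by simp
  qed
  have "\<exists>u. norm u \<le> r \<and> F s u = u" if s: "\<bar>s\<bar> < e" for s
  proof -
    have "\<exists>!u. u \<in> cball 0 r \<and> F s u = u"
    proof (rule Banach_fix)
      show "complete (cball (0::l1) r)" by (simp add: complete_eq_closed)
      show "F s ` cball 0 r \<subseteq> cball 0 r" using F1[OF s] by auto
      show "\<And>x y. x \<in> cball 0 r \<Longrightarrow> y \<in> cball 0 r \<Longrightarrow> dist (F s x) (F s y) \<le> 3/4 * dist x y"
        using F2[OF s] by (simp add: dist_norm)
    qed (use r in auto)
    then show ?thesis by auto
  qed
  then obtain U where U: "\<And>s. \<bar>s\<bar> < e \<Longrightarrow> norm (U s) \<le> r \<and> F s (U s) = U s" by metis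
  \<comment> \<open>Continuous dependence of the fixed point: inserting \<open>F s (U t)\<close>
    bounds the distance by three quarters of itself plus the change of the map in \<open>s\<close>.
    Absorbing the first part costs the factor 4.\<close>
  have lip: "norm (U s - U t) \<le> 4 * (C + e * C) * \<bar>s - t\<bar>" if s: "\<bar>s\<bar> < e" and t: "\<bar>t\<bar> < e" for s t
  proof -
    have "norm (F s (U t) - F t (U t)) = norm ((s - t) *\<^sub>R G (s, U t) + t *\<^sub>R (G (s, U t) - G (t, U t)))"
      by (simp add: F_def algebra_simps)
    also have "\<dots> \<le> \<bar>s - t\<bar> * norm (G (s, U t)) + \<bar>t\<bar> * norm (G (s, U t) - G (t, U t))"
      by (metis norm_scaleR norm_triangle_ineq)
    also have "\<dots> \<le> \<bar>s - t\<bar> * C + e * (C * norm ((s, U t) - (t, U t)))"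
      using s t e * U[OF t] by (intro add_mono mult_mono *(3)[OF dom] *(4)[OF dom dom]) auto
    also have "\<dots> = (C + e * C) * \<bar>s - t\<bar>" by (simp add: norm_Pair algebra_simps)
    finally have 1: "norm (F s (U t) - F t (U t)) \<le> (C + e * C) * \<bar>s - t\<bar>" .
    have "norm (U s - U t) = norm ((F s (U s) - F s (U t)) + (F s (U t) - F t (U t)))"
      using U[OF s] U[OF t] by simp
    also have "\<dots> \<le> 3/4 * norm (U s - U t) + (C + e * C) * \<bar>s - t\<bar>"
      using F2[OF s, of "U s" "U t"] U[OF s] U[OF t] 1
      by (intro order_trans[OF norm_triangle_ineq] add_mono) auto
    finally show ?thesis by (simp add: algebra_simps)
  qed
  have "(4 * (C + e * C))-lipschitz_on {-e<..<e} U"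
    using lip e * by (intro lipschitz_onI) (auto simp: dist_norm abs_less_iff)
  then have "continuous_on {-e<..<e} U" by (rule lipschitz_on_continuous_on)
  moreover have "norm (U s) \<le> r \<and> U s = A (U s) + s *\<^sub>R G (s, U s)" if "\<bar>s\<bar> < e" for s
    using U[OF that] by (simp add: F_def)
  ultimately show ?thesis using that e by blast
qed

subsection \<open>Bifurcation for the zonal equation\<close>

lemma l1_eval_X: "l1_eval x l1_X = x"
  by (simp add: l1_eval_def)

text \<open>The identity theorem on a one-sided interval: the value at 0 is recovered as a right
  limit, and differentiation passes to the next coefficient with constant 0. It serves to show that
  the solutions found are not constant.\<close>

lemma eval_fps_constant_imp_nth:
  fixes F :: "real fps"
  assumes "0 < r" "r \<le> 1" "1 \<le> fps_conv_radius F"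
    and "\<And>x. 0 < x \<Longrightarrow> x < r \<Longrightarrow> eval_fps F x = c"
  shows "fps_nth F n = (if n = 0 then c else 0)"
  using assms
proof (induction n arbitrary: F c)
  case 0
  have "ereal (norm (0::real)) < fps_conv_radius F"
    by (rule less_le_trans[OF _ 0(3)]) (simp add: one_ereal_def)
  then have cont: "isCont (eval_fps F) 0"
    by (rule continuous_eval_fps)
  have "eval_fps F 0 = c"
  proof (rule tendsto_unique)
    show "(eval_fps F \<longlongrightarrow> eval_fps F 0) (at_right 0)"
      using cont by (simp add: isCont_def filterlim_at_split)
    have "eventually (\<lambda>x. eval_fps F x = c) (at_right 0)"
      unfolding eventually_at_right_field using 0 by blast
    then show "(eval_fps F \<longlongrightarrow> c) (at_right 0)"
      by (rule tendsto_eventually)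
  qed simp
  then show ?case by (simp add: eval_fps_at_0)
next
  case (Suc n)
  have "eval_fps (fps_deriv F) x = 0" if x: "0 < x" "x < r" for x
  proof -
    have "ereal (norm x) < 1" using x Suc.prems(2) by (simp add: one_ereal_def)
    then have "ereal (norm x) < fps_conv_radius F" using Suc.prems(3) by (rule less_le_trans)
    then have "(eval_fps F has_field_derivative eval_fps (fps_deriv F) x) (at x)"
      by (rule has_field_derivative_eval_fps)
    moreover have "(eval_fps F has_field_derivative 0) (at x)"
      by (rule has_field_derivative_transform_within_open[of "\<lambda>_. c" 0 x "{0<..<r}"])
         (use x in \<open>simp_all add: Suc.prems(4)\<close>)
    ultimately show ?thesis by (rule DERIV_unique)
  qed
  moreover have "1 \<le> fps_conv_radius (fps_deriv F)"
    using Suc.prems(3) fps_conv_radius_deriv order_trans by blast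
  ultimately have "fps_nth (fps_deriv F) n = (if n = 0 then 0 else 0)"
    by (intro Suc.IH Suc.prems(1,2))
  then show ?case by simp
qed

section \<open>The linearized operator in power series coordinates\<close>

locale zonal =
  fixes N k :: nat
  assumes N2: "2 \<le> N" and k1: "1 \<le> k"
begin

text \<open>Chosen so that \<open>R^2 = 16 (k+1)^2\<close>: the factor \<open>(k+1)^2\<close>
  cancels the loss in the third estimate of \<open>\<delta>_bounds\<close>, and 16 makes the norm of
  \<open>shift_op\<close> at most 1/16.\<close>

definition R :: real where "R = 4 * (real k + 1)"
text \<open>Since L t^n = n (n-1) t^(n-2) - \<open>eig n\<close> t^n, these are the negatives of the
  diagonal entries of L, and also the eigenvalues of minus the Laplace-Beltrami operator.\<close>

definition eig :: "nat \<Rightarrow> real" where "eig n = real n * (real n + real N - 2)"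
definition \<delta> :: "nat \<Rightarrow> real" where "\<delta> n = eig n - eig k"

lemma R: "R \<ge> 8" "R\<^sup>2 = 16 * (real k + 1)\<^sup>2"
  using k1 by (auto simp: R_def power2_eq_square algebra_simps)

lemma \<delta>_eq: "\<delta> n = (real n - real k) * (real n + real k + real N - 2)"
  by (simp add: \<delta>_def eig_def algebra_simps)

lemma \<delta>_k: "\<delta> k = 0" by (simp add: \<delta>_def)

text \<open>The factorization of \<open>\<delta> n\<close> has first factor of modulus at least 1.
  The second estimate bounds one derivative after division by \<open>\<delta>\<close>, the third
  bounds two; for \<open>n > k\<close> the latter rests on n <= (k+1)(n-k), with equality at n =
  k+1.\<close>

lemma \<delta>_bounds:
  assumes "n \<noteq> k"
  shows "\<bar>\<delta> n\<bar> \<ge> 1" "\<bar>\<delta> n\<bar> \<ge> real n" "real n * (real n - 1) \<le> (real k + 1)\<^sup>2 * \<bar>\<delta> n\<bar>"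
proof -
  have d: "\<bar>real n - real k\<bar> \<ge> 1" using assms by linarith
  have s: "real n + real k + real N - 2 \<ge> real n + real k" "real n + real k \<ge> 1"
    using N2 k1 by auto
  have "\<bar>\<delta> n\<bar> \<ge> 1 * (real n + real k)"
    unfolding \<delta>_eq abs_mult using d s by (intro mult_mono) auto
  then show 1: "\<bar>\<delta> n\<bar> \<ge> 1" and 2: "\<bar>\<delta> n\<bar> \<ge> real n" using s by auto
  show "real n * (real n - 1) \<le> (real k + 1)\<^sup>2 * \<bar>\<delta> n\<bar>"
  proof (cases "n < k")
    case True
    have "real n * (real n - 1) \<le> real n * real n" by (intro mult_left_mono) auto
    also have "\<dots> \<le> (real k + 1) * (real k + 1)" using True by (intro mult_mono) auto
    also have "\<dots> \<le> (real k + 1) * (real k + 1) * \<bar>\<delta> n\<bar>"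
      using mult_left_mono[OF 1, of "(real k + 1) * (real k + 1)"] by simp
    finally show ?thesis by (simp add: power2_eq_square)
  next
    case False
    then have nk: "real n \<ge> real k + 1" using assms by linarith
    have a: "real n \<le> (real k + 1) * (real n - real k)"
    proof -
      have "0 \<le> real k * (real n - real k - 1)" using nk by (intro mult_nonneg_nonneg) auto
      then show ?thesis by (simp add: algebra_simps)
    qed
    have "real n * (real n - 1) \<le> ((real k + 1) * (real n - real k)) * (real n + real k + real N - 2)"
      using a s nk by (intro mult_mono) auto
    also have "\<dots> = (real k + 1) * \<bar>\<delta> n\<bar>"
      using nk s by (simp add: \<delta>_eq abs_mult)
    also have "\<dots> \<le> (real k + 1)\<^sup>2 * \<bar>\<delta> n\<bar>"
      by (intro mult_right_mono) (auto simp: power2_eq_square)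
    finally show ?thesis .
  qed
qed

text \<open>
  The unknown \<open>u\<close> stands for \<open>\<phi> = x\<^sup>k + \<Sum> (u\<^sub>n / \<delta>\<^sub>n) x\<^sup>n\<close> with \<open>x = t/R\<close>. Because \<open>\<delta>\<^sub>k = 0\<close> and \<open>1 / 0 = 0\<close>, the
  coefficient \<open>u\<^sub>k\<close> does not enter \<open>\<phi>\<close>; it is the eigenvalue shift \<open>\<nu>\<close>. In these variables
  \<open>(L + \<lambda>\<^sub>k) \<phi> = \<nu> \<phi> - s g\<close> becomes \<open>u = base u + s g\<close>. The truncated exponent \<open>k - 2\<close> in \<open>base\<close> is
  harmless, since its coefficient vanishes for \<open>k = 1\<close>.
\<close>

definition psi :: "l1 \<Rightarrow> l1" where
  "psi = wshift (\<lambda>n. 1 / \<delta> n) 0"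
definition dpsi :: "l1 \<Rightarrow> l1" where
  "dpsi = wshift (\<lambda>n. (real n + 1) / (R * \<delta> (n + 1))) 1"
definition shift_op :: "l1 \<Rightarrow> l1" where
  "shift_op = wshift (\<lambda>n. (real n + 2) * (real n + 1) / (R\<^sup>2 * \<delta> (n + 2))) 2"
definition phi :: "l1 \<Rightarrow> l1" where
  "phi u = l1_X ^ k + psi u"
definition dphi :: "l1 \<Rightarrow> l1" where
  "dphi u = (real k / R) *\<^sub>R l1_X ^ (k - 1) + dpsi u"
definition base :: "l1 \<Rightarrow> l1" where
  "base u = shift_op u + (real k * (real k - 1) / R\<^sup>2) *\<^sub>R l1_X ^ (k - 2) - l1_coeff u k *\<^sub>R psi u"

lemma psi_weight: "\<bar>1 / \<delta> n\<bar> \<le> 1"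
  using \<delta>_bounds(1)[of n] by (cases "n = k") (auto simp: \<delta>_k field_simps)

lemma dpsi_weight: "\<bar>(real n + 1) / (R * \<delta> (n + 1))\<bar> \<le> 1"
proof (cases "n + 1 = k")
  case False
  have "real n + 1 \<le> \<bar>\<delta> (n + 1)\<bar>" using \<delta>_bounds(2)[OF False] by simp
  also have "\<dots> \<le> R * \<bar>\<delta> (n + 1)\<bar>" using mult_right_mono[of 1 R "\<bar>\<delta> (n + 1)\<bar>"] R by simp
  finally show ?thesis
    using \<delta>_bounds(1)[OF False] R by (simp add: abs_mult field_simps)
qed (use \<delta>_k in auto)

lemma shift_weight: "\<bar>(real n + 2) * (real n + 1) / (R\<^sup>2 * \<delta> (n + 2))\<bar> \<le> 1 / 16"
proof (cases "n + 2 = k")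
  case False
  have "(real n + 2) * (real n + 1) \<le> (real k + 1)\<^sup>2 * \<bar>\<delta> (n + 2)\<bar>"
    using \<delta>_bounds(3)[OF False] by (simp add: algebra_simps)
  moreover have "0 < (real k + 1)\<^sup>2 * \<bar>\<delta> (n + 2)\<bar>"
    using \<delta>_bounds(1)[OF False] by (intro mult_pos_pos) auto
  ultimately show ?thesis
    by (simp add: R(2) abs_mult field_simps)
qed (use \<delta>_k in auto)

lemmas l1_coeff_psi = l1_coeff_wshift[of "\<lambda>n. 1 / \<delta> n", OF psi_weight, of 0, folded psi_def]
lemmas l1_coeff_dpsi =
  l1_coeff_wshift[of "\<lambda>n. (real n + 1) / (R * \<delta> (n + 1))", OF dpsi_weight, of 1, folded dpsi_def]
lemmas l1_coeff_shift_op =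
  l1_coeff_wshift[of "\<lambda>n. (real n + 2) * (real n + 1) / (R\<^sup>2 * \<delta> (n + 2))", OF shift_weight, of 2,
    folded shift_op_def]
lemmas norm_psi = norm_wshift_le[of "\<lambda>n. 1 / \<delta> n", OF psi_weight, of 0, folded psi_def]
lemmas norm_shift_op =
  norm_wshift_le[of "\<lambda>n. (real n + 2) * (real n + 1) / (R\<^sup>2 * \<delta> (n + 2))", OF shift_weight, of 2,
    folded shift_op_def]
lemmas bounded_linear_psi =
  bounded_linear_wshift[of "\<lambda>n. 1 / \<delta> n", OF psi_weight, of 0, folded psi_def]
lemmas bounded_linear_dpsi =
  bounded_linear_wshift[of "\<lambda>n. (real n + 1) / (R * \<delta> (n + 1))", OF dpsi_weight, of 1, folded dpsi_def]
lemmas bounded_linear_shift_op =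
  bounded_linear_wshift[of "\<lambda>n. (real n + 2) * (real n + 1) / (R\<^sup>2 * \<delta> (n + 2))", OF shift_weight, of 2,
    folded shift_op_def]

lemma l1_coeff_phi: "l1_coeff (phi u) n = (if n = k then 1 else 0) + l1_coeff u n / \<delta> n"
  by (simp add: phi_def l1_coeff_psi)

lemma l1_coeff_dphi: "l1_coeff (dphi u) n = (real n + 1) / R * l1_coeff (phi u) (n + 1)"
proof (cases "n + 1 = k")
  case True
  then show ?thesis using \<delta>_k by (auto simp: dphi_def l1_coeff_phi l1_coeff_dpsi)
next
  case False
  then have "n \<noteq> k - 1" using k1 by auto
  with False show ?thesis by (simp add: dphi_def l1_coeff_phi l1_coeff_dpsi)
qed

text \<open>The inhomogeneous term of \<open>base\<close> is the second derivative of the leading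
  monomial x^k, so together with \<open>shift_op u\<close> it is the full second derivative of
  \<open>phi u\<close>.\<close>

lemma l1_coeff_base:
  "l1_coeff (base u) n = (real n + 2) * (real n + 1) / R\<^sup>2 * l1_coeff (phi u) (n + 2)
     - l1_coeff u k * l1_coeff u n / \<delta> n"
proof -
  have "(real k * (real k - 1) / R\<^sup>2) * (if n = k - 2 then 1 else 0)
      = (real n + 2) * (real n + 1) / R\<^sup>2 * (if n + 2 = k then 1 else 0)"
    \<comment> \<open>For \<open>k = 1\<close> the truncated \<open>k - 2\<close> is 0, but the left
      side vanishes through the factor \<open>k - 1\<close> and the right side because
      \<open>n + 2 = 1\<close> is impossible.\<close>
    using k1 by (cases "k = 1") (auto simp: of_nat_diff)
  then show ?thesis
    by (simp add: base_def l1_coeff_phi l1_coeff_psi l1_coeff_shift_op ring_distribs)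
qed

text \<open>On the ball of radius 1/8 the shift contributes at most 1/128, the inhomogeneous term
  8/128 and the quadratic term 2/128; the total 11/128 stays below the required 12/128.\<close>

lemma norm_base:
  assumes u: "norm u \<le> 1/8"
  shows "norm (base u) \<le> 3/4 * (1/8)"
proof -
  have "norm (shift_op u) \<le> 1/16 * (1/8)" using norm_shift_op[of u] u by linarith
  moreover have "norm ((real k * (real k - 1) / R\<^sup>2) *\<^sub>R l1_X ^ (k - 2)) \<le> 1/16 * 1"
  proof -
    have "real k * (real k - 1) \<le> (real k + 1) * (real k + 1)"
      using k1 by (intro mult_mono) auto
    then have "\<bar>real k * (real k - 1) / R\<^sup>2\<bar> \<le> 1/16"
      unfolding R(2) using k1 by (simp add: abs_mult divide_le_eq power2_eq_square)
    then show ?thesis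
      unfolding norm_scaleR by (intro mult_mono norm_l1_X_power) auto
  qed
  moreover have "norm (l1_coeff u k *\<^sub>R psi u) \<le> 1/8 * (1/8)"
    unfolding norm_scaleR using abs_l1_coeff_le[of u k] norm_psi[of u] u by (intro mult_mono) auto
  moreover have "norm (base u) \<le> norm (shift_op u)
      + norm ((real k * (real k - 1) / R\<^sup>2) *\<^sub>R l1_X ^ (k - 2)) + norm (l1_coeff u k *\<^sub>R psi u)"
    unfolding base_def by (intro norm_triangle_le_diff add_right_mono norm_triangle_ineq)
  ultimately show ?thesis by linarith
qed

text \<open>The shift has norm 1/16 and the product rule for the quadratic term gives 1/8 twice, in
  total 5/16.\<close>

lemma base_lipschitz:
  assumes u: "norm u \<le> 1/8" and v: "norm v \<le> 1/8"
  shows "norm (base u - base v) \<le> norm (u - v) / 2"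
proof -
  note d = bounded_linear.linear[THEN linear_diff]
  have e: "base u - base v = shift_op (u - v)
      - (l1_coeff u k *\<^sub>R psi (u - v) + (l1_coeff (u - v) k) *\<^sub>R psi v)"
    by (simp add: base_def d[OF bounded_linear_psi] d[OF bounded_linear_shift_op] algebra_simps)
  have "norm (shift_op (u - v)) \<le> 1/16 * norm (u - v)" by (rule norm_shift_op)
  moreover have "norm (l1_coeff u k *\<^sub>R psi (u - v)) \<le> 1/8 * norm (u - v)"
    unfolding norm_scaleR using abs_l1_coeff_le[of u k] norm_psi[of "u - v"] u by (intro mult_mono) auto
  moreover have "norm ((l1_coeff (u - v) k) *\<^sub>R psi v) \<le> norm (u - v) * (1/8)"
    unfolding norm_scaleR using abs_l1_coeff_le[of "u - v" k] norm_psi[of v] v by (intro mult_mono) auto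
  moreover have "norm (base u - base v) \<le> norm (shift_op (u - v))
      + (norm (l1_coeff u k *\<^sub>R psi (u - v)) + norm ((l1_coeff (u - v) k) *\<^sub>R psi v))"
    unfolding e by (intro norm_triangle_le_diff add_left_mono norm_triangle_ineq)
  ultimately show ?thesis using norm_ge_zero[of "u - v"] by linarith
qed

text \<open>At \<open>s = 0\<close> the contraction preserves the polynomials of degree less than \<open>k\<close>, so its fixed
  point is one of them.\<close>

lemma base_fixed_coeff_k:
  assumes u: "norm u \<le> 1/8" "base u = u"
  shows "l1_coeff u k = 0"
proof -
  define S where "S = cball (0::l1) (1/8) \<inter> (\<Inter>n\<in>{k..}. {u. l1_coeff u n = 0})"
  have "closed {u. l1_coeff u n = 0}" for n
    by (intro closed_Collect_eq continuous_on_const linear_continuous_on bounded_linear_l1_coeff)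
  then have "closed S" unfolding S_def by auto
  have "\<exists>!v. v \<in> S \<and> base v = v"
  proof (rule Banach_fix)
    show "complete S" using \<open>closed S\<close> by (simp add: complete_eq_closed)
    have "0 \<in> S" by (simp add: S_def)
    then show "S \<noteq> {}" by blast
    show "base ` S \<subseteq> S"
    proof safe
      fix v assume v: "v \<in> S"
      then have "norm (base v) \<le> 1/8" using norm_base[of v] by (simp add: S_def)
      \<comment> \<open>Here \<open>n + 2 > k\<close>, so the monomial x^k does not contribute, and
        what remains contains the vanishing coefficients \<open>n + 2\<close> and \<open>n\<close>
        of \<open>v\<close>.\<close>
      moreover have "l1_coeff (base v) n = 0" if "k \<le> n" for n
        using v that by (simp add: S_def l1_coeff_base l1_coeff_phi)
      ultimately show "base v \<in> S" by (simp add: S_def)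
    qed
    show "\<And>x y. x \<in> S \<Longrightarrow> y \<in> S \<Longrightarrow> dist (base x) (base y) \<le> 1/2 * dist x y"
      using base_lipschitz by (simp add: S_def dist_norm)
  qed auto
  then obtain v where v: "v \<in> S" "base v = v" by blast
  have "norm (u - v) \<le> norm (u - v) / 2"
    using base_lipschitz[of u v] u v by (simp add: S_def)
  then have "u = v" by simp
  then show ?thesis using v by (simp add: S_def)
qed

section \<open>From the fixed point equation to the differential equation\<close>

definition ddphi :: "l1 \<Rightarrow> real \<Rightarrow> real" where
  "ddphi u t = eval_fps (fps_deriv (fps_of_l1 (dphi u))) (t / R) / R"

text \<open>The interval |t| < 2 is an open neighbourhood of [-1, 1], which makes the poles t = 1
  and t = -1 interior points for all derivatives.\<close>

lemma abs_div_R: "\<bar>t\<bar> < 2 \<Longrightarrow> \<bar>t / R\<bar> < 1"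
  using R(1) by (simp add: field_simps)

lemma phi_deriv:
  assumes t: "\<bar>t\<bar> < 2"
  shows "((\<lambda>t. l1_eval (t / R) (phi u)) has_real_derivative l1_eval (t / R) (dphi u)) (at t)"
    and "((\<lambda>t. l1_eval (t / R) (dphi u)) has_real_derivative ddphi u t) (at t)"
proof -
  have R0: "R \<noteq> 0" using R(1) by auto
  have c: "((\<lambda>t. l1_eval (t / R) f) has_real_derivative
      eval_fps (fps_deriv (fps_of_l1 f)) (t / R) * (1 / R)) (at t)" for f
    unfolding l1_eval_def
    by (rule DERIV_chain2[of "eval_fps (fps_of_l1 f)" _ "\<lambda>t. t / R",
          OF has_field_derivative_eval_fps[OF in_l1_conv_radius[OF abs_div_R[OF t]]]])
       (use R0 in \<open>auto intro!: derivative_eq_intros\<close>)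
  show "((\<lambda>t. l1_eval (t / R) (dphi u)) has_real_derivative ddphi u t) (at t)"
    using c[of "dphi u"] by (simp add: ddphi_def)
  have "fps_deriv (fps_of_l1 (phi u)) = fps_of_l1 (R *\<^sub>R dphi u)"
    using R0 by (intro fps_ext) (simp add: l1_coeff_dphi)
  then have "eval_fps (fps_deriv (fps_of_l1 (phi u))) (t / R) * (1 / R) = l1_eval (t / R) (dphi u)"
    using l1_eval_scaleR[OF abs_div_R[OF t], of R "dphi u"] R0 by (simp add: l1_eval_def)
  then show "((\<lambda>t. l1_eval (t / R) (phi u)) has_real_derivative l1_eval (t / R) (dphi u)) (at t)"
    using c[of "phi u"] by simp
qed

lemma in_conv_radius_deriv:
  assumes "\<bar>x\<bar> < (1::real)"
  shows "ereal (norm x) < fps_conv_radius (fps_deriv (fps_of_l1 f))"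
  using in_l1_conv_radius[OF assms, of f] fps_conv_radius_deriv[of "fps_of_l1 f"] by (rule less_le_trans)

lemma ddphi_continuous: "continuous_on {-2<..<2} (ddphi u)"
proof -
  have "t / R \<in> eball 0 (fps_conv_radius (fps_deriv (fps_of_l1 (dphi u))))" if "\<bar>t\<bar> < 2" for t
    using in_conv_radius_deriv[OF abs_div_R[OF that]] by (simp add: in_eball_iff dist_norm)
  then show ?thesis
    unfolding ddphi_def using R(1)
    by (intro continuous_on_divide continuous_on_eval_fps' continuous_intros) auto
qed

text \<open>The fixed point equation is the differential equation read coefficient by coefficient,
  with \<open>l1_coeff u k\<close> as eigenvalue shift \<nu>; the series identity is then evaluated
  at t/R.\<close>

lemma phi_equation:
  assumes u: "u = base u + s *\<^sub>R g" and t: "\<bar>t\<bar> < 2"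
  shows "(1 - t\<^sup>2) * ddphi u t - (real N - 1) * t * l1_eval (t / R) (dphi u)
    = (l1_coeff u k - eig k) * l1_eval (t / R) (phi u) - s * l1_eval (t / R) g"
proof -
  have R0: "R \<noteq> 0" using R(1) by auto
  let ?F = "fps_of_l1 (phi u)" and ?P = "fps_of_l1 (dphi u)" and ?G = "fps_of_l1 g"
  let ?a = "\<lambda>n. fps_nth ?F n"
  have P: "fps_nth ?P n = (real n + 1) / R * ?a (Suc n)" for n
    using l1_coeff_dphi[of u n] by simp
  \<comment> \<open>For \<open>n\<close> other than \<open>k\<close>,
    \<open>u_n = \<delta>_n a_n\<close>. In row \<open>k\<close> the diagonal entry is 0 and
    \<open>a_k = 1\<close>, so \<open>u_k\<close> is the missing term \<nu> a_k, while
    \<open>psi u\<close> has no coefficient there.\<close>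
  have rec: "(real n + 2) * (real n + 1) / R\<^sup>2 * ?a (n + 2) - \<delta> n * ?a n
      = l1_coeff u k * ?a n - s * fps_nth ?G n" for n
  proof -
    have "l1_coeff u n = l1_coeff (base u) n + s * fps_nth ?G n"
      by (subst u) simp
    then have e: "(real n + 2) * (real n + 1) / R\<^sup>2 * ?a (n + 2)
        = l1_coeff u n + l1_coeff u k * l1_coeff u n / \<delta> n - s * fps_nth ?G n"
      by (simp add: l1_coeff_base)
    show ?thesis
    proof (cases "n = k")
      case False
      then have "\<delta> n \<noteq> 0" using \<delta>_bounds(1)[of n] by auto
      then show ?thesis using False unfolding e by (simp add: l1_coeff_phi field_simps)
    qed (unfold e, simp add: l1_coeff_phi \<delta>_k)
  qed
  \<comment> \<open>In the variable x = t/R the second derivative in t is the x-derivative of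
    \<open>dphi u\<close> divided by R, and t = R x; hence the coefficients 1/R, R and (N-1)
    R.\<close>
  have "fps_const (1 / R) * fps_deriv ?P - fps_const R * (fps_X * (fps_X * fps_deriv ?P))
      - fps_const ((real N - 1) * R) * (fps_X * ?P)
      = fps_const (l1_coeff u k - eig k) * ?F - fps_const s * ?G" (is "?L = ?Rh")
  proof (rule fps_ext)
    fix n :: nat
    consider "n = 0" | "n = 1" | m where "n = m + 2"
      using le_Suc_ex[of 2 n] by (cases "n \<ge> 2") (auto simp: add.commute not_le less_2_cases_iff)
    then have "fps_nth ?L n = (real n + 2) * (real n + 1) / R\<^sup>2 * ?a (n + 2)
        - (real n * (real n - 1) + (real N - 1) * real n) * ?a n"
      using R0 by cases (auto simp: P fps_X_mult_nth power2_eq_square field_simps)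
    also have "real n * (real n - 1) + (real N - 1) * real n = \<delta> n + eig k"
      by (simp add: \<delta>_def eig_def algebra_simps)
    finally show "fps_nth ?L n = fps_nth ?Rh n"
      using rec[of n] by (simp add: algebra_simps)
  qed
  then have E: "eval_fps ?L (t / R) = eval_fps ?Rh (t / R)" by simp
  note x = abs_div_R[OF t]
  have c: "ereal (norm (t / R)) < fps_conv_radius (fps_const c)" "ereal (norm (t / R)) < fps_conv_radius fps_X"
    for c :: real by simp_all
  note e = eval_fps_mult eval_fps_diff
  have r: "ereal (norm y) < fps_conv_radius (F * G)"
    if "ereal (norm y) < fps_conv_radius F" "ereal (norm y) < fps_conv_radius G" for y :: real and F G
    using that fps_conv_radius_mult[of F G] by (meson less_le_trans min_less_iff_conj)
  have r': "ereal (norm y) < fps_conv_radius (F - G)"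
    if "ereal (norm y) < fps_conv_radius F" "ereal (norm y) < fps_conv_radius G" for y :: real and F G
    using that fps_conv_radius_diff[of F G] by (meson less_le_trans min_less_iff_conj)
  note c' = c in_l1_conv_radius[OF x] in_conv_radius_deriv[OF x]
  let ?D = "eval_fps (fps_deriv ?P) (t / R)" and ?v = "eval_fps ?P (t / R)"
  have L: "eval_fps ?L (t / R) = 1 / R * ?D - R * (t / R * (t / R * ?D)) - (real N - 1) * R * (t / R * ?v)"
    by (subst e, (intro r r' c')+)+ simp
  have Rh: "eval_fps ?Rh (t / R) = (l1_coeff u k - eig k) * eval_fps ?F (t / R) - s * eval_fps ?G (t / R)"
    by (subst e, (intro r r' c')+)+ simp
  have "(1 - t\<^sup>2) * (?D / R) - (real N - 1) * t * ?v
      = 1 / R * ?D - R * (t / R * (t / R * ?D)) - (real N - 1) * R * (t / R * ?v)"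
    using R0 by (simp add: field_simps power2_eq_square)
  then show ?thesis
    unfolding l1_eval_def ddphi_def using E L Rh by simp
qed

text \<open>The hypothesis on \<open>m0\<close> says that degree \<open>k\<close> lies in the kernel
  of the linearization at V = 1. Away from \<open>m0\<close> the linear part differs by \<nu> =
  \<beta> (m - m0), where \<beta> = p - 2q, so the unknown coefficient \<open>u_k\<close> delivers
  the parameter m along the curve.\<close>

lemma ode_branch:
  fixes p \<kappa> m0 d :: real
  assumes p: "p > 1"
  defines "q \<equiv> p / (p + 1)" and "\<beta> \<equiv> p * (p - 1) / (p + 1)"
  assumes m0: "(p - 1) * \<kappa> - \<beta> * m0 = eig k"
  obtains \<epsilon> :: real and m V V' V'' where "\<epsilon> > 0" and "continuous_on {-\<epsilon><..<\<epsilon>} m" and "m 0 = m0"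
    and "\<And>s t. \<bar>t\<bar> < 2 \<Longrightarrow> (V s has_real_derivative V' s t) (at t)"
    and "\<And>s t. \<bar>t\<bar> < 2 \<Longrightarrow> (V' s has_real_derivative V'' s t) (at t)"
    and "\<And>s. continuous_on {-2<..<2} (V'' s)"
    and "\<And>s t. \<bar>s\<bar> < \<epsilon> \<Longrightarrow> \<bar>t\<bar> < 2 \<Longrightarrow> V s t > 0"
    and "\<And>s t. \<bar>s\<bar> < \<epsilon> \<Longrightarrow> \<bar>t\<bar> \<le> 1 \<Longrightarrow>
      - ((1 - t\<^sup>2) * V'' s t - (real N - 1) * t * V' s t) + \<kappa> * V s t
        = (\<kappa> - m s) * V s t powr p + m s * ((V s t)\<^sup>2 + d * ((1 - t\<^sup>2) * (V' s t)\<^sup>2)) powr q"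
    and "\<And>s. \<bar>s\<bar> < \<epsilon> \<Longrightarrow> uniform_limit {-1..1} V (V s) (at s)"
    and "\<And>s. \<bar>s\<bar> < \<epsilon> \<Longrightarrow> uniform_limit {-1..1} V' (V' s) (at s)"
    and "\<And>t. V 0 t = 1"
    and "\<And>s. \<bar>s\<bar> < \<epsilon> \<Longrightarrow> s \<noteq> 0 \<Longrightarrow> \<not> V s constant_on {-1..1}"
proof -
  have \<beta>0: "\<beta> > 0" using p by (simp add: \<beta>_def)
  \<comment> \<open>Evaluates to 1 - t^2, because \<open>l1_X\<close> stands for t/R.\<close>
  define W where "W = 1 - R\<^sup>2 *\<^sub>R l1_X\<^sup>2"
  define mu :: "real \<times> l1 \<Rightarrow> l1" where "mu x = of_real m0 + of_real (1 / \<beta>) * of_real (l1_coeff (snd x) k)" for x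
  define ph where "ph x = phi (snd x)" for x :: "real \<times> l1"
  define dp where "dp x = dphi (snd x)" for x :: "real \<times> l1"
  \<comment> \<open>With V = 1 + s \<open>ph\<close>, the base of the second power is 1 + s
    \<open>z\<close>, where \<open>z\<close> is 2 \<open>ph\<close> plus s times
    \<open>qd\<close>.\<close>
  define qd where "qd x = ph x * ph x + of_real d * (W * (dp x * dp x))" for x
  define z where "z x = of_real 2 * ph x + of_real (fst x) * qd x" for x
  \<comment> \<open>The right side of the equation for V equals \<kappa> + s (p (\<kappa> - m) + 2 q
    m) phi + s^2 \<open>G\<close>: exactly the terms of order two and higher are collected
    here.\<close>
  define G where "G x = (of_real \<kappa> + of_real (- 1) * mu x) * (ph x * ph x * pow_tail p (of_real (fst x) * ph x))
    + mu x * (of_real q * qd x + z x * z x * pow_tail q (of_real (fst x) * z x))" for x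
  have n_ph: "near_lip ph" unfolding ph_def[abs_def] phi_def
    by (intro near_lip_add near_lip_const near_lip_linear[OF bounded_linear_psi] near_lip_snd)
  have n_dp: "near_lip dp" unfolding dp_def[abs_def] dphi_def
    by (intro near_lip_add near_lip_const near_lip_linear[OF bounded_linear_dpsi] near_lip_snd)
  have n_mu: "near_lip mu" unfolding mu_def[abs_def]
    by (intro near_lip_add near_lip_mult near_lip_const near_lip_snd near_lip_linear[OF bounded_linear_of_real]
        near_lip_linear[OF bounded_linear_l1_coeff])
  have n_qd: "near_lip qd" unfolding qd_def[abs_def]
    by (intro near_lip_add near_lip_mult near_lip_const n_ph n_dp)
  have n_z: "near_lip z" unfolding z_def[abs_def]
    by (intro near_lip_add near_lip_mult near_lip_const near_lip_fst n_ph n_qd)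
  have n_G: "near_lip G" unfolding G_def[abs_def]
    by (intro near_lip_add near_lip_mult near_lip_const n_mu near_lip_pow_tail n_ph n_qd n_z)
  obtain e1 U where e1: "e1 > 0" and U0: "\<And>s. \<bar>s\<bar> < e1 \<Longrightarrow> norm (U s) \<le> 1/8 \<and> U s = base (U s) + s *\<^sub>R G (s, U s)"
    and contU: "continuous_on {-e1<..<e1} U"
  proof (rule contraction_branch[of G "1/8" base, OF n_G _ _ norm_base base_lipschitz])
    fix e U
    assume "0 < e" "\<And>s. \<bar>s\<bar> < e \<Longrightarrow> norm (U s) \<le> 1/8 \<and> U s = base (U s) + s *\<^sub>R G (s, U s)"
      "continuous_on {-e<..<e} U"
    then show thesis by (rule that)
  qed simp_all
  obtain e2 where e2: "e2 > 0" "\<And>x. x \<in> near_box e2 \<Longrightarrow> norm (of_real (fst x) * ph x) \<le> 1/2"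
    using near_lip_small[OF n_ph] by blast
  obtain e3 where e3: "e3 > 0" "\<And>x. x \<in> near_box e3 \<Longrightarrow> norm (of_real (fst x) * z x) \<le> 1/2"
    using near_lip_small[OF n_z] by blast
  define \<epsilon> where "\<epsilon> = min e1 (min e2 e3)"
  have \<epsilon>: "\<epsilon> > 0" "\<epsilon> \<le> e1" "\<epsilon> \<le> e2" "\<epsilon> \<le> e3" using e1 e2 e3 by (auto simp: \<epsilon>_def)
  have U: "norm (U s) \<le> 1/8" "U s = base (U s) + s *\<^sub>R G (s, U s)" if "\<bar>s\<bar> < \<epsilon>" for s
    using U0[of s] that \<epsilon> by auto
  have box: "(s, U s) \<in> near_box e2" "(s, U s) \<in> near_box e3" if "\<bar>s\<bar> < \<epsilon>" for s
    using U(1)[OF that] that \<epsilon> by auto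
  have contU: "continuous_on {-\<epsilon><..<\<epsilon>} U"
    using contU by (rule continuous_on_subset) (use \<epsilon> in auto)
  define m where "m s = m0 + l1_coeff (U s) k / \<beta>" for s
  define V where "V s t = 1 + s * l1_eval (t / R) (phi (U s))" for s t
  define V' where "V' s t = s * l1_eval (t / R) (dphi (U s))" for s t
  define V'' where "V'' s t = s * ddphi (U s) t" for s t
  have small: "\<bar>s * l1_eval (t / R) (phi (U s))\<bar> \<le> 1/2" if "\<bar>s\<bar> < \<epsilon>" "\<bar>t\<bar> < 2" for s t
    using abs_l1_eval_le[OF abs_div_R[OF that(2)], of "of_real s * phi (U s)"] e2(2)[OF box(1)[OF that(1)]]
      abs_div_R[OF that(2)]
    by (simp add: ph_def l1_eval_mult l1_eval_of_real)
  have V_pos: "V s t > 0" if "\<bar>s\<bar> < \<epsilon>" "\<bar>t\<bar> < 2" for s t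
    using small[OF that] unfolding V_def by linarith
  have eqn: "- ((1 - t\<^sup>2) * V'' s t - (real N - 1) * t * V' s t) + \<kappa> * V s t
      = (\<kappa> - m s) * V s t powr p + m s * ((V s t)\<^sup>2 + d * ((1 - t\<^sup>2) * (V' s t)\<^sup>2)) powr q"
    if s: "\<bar>s\<bar> < \<epsilon>" and t: "\<bar>t\<bar> \<le> 1" for s t
  proof -
    have t2: "\<bar>t\<bar> < 2" using t by simp
    note x = abs_div_R[OF t2]
    note ev = l1_eval_add[OF x] l1_eval_mult[OF x] l1_eval_of_real[OF x]
    let ?ev = "l1_eval (t / R)" and ?X = "(s, U s)"
    define v where "v = ?ev (phi (U s))"
    define \<gamma> where "\<gamma> = (1 - t\<^sup>2) * (?ev (dphi (U s)))\<^sup>2"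
    define Q where "Q = v\<^sup>2 + d * \<gamma>"
    define Z where "Z = 2 * v + s * Q"
    define Ep where "Ep = ?ev (pow_tail p (of_real s * ph ?X))"
    define Eq where "Eq = ?ev (pow_tail q (of_real s * z ?X))"
    have W: "?ev W = 1 - t\<^sup>2"
      using R(1) by (simp add: W_def l1_eval_diff[OF x] l1_eval_scaleR[OF x] l1_eval_1[OF x]
          l1_eval_power[OF x] l1_eval_X power_divide)
    have ph: "?ev (ph ?X) = v" by (simp add: ph_def v_def)
    have qd: "?ev (qd ?X) = Q"
      unfolding qd_def ev W ph Q_def \<gamma>_def by (simp add: dp_def power2_eq_square)
    have z: "?ev (z ?X) = Z" unfolding z_def ev ph qd Z_def by simp
    have mu: "?ev (mu ?X) = m s" unfolding mu_def ev m_def by simp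
    have G: "?ev (G ?X) = (\<kappa> - m s) * (v\<^sup>2 * Ep) + m s * (q * Q + Z\<^sup>2 * Eq)"
      unfolding G_def ev ph qd z mu Ep_def Eq_def fst_conv by (simp add: power2_eq_square)
    have P: "V s t powr p = 1 + p * (s * v) + (s * v)\<^sup>2 * Ep"
      using l1_eval_pow_tail[OF x, of "of_real s * ph ?X" p] e2(2)[OF box(1)[OF s]]
      by (simp add: ev ph Ep_def V_def v_def)
    have "(V s t)\<^sup>2 + d * ((1 - t\<^sup>2) * (V' s t)\<^sup>2) = 1 + s * Z"
      unfolding V_def V'_def Z_def Q_def \<gamma>_def v_def[symmetric]
      by (simp add: power2_eq_square algebra_simps)
    moreover have "(1 + s * Z) powr q = 1 + q * (s * Z) + (s * Z)\<^sup>2 * Eq"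
      using l1_eval_pow_tail[OF x, of "of_real s * z ?X" q] e3(2)[OF box(2)[OF s]]
      by (simp add: ev z Eq_def)
    ultimately have Qp: "((V s t)\<^sup>2 + d * ((1 - t\<^sup>2) * (V' s t)\<^sup>2)) powr q
        = 1 + q * (s * Z) + (s * Z)\<^sup>2 * Eq" by simp
    have L: "(1 - t\<^sup>2) * ddphi (U s) t - (real N - 1) * t * ?ev (dphi (U s))
        = (l1_coeff (U s) k - eig k) * v - s * ?ev (G ?X)"
      unfolding v_def by (rule phi_equation[OF U(2)[OF s] t2])
    have c: "l1_coeff (U s) k = \<beta> * (m s - m0)" using \<beta>0 by (simp add: m_def)
    have pq: "p - 2 * q = \<beta>" using p by (simp add: q_def \<beta>_def field_simps)
    have lin: "\<kappa> - (l1_coeff (U s) k - eig k) = (\<kappa> - m s) * p + 2 * (q * m s)"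
      unfolding c m0[symmetric] pq[symmetric] by (simp add: algebra_simps)
    have "- ((1 - t\<^sup>2) * V'' s t - (real N - 1) * t * V' s t) + \<kappa> * V s t
        = \<kappa> + s * (\<kappa> * v - ((1 - t\<^sup>2) * ddphi (U s) t - (real N - 1) * t * ?ev (dphi (U s))))"
      unfolding V_def V'_def V''_def v_def by (simp add: algebra_simps)
    also have "\<dots> = \<kappa> + s * ((\<kappa> - (l1_coeff (U s) k - eig k)) * v) + s\<^sup>2 * ?ev (G ?X)"
      unfolding L by (simp add: algebra_simps power2_eq_square)
    also have "\<dots> = (\<kappa> - m s) * V s t powr p + m s * ((V s t)\<^sup>2 + d * ((1 - t\<^sup>2) * (V' s t)\<^sup>2)) powr q"
      unfolding P Qp G lin Z_def by (simp add: algebra_simps power2_eq_square)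
    finally show ?thesis .
  qed
  \<comment> \<open>Evaluation does not increase norms at any t, so continuity of the curve in the
    Banach algebra gives uniform convergence of values and derivatives.\<close>
  have unif: "uniform_limit {-1..1} (\<lambda>s t. l1_eval (t / R) (F s)) (\<lambda>t. l1_eval (t / R) (F s)) (at s)"
    if F: "continuous_on {-\<epsilon><..<\<epsilon>} F" and s: "\<bar>s\<bar> < \<epsilon>" for F s
  proof (rule uniform_limitI)
    fix e :: real assume "e > 0"
    have "isCont F s"
      using F s by (auto simp: continuous_on_eq_continuous_at abs_less_iff)
    then have "(F \<longlongrightarrow> F s) (at s)" by (simp add: isCont_def)
    then have "\<forall>\<^sub>F r in at s. dist (F r) (F s) < e" using \<open>e > 0\<close> by (rule tendstoD)
    then show "\<forall>\<^sub>F r in at s. \<forall>t\<in>{-1..1}. dist (l1_eval (t / R) (F r)) (l1_eval (t / R) (F s)) < e"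
    proof (rule eventually_mono, intro ballI)
      fix r t assume r: "dist (F r) (F s) < e" and t: "t \<in> {-1..1::real}"
      have x: "\<bar>t / R\<bar> < 1" using t by (intro abs_div_R) auto
      show "dist (l1_eval (t / R) (F r)) (l1_eval (t / R) (F s)) < e"
        using abs_l1_eval_le[OF x, of "F r - F s"] r by (simp add: dist_norm l1_eval_diff[OF x])
    qed
  qed
  have cont_phi: "continuous_on {-\<epsilon><..<\<epsilon>} (\<lambda>s. phi (U s))" "continuous_on {-\<epsilon><..<\<epsilon>} (\<lambda>s. dphi (U s))"
    unfolding phi_def dphi_def
    by (intro continuous_intros bounded_linear.continuous_on[OF bounded_linear_psi contU]
        bounded_linear.continuous_on[OF bounded_linear_dpsi contU])+
  have tx: "\<bar>t / R\<bar> < 1" if "t \<in> {-1..1}" for t using that by (intro abs_div_R) auto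
  show ?thesis
  proof (rule that[of \<epsilon> m V V' V''])
    show "continuous_on {-\<epsilon><..<\<epsilon>} m" unfolding m_def
      using bounded_linear.continuous_on[OF bounded_linear_l1_coeff contU]
      by (intro continuous_intros) (use \<beta>0 in auto)
    show "m 0 = m0" using base_fixed_coeff_k[of "U 0"] U[of 0] \<epsilon> by (simp add: m_def)
    show "(V s has_real_derivative V' s t) (at t)" "(V' s has_real_derivative V'' s t) (at t)"
      if "\<bar>t\<bar> < 2" for s t
      unfolding V_def[abs_def] V'_def[abs_def] V''_def
      by (auto intro!: derivative_eq_intros phi_deriv that)
    show "continuous_on {-2<..<2} (V'' s)" for s
      unfolding V''_def[abs_def] by (intro continuous_intros ddphi_continuous)
    show "uniform_limit {-1..1} V (V s) (at s)" if "\<bar>s\<bar> < \<epsilon>" for s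
    proof -
      have "uniform_limit {-1..1} (\<lambda>s t. l1_eval (t / R) (1 + s *\<^sub>R phi (U s)))
          (\<lambda>t. l1_eval (t / R) (1 + s *\<^sub>R phi (U s))) (at s)"
        by (intro unif that continuous_intros cont_phi)
      then show ?thesis
        by (rule uniform_limit_cong'[THEN iffD1, rotated 2])
           (simp_all add: V_def l1_eval_add[OF tx] l1_eval_scaleR[OF tx] l1_eval_1[OF tx])
    qed
    show "uniform_limit {-1..1} V' (V' s) (at s)" if "\<bar>s\<bar> < \<epsilon>" for s
    proof -
      have "uniform_limit {-1..1} (\<lambda>s t. l1_eval (t / R) (s *\<^sub>R dphi (U s)))
          (\<lambda>t. l1_eval (t / R) (s *\<^sub>R dphi (U s))) (at s)"
        by (intro unif that continuous_intros cont_phi)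
      then show ?thesis
        by (rule uniform_limit_cong'[THEN iffD1, rotated 2])
           (simp_all add: V'_def l1_eval_scaleR[OF tx])
    qed
    show "\<not> V s constant_on {-1..1}" if s: "\<bar>s\<bar> < \<epsilon>" "s \<noteq> 0" for s
    proof
      assume "V s constant_on {-1..1}"
      then obtain c where c: "\<And>t. t \<in> {-1..1} \<Longrightarrow> V s t = c" by (auto simp: constant_on_def)
      \<comment> \<open>Constancy would annihilate all coefficients of positive index, but the
        normalization fixes the \<open>k\<close>-th one to be 1.\<close>
      have "l1_coeff (phi (U s)) k = 0"
      proof -
        have "l1_eval x (phi (U s)) = (c - 1) / s" if "0 < x" "x < 1 / R" for x
        proof -
          have "0 < x * R" using that R(1) by simp
          moreover have "x * R < 1" using that R(1) by (simp add: field_simps)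
          ultimately show ?thesis using c[of "x * R"] s R(1) by (simp add: V_def field_simps)
        qed
        then have "l1_coeff (phi (U s)) k = (if k = 0 then (c - 1) / s else 0)"
          using R(1) l1_conv_radius
          by (intro eval_fps_constant_imp_nth[of "1 / R"]) (auto simp: l1_eval_def)
        then show ?thesis using k1 by simp
      qed
      then show False by (simp add: l1_coeff_phi \<delta>_k)
    qed
  qed (use \<epsilon> eqn V_pos in \<open>auto simp: V_def\<close>)
qed

end

subsection \<open>Calculus of zonal functions\<close>

text \<open>Exponent 0 gives the extension constant on rays, exponent -2/(p-1) the separable
  solution; one calculation thus serves both the sphere and the punctured space.\<close>

definition zonal_fun :: "'a::euclidean_space \<Rightarrow> real \<Rightarrow> (real \<Rightarrow> real) \<Rightarrow> 'a \<Rightarrow> real" where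
  "zonal_fun e \<alpha> w x = norm x powr \<alpha> * w (x \<bullet> e / norm x)"

lemma zonal_arg:
  assumes "norm e = 1"
  shows "\<bar>x \<bullet> e / norm x\<bar> \<le> 1"
  using Cauchy_Schwarz_ineq2[of x e] assms by (cases "x = 0") (auto simp: field_simps)

lemma zonal_fun_powr_diff:
  assumes "x \<noteq> 0"
  shows "norm x powr (\<alpha> - 1) = norm x powr \<alpha> / norm x"
    and "norm x powr (\<alpha> - 2) = norm x powr \<alpha> / (norm x)\<^sup>2"
    and "norm x powr (\<alpha> - 3) = norm x powr \<alpha> / (norm x) ^ 3"
    and "norm x powr (\<alpha> - 4) = norm x powr \<alpha> / (norm x) ^ 4"
  using assms by (simp_all add: powr_diff)

text \<open>The coefficients of \<open>x\<close> and \<open>e\<close> in the gradient are again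
  zonal functions, of lower degree, so second derivatives follow by applying the same lemma to
  them.\<close>

lemma zonal_fun_has_derivative:
  fixes e x :: "'a::euclidean_space"
  assumes e: "norm e = 1" and x: "x \<noteq> 0"
    and w: "\<And>t. \<bar>t\<bar> < 2 \<Longrightarrow> (w has_real_derivative w' t) (at t)"
  shows "(zonal_fun e \<alpha> w has_derivative
    (\<lambda>h. (x \<bullet> h) * zonal_fun e (\<alpha> - 2) (\<lambda>t. \<alpha> * w t - t * w' t) x + (e \<bullet> h) * zonal_fun e (\<alpha> - 1) w' x)) (at x)"
proof -
  let ?r = "norm x" and ?t = "x \<bullet> e / norm x"
  have r: "?r > 0" using x by simp
  have n: "(norm has_derivative (\<lambda>h. (x \<bullet> h) / ?r)) (at x)"
    using has_derivative_norm[OF x] by (simp add: sgn_div_norm inner_commute divide_inverse mult.commute)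
  have t: "((\<lambda>y. y \<bullet> e / norm y) has_derivative (\<lambda>h. (e \<bullet> h) / ?r - (x \<bullet> e) * (x \<bullet> h) / ?r ^ 3)) (at x)"
  proof (rule has_derivative_eq_rhs)
    show "((\<lambda>y. y \<bullet> e / norm y) has_derivative
        (\<lambda>h. ((h \<bullet> e) * ?r - (x \<bullet> e) * ((x \<bullet> h) / ?r)) / (?r * ?r))) (at x)"
      by (rule has_derivative_divide'[OF bounded_linear_imp_has_derivative[OF bounded_linear_inner_left] n])
         (use x in simp)
    have "(b * r - a * (c / r)) / (r * r) = b / r - a * c / r ^ 3" if "r > 0" for a b c r :: real
      using that by (simp add: field_simps power3_eq_cube)
    from this[OF r] show "(\<lambda>h. ((h \<bullet> e) * ?r - (x \<bullet> e) * ((x \<bullet> h) / ?r)) / (?r * ?r))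
        = (\<lambda>h. (e \<bullet> h) / ?r - (x \<bullet> e) * (x \<bullet> h) / ?r ^ 3)"
      by (simp add: inner_commute[of _ e])
  qed
  have P: "((\<lambda>y. norm y powr \<alpha>) has_derivative (\<lambda>h. (x \<bullet> h) / ?r * (\<alpha> * ?r powr (\<alpha> - 1)))) (at x)"
    by (rule DERIV_compose_FDERIV[OF has_real_derivative_powr n]) (use r in auto)
  have "\<bar>?t\<bar> < 2" using zonal_arg[OF e, of x] by simp
  then have Q: "((\<lambda>y. w (y \<bullet> e / norm y)) has_derivative
      (\<lambda>h. ((e \<bullet> h) / ?r - (x \<bullet> e) * (x \<bullet> h) / ?r ^ 3) * w' ?t)) (at x)"
    by (intro DERIV_compose_FDERIV[OF w t])
  have "\<rho> * ((b / r - a * c / r ^ 3) * V) + c / r * (\<alpha> * (\<rho> / r)) * W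
      = c * (\<rho> / r\<^sup>2 * (\<alpha> * W - a / r * V)) + b * (\<rho> / r * V)" if "r > 0" for a b c r V W \<rho> :: real
    using that by (simp add: field_simps power3_eq_cube power2_eq_square)
  from this[OF r] show ?thesis
    unfolding zonal_fun_def
    by (intro has_derivative_eq_rhs[OF has_derivative_mult[OF P Q]])
       (simp only: fun_eq_iff zonal_fun_powr_diff[OF x] simp_thms)
qed

lemma zonal_fun_continuous:
  assumes e: "norm e = 1" and w: "continuous_on {-2<..<2} w"
  shows "continuous_on (- {0}) (zonal_fun e \<alpha> w)"
  unfolding zonal_fun_def
proof (intro continuous_on_mult continuous_on_powr continuous_intros)
  show "continuous_on (- {0}) (\<lambda>x. w (x \<bullet> e / norm x))"
  proof (rule continuous_on_compose2[OF w])
    show "continuous_on (- {0}) (\<lambda>x. x \<bullet> e / norm x)" by (intro continuous_intros) auto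
    show "(\<lambda>x. x \<bullet> e / norm x) ` (- {0}) \<subseteq> {-2<..<2}"
    proof (rule image_subsetI)
      fix x
      show "x \<bullet> e / norm x \<in> {-2<..<2}"
        using zonal_arg[OF e, of x] unfolding greaterThanLessThan_iff by linarith
    qed
  qed
qed auto

lemma partial_deriv_eqI:
  assumes "(f has_derivative f') (at x)"
  shows "partial_deriv b f x = f' b"
  unfolding partial_deriv_def using frechet_derivative_at[OF assms] by simp

text \<open>The function \<open>f\<close> is tied to the formula only away from 0:
  \<open>radial_ext\<close> and \<open>zonal_fun\<close> with exponent 0 may disagree at the origin,
  as \<open>0 powr 0 = 0\<close>.\<close>

locale zonal_profile =
  fixes e :: "'a::euclidean_space" and \<alpha> :: real and w w' w'' :: "real \<Rightarrow> real" and f :: "'a \<Rightarrow> real"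
  assumes e: "norm e = 1"
    and w: "\<And>t. \<bar>t\<bar> < 2 \<Longrightarrow> (w has_real_derivative w' t) (at t)"
    and w': "\<And>t. \<bar>t\<bar> < 2 \<Longrightarrow> (w' has_real_derivative w'' t) (at t)"
    and w'': "continuous_on {-2<..<2} w''"
    and f: "\<And>x. x \<noteq> 0 \<Longrightarrow> f x = zonal_fun e \<alpha> w x"
begin

abbreviation "w1 \<equiv> \<lambda>t. \<alpha> * w t - t * w' t"
abbreviation "w1' \<equiv> \<lambda>t. (\<alpha> - 1) * w' t - t * w'' t"
abbreviation "Z \<equiv> zonal_fun e"

lemma w1: "\<bar>t\<bar> < 2 \<Longrightarrow> (w1 has_real_derivative w1' t) (at t)"
  by (auto intro!: derivative_eq_intros w w' simp: algebra_simps)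

lemma has_derivative_f:
  assumes x: "x \<noteq> 0"
  shows "(f has_derivative (\<lambda>h. (x \<bullet> h) * Z (\<alpha> - 2) w1 x + (e \<bullet> h) * Z (\<alpha> - 1) w' x)) (at x)"
  by (rule has_derivative_transform_within_open[OF zonal_fun_has_derivative[OF e x w], of "- {0}"])
     (use x f in auto)

lemma partial_f: "x \<noteq> 0 \<Longrightarrow> partial_deriv b f x = (x \<bullet> b) * Z (\<alpha> - 2) w1 x + (e \<bullet> b) * Z (\<alpha> - 1) w' x"
  by (rule partial_deriv_eqI[OF has_derivative_f])

definition second :: "'a \<Rightarrow> 'a \<Rightarrow> 'a \<Rightarrow> real" where
  "second b c x = (b \<bullet> c) * Z (\<alpha> - 2) w1 x
    + (x \<bullet> b) * ((x \<bullet> c) * Z (\<alpha> - 4) (\<lambda>t. (\<alpha> - 2) * w1 t - t * w1' t) x + (e \<bullet> c) * Z (\<alpha> - 3) w1' x)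
    + (e \<bullet> b) * ((x \<bullet> c) * Z (\<alpha> - 3) (\<lambda>t. (\<alpha> - 1) * w' t - t * w'' t) x + (e \<bullet> c) * Z (\<alpha> - 2) w'' x)"

lemma has_derivative_partial:
  assumes x: "x \<noteq> 0"
  shows "(partial_deriv b f has_derivative (\<lambda>c. second b c x)) (at x)"
proof -
  have "((\<lambda>x. (x \<bullet> b) * Z (\<alpha> - 2) w1 x + (e \<bullet> b) * Z (\<alpha> - 1) w' x) has_derivative (\<lambda>c. second b c x)) (at x)"
    by (rule has_derivative_eq_rhs, (rule derivative_intros zonal_fun_has_derivative[OF e x]
          w1 w' | assumption)+)
       (simp add: second_def fun_eq_iff algebra_simps inner_commute)
  then show ?thesis
    by (rule has_derivative_transform_within_open[of _ _ _ _ "- {0}"]) (use x partial_f in auto)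
qed

lemma partial2_f: "x \<noteq> 0 \<Longrightarrow> partial_deriv c (partial_deriv b f) x = second b c x"
  by (rule partial_deriv_eqI[OF has_derivative_partial])

lemma continuous_profiles: "continuous_on {-2<..<2} w" "continuous_on {-2<..<2} w'"
  using DERIV_isCont[OF w] DERIV_isCont[OF w']
  by (simp_all add: continuous_on_eq_continuous_at abs_less_iff)

lemma C2_f: "C2_on (- {0}) f"
  unfolding C2_on_def
proof (intro conjI ballI)
  fix b c :: 'a
  show "f differentiable at x" if "x \<in> - {0}" for x
    using has_derivative_f[of x] that by (auto simp: differentiable_def)
  show "partial_deriv b f differentiable at x" if "x \<in> - {0}" for x
    using has_derivative_partial[of x b] that by (auto simp: differentiable_def)
  have "continuous_on (- {0}) (second b c)"
    unfolding second_def[abs_def]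
    by (intro continuous_intros zonal_fun_continuous[OF e] continuous_profiles w'')
  then show "continuous_on (- {0}) (partial_deriv c (partial_deriv b f))"
    by (rule continuous_on_eq) (simp add: partial2_f)
qed

lemma grad_f:
  assumes "x \<noteq> 0"
  shows "grad f x = Z (\<alpha> - 2) w1 x *\<^sub>R x + Z (\<alpha> - 1) w' x *\<^sub>R e"
proof -
  have "grad f x = (\<Sum>b\<in>Basis. Z (\<alpha> - 2) w1 x *\<^sub>R ((x \<bullet> b) *\<^sub>R b) + Z (\<alpha> - 1) w' x *\<^sub>R ((e \<bullet> b) *\<^sub>R b))"
    unfolding grad_def using assms by (simp add: partial_f algebra_simps)
  then show ?thesis by (simp only: sum.distrib scaleR_sum_right[symmetric] euclidean_representation)
qed

text \<open>The mixed term completes a square: w1^2 + 2 t w1 w' + w'^2 = (w1 + t w')^2 + (1 - t^2)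
  w'^2, and w1 + t w' is just \<alpha> w.\<close>

lemma norm_grad_f:
  assumes x: "x \<noteq> 0"
  shows "(norm (grad f x))\<^sup>2 = Z (2 * \<alpha> - 2) (\<lambda>t. \<alpha>\<^sup>2 * (w t)\<^sup>2 + (1 - t\<^sup>2) * (w' t)\<^sup>2) x"
proof -
  let ?r = "norm x" let ?t = "x \<bullet> e / ?r"
  have r: "?r > 0" using x by simp
  have xe: "?t * ?r = x \<bullet> e" "e \<bullet> e = 1" "x \<bullet> x = ?r\<^sup>2"
    using r e by (auto simp: power2_norm_eq_inner norm_eq_1)
  have p: "?r powr (2 * \<alpha> - 2) = (?r powr \<alpha>)\<^sup>2 / ?r\<^sup>2"
    using r by (simp add: powr_diff power2_eq_square flip: powr_add)
  have "(norm (grad f x))\<^sup>2 = (Z (\<alpha> - 2) w1 x)\<^sup>2 * (x \<bullet> x)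
      + 2 * Z (\<alpha> - 2) w1 x * Z (\<alpha> - 1) w' x * (x \<bullet> e) + (Z (\<alpha> - 1) w' x)\<^sup>2 * (e \<bullet> e)"
  proof -
    have "(norm (a *\<^sub>R x + b *\<^sub>R e))\<^sup>2 = a\<^sup>2 * (x \<bullet> x) + 2 * a * b * (x \<bullet> e) + b\<^sup>2 * (e \<bullet> e)" for a b
      unfolding power2_norm_eq_inner
      by (simp add: inner_add_left inner_add_right inner_commute[of e x] power2_eq_square algebra_simps)
    then show ?thesis unfolding grad_f[OF x] .
  qed
  also have "\<dots> = (?r powr \<alpha>)\<^sup>2 / ?r\<^sup>2 * ((w1 ?t)\<^sup>2 + 2 * w1 ?t * w' ?t * ?t + (w' ?t)\<^sup>2)"
  proof -
    have "(\<rho> / r\<^sup>2 * W)\<^sup>2 * r\<^sup>2 + 2 * (\<rho> / r\<^sup>2 * W) * (\<rho> / r * V) * (t * r) + (\<rho> / r * V)\<^sup>2 * 1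
        = \<rho>\<^sup>2 / r\<^sup>2 * (W\<^sup>2 + 2 * W * V * t + V\<^sup>2)" if "r > 0" for r W V t \<rho> :: real
      using that by (simp add: field_simps power2_eq_square)
    from this[OF r, of "?r powr \<alpha>" "w1 ?t" "w' ?t" ?t] show ?thesis
      by (simp only: xe zonal_fun_def zonal_fun_powr_diff[OF x])
  qed
  also have "\<dots> = (?r powr \<alpha>)\<^sup>2 / ?r\<^sup>2 * (\<alpha>\<^sup>2 * (w ?t)\<^sup>2 + (1 - ?t\<^sup>2) * (w' ?t)\<^sup>2)"
  proof -
    have "(w1 t)\<^sup>2 + 2 * w1 t * w' t * t + (w' t)\<^sup>2 = \<alpha>\<^sup>2 * (w t)\<^sup>2 + (1 - t\<^sup>2) * (w' t)\<^sup>2" for t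
      by (simp add: power2_eq_square algebra_simps)
    then show ?thesis by (simp only:)
  qed
  finally show ?thesis by (simp add: zonal_fun_def p)
qed

text \<open>Taking the trace of the Hessian separates the radial contribution \<alpha> (\<alpha> + N
  - 2) w from the angular operator; for \<alpha> = 0 only the latter is left.\<close>

lemma laplacian_f:
  assumes x: "x \<noteq> 0"
  shows "laplacian f x = Z (\<alpha> - 2) (\<lambda>t. \<alpha> * (\<alpha> + real DIM('a) - 2) * w t
    + ((1 - t\<^sup>2) * w'' t - (real DIM('a) - 1) * t * w' t)) x"
proof -
  let ?r = "norm x" let ?t = "x \<bullet> e / ?r"
  have r: "?r > 0" using x by simp
  have s: "(\<Sum>b\<in>Basis. (x \<bullet> b) * (x \<bullet> b)) = ?r\<^sup>2" "(\<Sum>b\<in>Basis. (x \<bullet> b) * (e \<bullet> b)) = ?t * ?r"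
    "(\<Sum>b\<in>Basis. (e \<bullet> b) * (e \<bullet> b)) = 1"
    using r e by (auto simp: euclidean_inner[symmetric] power2_norm_eq_inner norm_eq_1)
  define A B C D where "A = Z (\<alpha> - 2) w1 x" and "B = Z (\<alpha> - 4) (\<lambda>t. (\<alpha> - 2) * w1 t - t * w1' t) x"
    and "C = Z (\<alpha> - 3) w1' x" and "D = Z (\<alpha> - 2) w'' x"
  have "laplacian f x = (\<Sum>b\<in>Basis. A + (x \<bullet> b) * (x \<bullet> b) * B + (x \<bullet> b) * (e \<bullet> b) * (2 * C)
      + (e \<bullet> b) * (e \<bullet> b) * D)"
    unfolding laplacian_def A_def B_def C_def D_def
    by (rule sum.cong) (simp_all add: partial2_f[OF x] second_def algebra_simps)
  also have "\<dots> = real DIM('a) * A + ?r\<^sup>2 * B + ?t * ?r * (2 * C) + D"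
    by (simp only: sum.distrib sum_distrib_right[symmetric] s) simp
  also have "\<dots> = ?r powr \<alpha> / ?r\<^sup>2 * (real DIM('a) * w1 ?t + ((\<alpha> - 2) * w1 ?t - ?t * w1' ?t)
      + 2 * ?t * w1' ?t + w'' ?t)"
  proof -
    have "n * (\<rho> / r\<^sup>2 * W) + r\<^sup>2 * (\<rho> / r ^ 4 * Y) + t * r * (2 * (\<rho> / r ^ 3 * U)) + \<rho> / r\<^sup>2 * V
        = \<rho> / r\<^sup>2 * (n * W + Y + 2 * t * U + V)" if "r > 0" for r W V t \<rho> Y U n :: real
      using that by (simp add: field_simps power2_eq_square power3_eq_cube power4_eq_xxxx)
    from this[OF r] show ?thesis
      unfolding A_def B_def C_def D_def zonal_fun_def zonal_fun_powr_diff[OF x] .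
  qed
  also have "\<dots> = ?r powr \<alpha> / ?r\<^sup>2 * (\<alpha> * (\<alpha> + real DIM('a) - 2) * w ?t
      + ((1 - ?t\<^sup>2) * w'' ?t - (real DIM('a) - 1) * ?t * w' ?t))"
  proof -
    have "real DIM('a) * w1 t + ((\<alpha> - 2) * w1 t - t * w1' t) + 2 * t * w1' t + w'' t
        = \<alpha> * (\<alpha> + real DIM('a) - 2) * w t + ((1 - t\<^sup>2) * w'' t - (real DIM('a) - 1) * t * w' t)" for t
      by (simp add: power2_eq_square algebra_simps)
    then show ?thesis by (simp only:)
  qed
  finally show ?thesis by (simp add: zonal_fun_def zonal_fun_powr_diff[OF x])
qed

end

text \<open>Stated at a single t because for \<open>N = 1\<close> the values attained by
  \<open>\<sigma> \<bullet> e\<close> are only 1 and -1, and nothing is claimed between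
  them.\<close>

definition zonal_solution_at :: "nat \<Rightarrow> real \<Rightarrow> real \<Rightarrow> (real \<Rightarrow> real) \<Rightarrow> (real \<Rightarrow> real) \<Rightarrow> (real \<Rightarrow> real) \<Rightarrow> real \<Rightarrow> bool" where
  "zonal_solution_at N p M w w' w'' t \<longleftrightarrow> w t > 0 \<and>
     - ((1 - t\<^sup>2) * w'' t - (real N - 1) * t * w' t) + 2 * K_const N p / (p - 1) * w t
       = w t powr p + M * ((2 / (p - 1))\<^sup>2 * (w t)\<^sup>2 + (1 - t\<^sup>2) * (w' t)\<^sup>2) powr (p / (p + 1))"

lemma power2_powr: "0 \<le> x \<Longrightarrow> (x\<^sup>2) powr c = x powr (2 * c)" for x c :: real
  by (cases "x = 0") (simp_all add: powr_powr flip: powr_numeral)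

section \<open>Solutions on the sphere and in the punctured space from a zonal profile\<close>

locale zonal_sphere =
  fixes e :: "'a::euclidean_space" and w w' w'' :: "real \<Rightarrow> real"
  assumes e: "norm e = 1"
    and w: "\<And>t. \<bar>t\<bar> < 2 \<Longrightarrow> (w has_real_derivative w' t) (at t)"
    and w': "\<And>t. \<bar>t\<bar> < 2 \<Longrightarrow> (w' has_real_derivative w'' t) (at t)"
    and w'': "continuous_on {-2<..<2} w''"
begin

abbreviation "\<omega> \<equiv> \<lambda>x. w (x \<bullet> e)"

sublocale sph: zonal_profile e 0 w w' w'' "radial_ext \<omega>"
  by standard (use e w w' w'' in \<open>auto simp: radial_ext_def zonal_fun_def divide_inverse mult.commute\<close>)

lemma sphere_grad_zonal:
  assumes "\<sigma> \<in> sphere 0 1"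
  shows "sphere_grad \<omega> \<sigma> = w' (\<sigma> \<bullet> e) *\<^sub>R (e - (\<sigma> \<bullet> e) *\<^sub>R \<sigma>)"
proof -
  have "norm \<sigma> = 1" "\<sigma> \<noteq> 0" using assms by auto
  then show ?thesis
    by (simp add: sphere_grad_def sph.grad_f zonal_fun_def algebra_simps)
qed

lemma sphere_solution_zonal:
  assumes eq: "\<And>\<sigma>. \<sigma> \<in> sphere 0 1 \<Longrightarrow> zonal_solution_at DIM('a) p M w w' w'' (\<sigma> \<bullet> e)"
  shows "sphere_solution p M \<omega>"
  unfolding sphere_solution_def C2_sphere_def
proof (intro conjI ballI sph.C2_f)
  fix \<sigma> :: 'a assume s: "\<sigma> \<in> sphere 0 1"
  then have n: "norm \<sigma> = 1" "\<sigma> \<noteq> 0" by auto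
  show "\<omega> \<sigma> > 0" using eq[OF s] by (simp add: zonal_solution_at_def)
  have "(norm (sphere_grad \<omega> \<sigma>))\<^sup>2 = (1 - (\<sigma> \<bullet> e)\<^sup>2) * (w' (\<sigma> \<bullet> e))\<^sup>2"
    by (simp add: sphere_grad_def sph.norm_grad_f n zonal_fun_def)
  moreover have "sphere_laplacian \<omega> \<sigma>
      = (1 - (\<sigma> \<bullet> e)\<^sup>2) * w'' (\<sigma> \<bullet> e) - (real DIM('a) - 1) * (\<sigma> \<bullet> e) * w' (\<sigma> \<bullet> e)"
    by (simp add: sphere_laplacian_def sph.laplacian_f n zonal_fun_def)
  ultimately show "- sphere_laplacian \<omega> \<sigma> + 2 * K_const DIM('a) p / (p - 1) * \<omega> \<sigma> = \<omega> \<sigma> powr p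
      + M * ((2 / (p - 1))\<^sup>2 * (\<omega> \<sigma>)\<^sup>2 + (norm (sphere_grad \<omega> \<sigma>))\<^sup>2) powr (p / (p + 1))"
    using eq[OF s] by (simp add: zonal_solution_at_def)
qed

lemma emden_zonal:
  assumes p: "p > 1"
    and eq: "\<And>\<sigma>. \<sigma> \<in> sphere 0 1 \<Longrightarrow> zonal_solution_at DIM('a) p M w w' w'' (\<sigma> \<bullet> e)"
    and nonconst: "\<not> \<omega> constant_on sphere 0 1"
  shows "\<exists>(u :: 'a \<Rightarrow> real) \<omega>. emden_solution p M u \<and> (\<forall>x. x \<noteq> 0 \<longrightarrow> u x > 0) \<and>
    nonradial u \<and> singular_at_origin u \<and>
    (\<forall>r>0. \<forall>\<sigma>\<in>sphere 0 1. u (r *\<^sub>R \<sigma>) = r powr (- (2 / (p - 1))) * \<omega> \<sigma>)"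
proof -
  define \<alpha> where "\<alpha> = - (2 / (p - 1))"
  define u where "u = zonal_fun e \<alpha> w"
  interpret z: zonal_profile e \<alpha> w w' w'' u
    by standard (use e w w' w'' in \<open>auto simp: u_def\<close>)
  have eqx: "zonal_solution_at DIM('a) p M w w' w'' (x \<bullet> e / norm x)" if "x \<noteq> 0" for x
  proof -
    have "x /\<^sub>R norm x \<in> sphere 0 1" using that by simp
    from eq[OF this] show ?thesis by (simp add: divide_inverse mult.commute)
  qed
  have pos: "u x > 0" if "x \<noteq> 0" for x
    using eqx[OF that] that by (simp add: u_def zonal_fun_def zonal_solution_at_def)
  \<comment> \<open>Homogeneity: for the exponent q = 2p/(p+1) the Laplacian, the power and the
    gradient term all scale like r^(\<alpha> - 2), so the equation reduces to the angular
    one.\<close>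
  have \<alpha>p: "\<alpha> * p = \<alpha> - 2" "(2 * \<alpha> - 2) * p / (p + 1) = \<alpha> - 2"
    using p by (simp_all add: \<alpha>_def divide_simps) (simp_all add: algebra_simps)
  have \<alpha>K: "\<alpha> * (\<alpha> + real DIM('a) - 2) = - (2 * K_const DIM('a) p / (p - 1))"
    using p by (simp add: \<alpha>_def K_const_def divide_simps) (simp add: algebra_simps)
  have em: "emden_solution p M u"
    unfolding emden_solution_def
  proof (intro conjI allI impI z.C2_f)
    fix x :: 'a assume x: "x \<noteq> 0"
    let ?t = "x \<bullet> e / norm x" and ?r = "norm x"
    have r: "?r > 0" using x by simp
    define S where "S = (2 / (p - 1))\<^sup>2 * (w ?t)\<^sup>2 + (1 - ?t\<^sup>2) * (w' ?t)\<^sup>2"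
    have "?t\<^sup>2 \<le> 1" using zonal_arg[OF e, of x] by (simp add: abs_square_le_1)
    then have S: "S \<ge> 0" by (simp add: S_def)
    have wt: "w ?t > 0" using eqx[OF x] by (simp add: zonal_solution_at_def)
    have "\<bar>u x\<bar> powr (p - 1) * u x = u x powr p"
      using pos[OF x] by (simp add: powr_diff)
    also have "\<dots> = ?r powr (\<alpha> - 2) * w ?t powr p"
      using wt by (simp add: u_def zonal_fun_def powr_mult powr_powr \<alpha>p)
    finally have 1: "\<bar>u x\<bar> powr (p - 1) * u x = ?r powr (\<alpha> - 2) * w ?t powr p" .
    have "norm (grad u x) powr (2 * p / (p + 1)) = ((norm (grad u x))\<^sup>2) powr (p / (p + 1))"
      by (simp add: power2_powr)
    also have "\<dots> = (?r powr (2 * \<alpha> - 2) * S) powr (p / (p + 1))"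
      by (simp add: z.norm_grad_f[OF x] zonal_fun_def S_def \<alpha>_def)
    also have "\<dots> = ?r powr (\<alpha> - 2) * S powr (p / (p + 1))"
      using S by (simp add: powr_mult powr_powr \<alpha>p)
    finally have 2: "norm (grad u x) powr (2 * p / (p + 1)) = ?r powr (\<alpha> - 2) * S powr (p / (p + 1))" .
    have "- laplacian u x = ?r powr (\<alpha> - 2) * (- ((1 - ?t\<^sup>2) * w'' ?t - (real DIM('a) - 1) * ?t * w' ?t)
        + 2 * K_const DIM('a) p / (p - 1) * w ?t)"
      unfolding z.laplacian_f[OF x] zonal_fun_def \<alpha>K by (simp only: minus_mult_left[symmetric]
          mult_minus_right[symmetric] minus_add_distrib minus_minus add.commute)
    also have "\<dots> = ?r powr (\<alpha> - 2) * (w ?t powr p + M * S powr (p / (p + 1)))"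
      using eqx[OF x] by (simp add: zonal_solution_at_def S_def)
    finally show "- laplacian u x = \<bar>u x\<bar> powr (p - 1) * u x + M * norm (grad u x) powr (2 * p / (p + 1))"
      unfolding 1 2 by (simp add: algebra_simps)
  qed
  have ray: "u (r *\<^sub>R \<sigma>) = r powr \<alpha> * \<omega> \<sigma>" if "r > 0" "\<sigma> \<in> sphere 0 1" for r \<sigma>
    using that by (simp add: u_def zonal_fun_def)
  have nr: "nonradial u"
    unfolding nonradial_def
  proof
    assume "\<exists>g. \<forall>x. x \<noteq> 0 \<longrightarrow> u x = g (norm x)"
    then obtain g where g: "\<And>x. x \<noteq> 0 \<Longrightarrow> u x = g (norm x)" by blast
    have "\<omega> \<sigma> = g 1" if "\<sigma> \<in> sphere 0 1" for \<sigma>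
    proof -
      have "\<sigma> \<noteq> 0" "norm \<sigma> = 1" using that by auto
      then show ?thesis using ray[of 1 \<sigma>] g[of \<sigma>] that by simp
    qed
    then show False using nonconst by (auto simp: constant_on_def)
  qed
  \<comment> \<open>Already along the ray through \<open>e\<close> the function tends to infinity,
    because \<alpha> < 0 and the profile is positive.\<close>
  have "singular_at_origin u"
    unfolding singular_at_origin_def
  proof
    assume "\<exists>l. (u \<longlongrightarrow> l) (at 0)"
    then obtain l where l: "(u \<longlongrightarrow> l) (at 0)" by blast
    have es: "e \<in> sphere 0 1" using e by simp
    have \<omega>e: "\<omega> e > 0" using eq[OF es] by (simp add: zonal_solution_at_def)
    have "filterlim (\<lambda>r. r *\<^sub>R e) (at 0) (at_right 0)"
      unfolding filterlim_at
    proof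
      show "\<forall>\<^sub>F r in at_right 0. r *\<^sub>R e \<in> UNIV \<and> r *\<^sub>R e \<noteq> 0"
      proof -
        have "e \<noteq> 0" using e by auto
        then show ?thesis by (simp add: eventually_at_filter)
      qed
      show "((\<lambda>r. r *\<^sub>R e) \<longlongrightarrow> 0) (at_right 0)"
        by (auto intro!: tendsto_eq_intros)
    qed
    then have lim: "((\<lambda>r. u (r *\<^sub>R e)) \<longlongrightarrow> l) (at_right 0)"
      using l filterlim_compose by blast
    have "filterlim (\<lambda>r. r powr \<alpha> * \<omega> e) at_top (at_right 0)"
    proof (rule filterlim_at_top_mult_tendsto_pos[OF tendsto_const \<omega>e])
      show "filterlim (\<lambda>r. r powr \<alpha>) at_top (at_right (0::real))"
      proof -
        have "filterlim (\<lambda>r::real. - ln r) at_top (at_right 0)"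
          using ln_at_0 by (simp add: filterlim_uminus_at_top)
        then have "filterlim (\<lambda>r::real. - \<alpha> * - ln r) at_top (at_right 0)"
          using p by (intro filterlim_tendsto_pos_mult_at_top[OF tendsto_const]) (auto simp: \<alpha>_def)
        then have "filterlim (\<lambda>r::real. exp (- \<alpha> * - ln r)) at_top (at_right 0)"
          by (rule filterlim_compose[OF exp_at_top])
        then show ?thesis
          by (rule filterlim_mono_eventually) (auto simp: eventually_at_filter powr_def)
      qed
    qed
    then have "filterlim (\<lambda>r. u (r *\<^sub>R e)) at_top (at_right 0)"
      by (rule filterlim_mono_eventually) (use ray es in \<open>auto simp: eventually_at_filter\<close>)
    then show False
      using lim not_tendsto_and_filterlim_at_infinity filterlim_at_top_imp_at_infinity
        trivial_limit_at_right_real by blast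
  qed
  then show ?thesis
    using em nr pos ray by (intro exI[of _ u] exI[of _ \<omega>]) (simp add: \<alpha>_def)
qed

end

lemma uniform_limit_compose_set:
  assumes "uniform_limit T f g F" "\<And>x. x \<in> S \<Longrightarrow> h x \<in> T"
  shows "uniform_limit S (\<lambda>s x. f s (h x)) (\<lambda>x. g (h x)) F"
proof (rule uniform_limitI)
  fix \<epsilon> :: real assume "\<epsilon> > 0"
  from uniform_limitD[OF assms(1) this]
  show "\<forall>\<^sub>F s in F. \<forall>x\<in>S. dist (f s (h x)) (g (h x)) < \<epsilon>"
    by (rule eventually_mono) (use assms(2) in blast)
qed

subsection \<open>Constant solutions\<close>

text \<open>Strict convexity of the power on the positive axis, from the mean value theorem. It
  governs both the number of constant solutions and the comparison with - mu_star.\<close>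

lemma powr_above_tangent:
  fixes y z a :: real
  assumes "y > 0" "z > 0" "y \<noteq> z" "a > 0"
  shows "y powr (a + 1) > z powr (a + 1) + (a + 1) * z powr a * (y - z)"
proof -
  have d: "((\<lambda>x. x powr (a + 1)) has_real_derivative (a + 1) * x powr a) (at x)" if "x > 0" for x
    using has_real_derivative_powr[OF that, of "a + 1"] by simp
  show ?thesis
  proof (cases "z < y")
    case True
    obtain \<xi> where \<xi>: "\<xi> > z" "\<xi> < y"
      "y powr (a + 1) - z powr (a + 1) = (y - z) * ((a + 1) * \<xi> powr a)"
      using MVT2[OF True, of "\<lambda>x. x powr (a + 1)" "\<lambda>x. (a + 1) * x powr a"] d assms by auto
    have "z powr a < \<xi> powr a" using \<xi> assms by (intro powr_less_mono2) auto
    then have "(y - z) * ((a + 1) * z powr a) < (y - z) * ((a + 1) * \<xi> powr a)"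
      using True assms by (intro mult_strict_left_mono) auto
    then show ?thesis using \<xi>(3) by (simp add: algebra_simps)
  next
    case False
    then have yz: "y < z" using assms by simp
    obtain \<xi> where \<xi>: "\<xi> > y" "\<xi> < z"
      "z powr (a + 1) - y powr (a + 1) = (z - y) * ((a + 1) * \<xi> powr a)"
      using MVT2[OF yz, of "\<lambda>x. x powr (a + 1)" "\<lambda>x. (a + 1) * x powr a"] d assms by auto
    have "\<xi> powr a < z powr a" using \<xi> assms by (intro powr_less_mono2) auto
    then have "(z - y) * ((a + 1) * \<xi> powr a) < (z - y) * ((a + 1) * z powr a)"
      using yz assms by (intro mult_strict_left_mono) auto
    then show ?thesis using \<xi>(3) by (simp add: algebra_simps)
  qed
qed

definition kappa :: "nat \<Rightarrow> real \<Rightarrow> real" where "kappa N p = 2 * K_const N p / (p - 1)"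

definition grad_const :: "real \<Rightarrow> real" where "grad_const p = (2 / (p - 1)) powr (2 * p / (p + 1))"

definition angular_eig :: "nat \<Rightarrow> nat \<Rightarrow> real" where
  "angular_eig N k = real k * (real k + real N - 2)"

text \<open>The value of m at which harmonics of degree \<open>k\<close> enter the kernel of the
  linearization, solved from the second identity of \<open>crit_m_eq\<close>.\<close>

definition crit_m :: "nat \<Rightarrow> real \<Rightarrow> nat \<Rightarrow> real" where
  "crit_m N p k = (p + 1) / (p * (p - 1)) * (2 * K_const N p - angular_eig N k)"

definition branch_X :: "nat \<Rightarrow> real \<Rightarrow> real \<Rightarrow> real" where
  "branch_X N p m = (kappa N p - m) powr (1 / (p - 1))"

definition branch_M :: "nat \<Rightarrow> real \<Rightarrow> real \<Rightarrow> real" where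
  "branch_M N p m = m / (grad_const p * branch_X N p m powr ((p - 1) / (p + 1)))"

section \<open>Roots of the equation for constant solutions\<close>

context
  fixes p :: real and N :: nat
  assumes p: "p > 1"
begin

lemma grad_const_pos: "grad_const p > 0" using p by (simp add: grad_const_def)

lemma branch_X_powr: "kappa N p - m > 0 \<Longrightarrow> branch_X N p m powr (p - 1) = kappa N p - m"
  using p by (simp add: branch_X_def powr_powr)

lemma branch_X_pos: "kappa N p - m > 0 \<Longrightarrow> branch_X N p m > 0"
  by (simp add: branch_X_def)

lemma branch_M_mult:
  assumes "kappa N p - m > 0"
  shows "branch_M N p m * grad_const p * branch_X N p m powr ((p - 1) / (p + 1)) = m"
  using branch_X_pos[OF assms] grad_const_pos by (simp add: branch_M_def)

lemma branch_in_constant_solutions: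
  assumes "kappa N p - m > 0"
  shows "branch_X N p m \<in> constant_solutions N p (branch_M N p m)"
  using branch_X_pos[OF assms] branch_X_powr[OF assms] branch_M_mult[OF assms]
  by (simp add: constant_solutions_def grad_const_def kappa_def)

lemma sgn_branch_M: "kappa N p - m > 0 \<Longrightarrow> sgn (branch_M N p m) = sgn m"
  using branch_X_pos[of m] grad_const_pos by (simp add: branch_M_def sgn_divide sgn_mult)

text \<open>In the variable \<open>y = X\<^bsup>(p-1)/(p+1)\<^esup>\<close> the equation for the constant solutions reads
  \<open>y\<^bsup>p+1\<^esup> + M c y = \<kappa>\<close>.\<close>

lemma constant_solutions_iff:
  "X \<in> constant_solutions N p M \<longleftrightarrow> X > 0 \<and>
     (X powr ((p - 1) / (p + 1))) powr (p + 1) + M * grad_const p * X powr ((p - 1) / (p + 1)) = kappa N p"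
  using p by (auto simp: constant_solutions_def grad_const_def kappa_def powr_powr)

text \<open>Eliminating M from the equations of two roots x < y leaves x y (y^p - x^p) = (x - y)
  \<kappa>, whose left side is positive and whose right side is not when \<kappa> >= 0.\<close>

lemma constant_solutions_unique:
  assumes k: "kappa N p \<ge> 0" and X: "X \<in> constant_solutions N p M" and Y: "Y \<in> constant_solutions N p M"
  shows "X = Y"
proof -
  have less: False if X: "X \<in> constant_solutions N p M" and Y: "Y \<in> constant_solutions N p M" and "X < Y" for X Y
  proof -
    define x y where "x = X powr ((p - 1) / (p + 1))" and "y = Y powr ((p - 1) / (p + 1))"
    have x0: "x > 0" "y > 0" using X Y by (auto simp: x_def y_def constant_solutions_iff)
    have xy: "x < y" unfolding x_def y_def using X that p
      by (intro powr_less_mono2) (auto simp: constant_solutions_iff)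
    have ex: "x powr (p + 1) + M * grad_const p * x = kappa N p" "y powr (p + 1) + M * grad_const p * y = kappa N p"
      using X Y by (auto simp: x_def y_def constant_solutions_iff)
    have "y powr p * (x * y) - x powr p * (x * y) = (x - y) * kappa N p"
    proof -
      have "x powr (p + 1) = x powr p * x" "y powr (p + 1) = y powr p * y"
        using x0 by (simp_all add: powr_add)
      then have "y powr p * (x * y) - x powr p * (x * y)
          = (y powr (p + 1) + M * grad_const p * y) * x - (x powr (p + 1) + M * grad_const p * x) * y"
        by (simp add: algebra_simps)
      then show ?thesis unfolding ex by (simp add: algebra_simps)
    qed
    moreover have "x powr p < y powr p" using xy x0 p by (intro powr_less_mono2) auto
    then have "y powr p * (x * y) - x powr p * (x * y) > 0" using x0 by simp
    moreover have "(x - y) * kappa N p \<le> 0" using k xy by (intro mult_nonpos_nonneg) auto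
    ultimately show False by linarith
  qed
  then show ?thesis using X Y by (metis linorder_neqE_linordered_idom)
qed

lemma X_M_branch:
  assumes "kappa N p \<ge> 0" "kappa N p - m > 0"
  shows "X_M N p (branch_M N p m) = branch_X N p m"
  unfolding X_M_def
  by (rule the_equality) (use branch_in_constant_solutions[OF assms(2)] constant_solutions_unique[OF assms(1)] in blast)+

text \<open>The strictly convex function y^(p+1) + M c y takes the value \<kappa> at both roots, so
  at each root it must decrease towards the other.\<close>

lemma root_above_tangent:
  assumes X: "X \<in> constant_solutions N p M" and Y: "Y \<in> constant_solutions N p M" and "X \<noteq> Y"
  defines "x \<equiv> X powr ((p - 1) / (p + 1))" and "y \<equiv> Y powr ((p - 1) / (p + 1))"
  shows "((p + 1) * y powr p + M * grad_const p) * (x - y) < 0"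
proof -
  have x0: "x > 0" "y > 0" using X Y by (auto simp: x_def y_def constant_solutions_iff)
  have X0: "X > 0" "Y > 0" using X Y by (auto simp: constant_solutions_iff)
  have "x \<noteq> y"
  proof
    assume "x = y"
    then have "x powr ((p + 1) / (p - 1)) = y powr ((p + 1) / (p - 1))" by simp
    then show False using X0 p \<open>X \<noteq> Y\<close> by (simp add: x_def y_def powr_powr)
  qed
  then have "x powr (p + 1) > y powr (p + 1) + (p + 1) * y powr p * (x - y)"
    using x0 p by (intro powr_above_tangent) auto
  moreover have "x powr (p + 1) + M * grad_const p * x = kappa N p" "y powr (p + 1) + M * grad_const p * y = kappa N p"
    using X Y by (auto simp: x_def y_def constant_solutions_iff)
  ultimately show ?thesis by (simp add: algebra_simps)
qed

text \<open>At the middle one of three roots the slope would have to be both positive and negative.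
  Finiteness makes the \<open>Max\<close> in \<open>X2_M\<close> an actual root.\<close>

lemma finite_constant_solutions: "finite (constant_solutions N p M)"
proof -
  have three: False if X: "X \<in> constant_solutions N p M" and Y: "Y \<in> constant_solutions N p M"
    and Z: "Z \<in> constant_solutions N p M" and "X < Y" "Y < Z" for X Y Z
  proof -
    define y where "y = Y powr ((p - 1) / (p + 1))"
    have X0: "X > 0" "Y > 0" using X Y by (auto simp: constant_solutions_iff)
    have "X powr ((p - 1) / (p + 1)) < y" "y < Z powr ((p - 1) / (p + 1))"
      unfolding y_def using that X0 p by (intro powr_less_mono2; simp)+
    moreover have "((p + 1) * y powr p + M * grad_const p) * (X powr ((p - 1) / (p + 1)) - y) < 0"
      "((p + 1) * y powr p + M * grad_const p) * (Z powr ((p - 1) / (p + 1)) - y) < 0"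
      using root_above_tangent[OF X Y] root_above_tangent[OF Z Y] that by (auto simp: y_def)
    ultimately show False by (simp add: mult_less_0_iff)
  qed
  show ?thesis
  proof (cases "\<exists>X\<in>constant_solutions N p M. \<exists>Y\<in>constant_solutions N p M. X < Y")
    case True
    then obtain X Y where XY: "X \<in> constant_solutions N p M" "Y \<in> constant_solutions N p M" "X < Y" by blast
    have "constant_solutions N p M \<subseteq> {X, Y}"
    proof
      fix Z assume Z: "Z \<in> constant_solutions N p M"
      show "Z \<in> {X, Y}"
        using three[OF Z XY(1,2)] three[OF XY(1) Z XY(2)] three[OF XY(1,2) Z] XY(3) by fastforce
    qed
    then show ?thesis by (rule finite_subset) simp
  next
    case False
    show ?thesis
    proof (cases "constant_solutions N p M = {}")
      case nonempty: False
      then obtain X where "X \<in> constant_solutions N p M" by blast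
      then have "constant_solutions N p M \<subseteq> {X}" using False by (auto simp: not_less intro: antisym)
      then show ?thesis by (rule finite_subset) simp
    qed simp
  qed
qed

lemma crit_m_eq:
  "kappa N p - crit_m N p k = ((p + 1) * angular_eig N k - 2 * K_const N p) / (p * (p - 1))"
  "(p - 1) * kappa N p - p * (p - 1) / (p + 1) * crit_m N p k = angular_eig N k"
proof -
  have "p \<noteq> 0" "p - 1 \<noteq> 0" "p + 1 \<noteq> 0" using p by auto
  then show "kappa N p - crit_m N p k = ((p + 1) * angular_eig N k - 2 * K_const N p) / (p * (p - 1))"
    "(p - 1) * kappa N p - p * (p - 1) / (p + 1) * crit_m N p k = angular_eig N k"
    by (simp_all add: kappa_def crit_m_def divide_simps) (simp_all add: algebra_simps)
qed

section \<open>The points M_k in the case K < 0\<close>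

context
  fixes k :: nat
  assumes K: "K_const N p < 0" and eig: "angular_eig N k \<ge> 0"
begin

lemma kappa_crit_pos: "kappa N p - crit_m N p k > 0"
proof -
  have "(p + 1) * angular_eig N k \<ge> 0" using p eig by simp
  then have "(p + 1) * angular_eig N k - 2 * K_const N p > 0" using K by linarith
  then show ?thesis using p by (simp add: crit_m_eq)
qed

abbreviation "crit_M \<equiv> branch_M N p (crit_m N p k)"
abbreviation "crit_X \<equiv> branch_X N p (crit_m N p k)"
abbreviation "crit_y \<equiv> crit_X powr ((p - 1) / (p + 1))"

lemma crit_y: "crit_y > 0" "crit_y powr (p + 1) = kappa N p - crit_m N p k" "crit_M * grad_const p * crit_y = crit_m N p k"
  using branch_X_pos[OF kappa_crit_pos] branch_X_powr[OF kappa_crit_pos] branch_M_mult[OF kappa_crit_pos] p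
  by (simp_all add: powr_powr)

text \<open>The slope of y^(p+1) + M c y at \<open>crit_y\<close>, multiplied by
  \<open>crit_y\<close>, equals (p+1) lambda_k / (p-1) >= 0, so by convexity no root lies further to
  the right.\<close>

lemma X2_M_branch: "X2_M N p crit_M = crit_X"
  unfolding X2_M_def
proof (rule Max_eqI[OF finite_constant_solutions])
  show crit_X: "crit_X \<in> constant_solutions N p crit_M" by (rule branch_in_constant_solutions[OF kappa_crit_pos])
  fix X assume X: "X \<in> constant_solutions N p crit_M"
  show "X \<le> crit_X"
  proof (rule ccontr)
    assume "\<not> X \<le> crit_X"
    then have "crit_X < X" by simp
    then have "crit_y < X powr ((p - 1) / (p + 1))"
      using branch_X_pos[OF kappa_crit_pos] p by (intro powr_less_mono2) auto
    then have neg: "(p + 1) * crit_y powr p + crit_M * grad_const p < 0"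
      using root_above_tangent[OF X crit_X] \<open>crit_X < X\<close> by (auto simp: mult_less_0_iff)
    have "((p + 1) * crit_y powr p + crit_M * grad_const p) * crit_y = (p + 1) * crit_y powr (p + 1) + crit_M * grad_const p * crit_y"
      using crit_y(1) by (simp add: powr_add algebra_simps)
    also have "\<dots> = (p + 1) * (kappa N p - crit_m N p k) + crit_m N p k" unfolding crit_y(2,3) ..
    also have "\<dots> = (p + 1) * angular_eig N k / (p - 1)"
    proof -
      have "p \<noteq> 0" "p - 1 \<noteq> 0" using p by auto
      then show ?thesis by (simp add: kappa_def crit_m_def divide_simps) (simp add: algebra_simps)
    qed
    also have "\<dots> \<ge> 0" using p eig by simp
    finally show False using neg crit_y(1) by (simp add: zero_le_mult_iff)
  qed
qed

text \<open>The description is unique: its relation prescribes m, hence X^(p-1) = \<kappa> - m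
  prescribes X, and m and X together prescribe M.\<close>

lemma M_k_branch: "M_k N p k = crit_M"
  unfolding M_k_def
proof (rule the_equality)
  have d: "(p + 1) / (p * (p - 1)) * (2 * K_const N p - real k * (real k + real N - 2)) = crit_m N p k"
    by (simp add: crit_m_def angular_eig_def)
  show "constant_solutions N p crit_M \<noteq> {} \<and> crit_M * (2 / (p - 1)) powr (2 * p / (p + 1)) *
      X2_M N p crit_M powr ((p - 1) / (p + 1))
      = (p + 1) / (p * (p - 1)) * (2 * K_const N p - real k * (real k + real N - 2))"
    unfolding X2_M_branch d grad_const_def[symmetric] crit_y(3)
    using branch_in_constant_solutions[OF kappa_crit_pos] by blast
  fix M
  assume *: "constant_solutions N p M \<noteq> {} \<and> M * (2 / (p - 1)) powr (2 * p / (p + 1)) *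
      X2_M N p M powr ((p - 1) / (p + 1))
      = (p + 1) / (p * (p - 1)) * (2 * K_const N p - real k * (real k + real N - 2))"
  define X where "X = X2_M N p M"
  have X: "X \<in> constant_solutions N p M"
    unfolding X_def X2_M_def using * finite_constant_solutions by (intro Max_in) auto
  have m: "M * grad_const p * X powr ((p - 1) / (p + 1)) = crit_m N p k"
    using * unfolding d grad_const_def[symmetric] X_def[symmetric] by blast
  have crit_X: "X > 0" using X by (simp add: constant_solutions_iff)
  have "X powr (p - 1) = kappa N p - crit_m N p k"
    using X m p by (simp add: constant_solutions_iff powr_powr)
  then have "X = branch_X N p (crit_m N p k)"
    unfolding branch_X_def using crit_X p by (simp add: powr_powr flip: \<open>X powr (p - 1) = _\<close>)
  then show "M = crit_M" using m crit_y grad_const_pos by (simp add: branch_M_def field_simps)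
qed

text \<open>At the fold the slope vanishes, which gives the double root \<open>z\<close> with
  z^(p+1) = - \<kappa>/p and M = - mu_star. Then (M + mu_star) c y is minus the gap between the
  power at y = \<open>crit_y\<close> and its tangent at z, while y^(p+1) - z^(p+1) is a positive
  multiple of lambda_k.\<close>

lemma crit_M_mu_star: "angular_eig N k = 0 \<Longrightarrow> crit_M = - mu_star N p"
  "angular_eig N k > 0 \<Longrightarrow> crit_M < - mu_star N p"
proof -
  define z where "z = (- kappa N p / p) powr (1 / (p + 1))"
  have kn: "kappa N p < 0" using K p by (simp add: kappa_def divide_neg_pos)
  have kp: "- kappa N p / p > 0" using kn p by (simp add: divide_neg_pos)
  have z: "z > 0" "z powr (p + 1) = - kappa N p / p"
    unfolding z_def powr_powr using kp p powr_one[of "- kappa N p / p"] by (simp_all del: powr_one_gt_zero_iff)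
  have mu: "mu_star N p * grad_const p = (p + 1) * z powr p"
  proof -
    have "real N - (real N - 2) * p = - K_const N p * (p - 1)" using p by (simp add: K_const_def)
    then have "mu_star N p * grad_const p
        = (p + 1) * ((- K_const N p * (p - 1) / (2 * p)) powr (p / (p + 1)) * ((2 / (p - 1))\<^sup>2) powr (p / (p + 1)))"
      using p by (simp add: mu_star_def grad_const_def powr_powr flip: powr_numeral)
    also have "\<dots> = (p + 1) * (- K_const N p * (p - 1) / (2 * p) * (2 / (p - 1))\<^sup>2) powr (p / (p + 1))"
      using p K by (subst powr_mult) (auto simp: mult_nonpos_nonneg divide_nonpos_pos)
    also have "- K_const N p * (p - 1) / (2 * p) * (2 / (p - 1))\<^sup>2 = - kappa N p / p"
    proof -
      have "p \<noteq> 0" "p - 1 \<noteq> 0" using p by auto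
      then show ?thesis by (simp add: kappa_def power2_eq_square divide_simps)
    qed
    also have "(- kappa N p / p) powr (p / (p + 1)) = z powr p"
      by (simp add: z_def powr_powr)
    finally show ?thesis .
  qed
  have zeq: "z powr p * z = z powr (p + 1)" using z by (simp add: powr_add)
  have crit_M: "crit_M * grad_const p * crit_y = kappa N p - crit_y powr (p + 1)" using crit_y by simp
  have d: "crit_y powr (p + 1) - z powr (p + 1) = (p + 1) * angular_eig N k / (p * (p - 1))"
  proof -
    have "p \<noteq> 0" "p - 1 \<noteq> 0" using p by auto
    then show ?thesis unfolding crit_y(2) z(2) crit_m_eq(1) unfolding kappa_def by (simp add: divide_simps)
  qed
  have diff: "(crit_M + mu_star N p) * grad_const p * crit_y
      = - (crit_y powr (p + 1) - z powr (p + 1) - (p + 1) * z powr p * (crit_y - z))"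
  proof -
    have k': "kappa N p = - p * z powr (p + 1)" using z(2) p by simp
    have e: "(p + 1) * z powr p * (crit_y - z) = (p + 1) * z powr p * crit_y - (p + 1) * z powr (p + 1)"
      unfolding zeq[symmetric] by (simp add: algebra_simps)
    have "(crit_M + mu_star N p) * grad_const p * crit_y = crit_M * grad_const p * crit_y + mu_star N p * grad_const p * crit_y"
      by (simp add: algebra_simps)
    also have "\<dots> = - p * z powr (p + 1) - crit_y powr (p + 1) + (p + 1) * z powr p * crit_y"
      unfolding crit_M mu k' ..
    also have "\<dots> = - (crit_y powr (p + 1) - z powr (p + 1) - (p + 1) * z powr p * (crit_y - z))"
      unfolding e by (simp add: algebra_simps)
    finally show ?thesis .
  qed
  show "crit_M < - mu_star N p" if "angular_eig N k > 0"
  proof -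
    have "(p + 1) * angular_eig N k / (p * (p - 1)) > 0" using p that by simp
    then have "crit_y \<noteq> z" using d by auto
    then have "(crit_M + mu_star N p) * grad_const p * crit_y < 0"
      unfolding diff using powr_above_tangent[of crit_y z p] crit_y(1) z(1) p by auto
    then show ?thesis using grad_const_pos crit_y(1) by (auto simp: mult_less_0_iff zero_less_mult_iff not_less)
  qed
  show "crit_M = - mu_star N p" if "angular_eig N k = 0"
  proof -
    have "crit_y powr (p + 1) = z powr (p + 1)" using d that by simp
    then have "(crit_y powr (p + 1)) powr (1 / (p + 1)) = (z powr (p + 1)) powr (1 / (p + 1))" by simp
    then have "crit_y = z" using crit_y(1) z(1) p by (simp add: powr_powr)
    then have "(crit_M + mu_star N p) * grad_const p * crit_y = 0" unfolding diff by simp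
    then show ?thesis using grad_const_pos crit_y(1) by auto
  qed
qed

end

end

subsection \<open>Bifurcation on the sphere\<close>

lemma uniform_limit_const_fun:
  assumes "(f \<longlongrightarrow> l) F"
  shows "uniform_limit S (\<lambda>s x. f s) (\<lambda>x. l) F"
  by (rule uniform_limitI) (use tendstoD[OF assms] in \<open>auto elim: eventually_mono\<close>)

abbreviation nonradial_separable_solution :: "'a::euclidean_space itself \<Rightarrow> real \<Rightarrow> bool" where
  "nonradial_separable_solution _ p \<equiv>
     \<exists>(M::real) (u :: 'a \<Rightarrow> real) (\<omega> :: 'a \<Rightarrow> real).
       emden_solution p M u \<and> (\<forall>x. x \<noteq> 0 \<longrightarrow> u x > 0) \<and>
       nonradial u \<and> singular_at_origin u \<and>
       (\<forall>r>0. \<forall>\<sigma>\<in>sphere 0 1. u (r *\<^sub>R \<sigma>) = r powr (- (2 / (p - 1))) * \<omega> \<sigma>)"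

lemma bifurcates_from_zonal_family:
  fixes e :: "'a::euclidean_space" and M :: "real \<Rightarrow> real" and w w' w'' :: "real \<Rightarrow> real \<Rightarrow> real"
  assumes p: "p > 1" and \<epsilon>: "\<epsilon> > 0" and e: "norm e = 1"
    and M: "continuous_on {-\<epsilon><..<\<epsilon>} M"
    and w: "\<And>s. \<bar>s\<bar> < \<epsilon> \<Longrightarrow> zonal_sphere e (w s) (w' s) (w'' s)"
    and sol: "\<And>s \<sigma>. \<bar>s\<bar> < \<epsilon> \<Longrightarrow> \<sigma> \<in> sphere 0 1 \<Longrightarrow>
      zonal_solution_at DIM('a) p (M s) (w s) (w' s) (w'' s) (\<sigma> \<bullet> e)"
    and lim: "\<And>s. \<bar>s\<bar> < \<epsilon> \<Longrightarrow> uniform_limit {-1..1} w (w s) (at s)"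
      "\<And>s. \<bar>s\<bar> < \<epsilon> \<Longrightarrow> uniform_limit {-1..1} w' (w' s) (at s)"
    and w0: "\<And>t. w 0 t = X0"
    and nonconst: "\<And>s. \<bar>s\<bar> < \<epsilon> \<Longrightarrow> s \<noteq> 0 \<Longrightarrow> \<not> (\<lambda>\<sigma>. w s (\<sigma> \<bullet> e)) constant_on sphere 0 1"
  shows "bifurcates_from TYPE('a) p (M 0) X0"
    and "nonradial_separable_solution TYPE('a) p"
proof -
  have inner: "\<sigma> \<bullet> e \<in> {-1..1}" if "\<sigma> \<in> sphere 0 1" for \<sigma>
    using zonal_arg[OF e, of \<sigma>] that by (auto simp: abs_le_iff)
  show "bifurcates_from TYPE('a) p (M 0) X0"
    unfolding bifurcates_from_def
  proof (intro exI[of _ \<epsilon>] conjI exI[of _ M] exI[of _ "\<lambda>s \<sigma>. w s (\<sigma> \<bullet> e)"] ballI impI)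
    fix s assume "s \<in> {-\<epsilon><..<\<epsilon>}"
    then have s: "\<bar>s\<bar> < \<epsilon>" by auto
    interpret s: zonal_sphere e "w s" "w' s" "w'' s" by (rule w[OF s])
    show "uniform_limit (sphere 0 1) (\<lambda>s \<sigma>. w s (\<sigma> \<bullet> e)) (\<lambda>\<sigma>. w s (\<sigma> \<bullet> e)) (at s)"
      by (rule uniform_limit_compose_set[OF lim(1)[OF s] inner])
    have "continuous_on {-1..1} (w' s)"
      using DERIV_isCont[OF s.w'] by (intro continuous_at_imp_continuous_on) auto
    then have "bounded ((w' s) ` {-1..1})"
      by (intro compact_imp_bounded compact_continuous_image) auto
    then have b: "bounded ((\<lambda>\<sigma>. w' s (\<sigma> \<bullet> e)) ` sphere 0 1)"
      by (rule bounded_subset) (use inner in auto)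
    \<comment> \<open>This vector is the tangential part of \<open>e\<close>, that is, the spherical
      gradient of \<open>\<sigma> \<bullet> e\<close>.\<close>
    have "continuous_on (sphere 0 1) (\<lambda>\<sigma>. e - (\<sigma> \<bullet> e) *\<^sub>R \<sigma>)" by (intro continuous_intros)
    then have b': "bounded ((\<lambda>\<sigma>. e - (\<sigma> \<bullet> e) *\<^sub>R \<sigma>) ` sphere 0 1)"
      by (intro compact_imp_bounded compact_continuous_image) auto
    have "uniform_limit (sphere 0 1) (\<lambda>s \<sigma>. w' s (\<sigma> \<bullet> e) *\<^sub>R (e - (\<sigma> \<bullet> e) *\<^sub>R \<sigma>))
        (\<lambda>\<sigma>. w' s (\<sigma> \<bullet> e) *\<^sub>R (e - (\<sigma> \<bullet> e) *\<^sub>R \<sigma>)) (at s)"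
      by (intro bounded_bilinear.bounded_uniform_limit[OF bounded_bilinear_scaleR] b b'
          uniform_limit_const uniform_limit_compose_set[OF lim(2)[OF s] inner])
    moreover have "\<forall>\<^sub>F r in at s. \<forall>\<sigma>\<in>sphere 0 1.
        w' r (\<sigma> \<bullet> e) *\<^sub>R (e - (\<sigma> \<bullet> e) *\<^sub>R \<sigma>) = sphere_grad (\<lambda>\<sigma>. w r (\<sigma> \<bullet> e)) \<sigma>"
    proof -
      have "\<forall>\<^sub>F r in at s. r \<in> {-\<epsilon><..<\<epsilon>}"
        using s by (intro eventually_at_in_open') auto
      then show ?thesis
        by (rule eventually_mono) (use zonal_sphere.sphere_grad_zonal[OF w] in auto)
    qed
    ultimately show "uniform_limit (sphere 0 1) (\<lambda>t. sphere_grad (\<lambda>\<sigma>. w t (\<sigma> \<bullet> e)))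
        (sphere_grad (\<lambda>\<sigma>. w s (\<sigma> \<bullet> e))) (at s)"
      by (rule uniform_limit_cong[THEN iffD1, rotated 2]) (simp add: s.sphere_grad_zonal)
    show "sphere_solution p (M s) (\<lambda>\<sigma>. w s (\<sigma> \<bullet> e))"
      by (rule s.sphere_solution_zonal[OF sol[OF s]])
    show "\<not> (\<lambda>\<sigma>. w s (\<sigma> \<bullet> e)) constant_on sphere 0 1" if "s \<noteq> 0"
      by (rule nonconst[OF s that])
  qed (use \<epsilon> M w0 in auto)
  \<comment> \<open>One member of the family off the constant solution supplies the nonradial
    solution.\<close>
  have h: "\<bar>\<epsilon> / 2\<bar> < \<epsilon>" "\<epsilon> / 2 \<noteq> 0" using \<epsilon> by auto
  interpret s: zonal_sphere e "w (\<epsilon> / 2)" "w' (\<epsilon> / 2)" "w'' (\<epsilon> / 2)" by (rule w[OF h(1)])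
  show "nonradial_separable_solution TYPE('a) p"
    using s.emden_zonal[OF p sol[OF h(1)] nonconst[OF h]] by blast
qed

text \<open>A second basis vector completes \<open>t *\<^sub>R e\<close> to a unit vector. This
  carries nonconstancy from [-1, 1] over to the sphere, and it fails on the two-point
  sphere.\<close>

lemma sphere_inner_onto:
  fixes e :: "'a::euclidean_space"
  assumes N: "DIM('a) \<ge> 2" and e: "e \<in> Basis" and t: "t \<in> {-1..1}"
  obtains \<sigma> where "\<sigma> \<in> sphere 0 1" "\<sigma> \<bullet> e = t"
proof -
  have "\<not> Basis \<subseteq> {e}" using N card_mono[of "{e}" "Basis :: 'a set"] by auto
  then obtain e' :: 'a where e': "e' \<in> Basis" "e' \<noteq> e" by blast
  have ie: "e \<bullet> e = 1" "e' \<bullet> e' = 1" "e \<bullet> e' = 0" "e' \<bullet> e = 0"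
    using e e' by (auto simp: inner_Basis)
  have "t\<^sup>2 \<le> 1" using t by (simp add: abs_square_le_1 abs_le_iff)
  show ?thesis
  proof (rule that[of "t *\<^sub>R e + sqrt (1 - t\<^sup>2) *\<^sub>R e'"])
    have "(norm (t *\<^sub>R e + sqrt (1 - t\<^sup>2) *\<^sub>R e'))\<^sup>2 = t * t + sqrt (1 - t\<^sup>2) * sqrt (1 - t\<^sup>2)"
      unfolding power2_norm_eq_inner by (simp add: inner_add_left inner_add_right ie)
    also have "\<dots> = 1" using \<open>t\<^sup>2 \<le> 1\<close> by (simp add: power2_eq_square)
    finally have "norm (t *\<^sub>R e + sqrt (1 - t\<^sup>2) *\<^sub>R e') = 1"
      using power2_eq_imp_eq[of "norm (t *\<^sub>R e + sqrt (1 - t\<^sup>2) *\<^sub>R e')" 1] by simp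
    then show "t *\<^sub>R e + sqrt (1 - t\<^sup>2) *\<^sub>R e' \<in> sphere 0 1" by simp
  qed (simp add: inner_add_left ie)
qed

text \<open>Since 2p/(p+1) = (p-1)/(p+1) + 1, both powers of X reduce to X times a coefficient,
  namely \<kappa> - m and m; the constant X thus factors out.\<close>

lemma scaled_nonlinearity:
  fixes X V S p a :: real
  assumes p: "p > 1" and X: "X > 0" and V: "V > 0" and S: "S \<ge> 0"
    and m: "M * grad_const p * X powr ((p - 1) / (p + 1)) = m" and X': "X powr (p - 1) = \<kappa> - m"
  shows "(X * V) powr p + M * ((2 / (p - 1))\<^sup>2 * X\<^sup>2 * S) powr (p / (p + 1))
    = X * ((\<kappa> - m) * V powr p + m * S powr (p / (p + 1)))"
proof -
  have "2 * (p / (p + 1)) = (p - 1) / (p + 1) + 1" using p by (simp add: field_simps)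
  then have "X powr (2 * (p / (p + 1))) = X powr ((p - 1) / (p + 1)) * X"
    using X by (simp only: powr_add powr_one_gt_zero_iff powr_one)
  moreover have "((2 / (p - 1))\<^sup>2 * X\<^sup>2 * S) powr (p / (p + 1))
      = grad_const p * X powr (2 * (p / (p + 1))) * S powr (p / (p + 1))"
  proof -
    have "((2 / (p - 1))\<^sup>2 * X\<^sup>2 * S) powr (p / (p + 1))
        = ((2 / (p - 1))\<^sup>2) powr (p / (p + 1)) * (X\<^sup>2) powr (p / (p + 1)) * S powr (p / (p + 1))"
      using S by (simp add: powr_mult)
    also have "((2 / (p - 1))\<^sup>2) powr (p / (p + 1)) = grad_const p"
      using p by (simp add: power2_powr grad_const_def)
    finally show ?thesis using X by (simp add: power2_powr)
  qed
  moreover have "(X * V) powr p = (\<kappa> - m) * X * V powr p"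
  proof -
    have "X powr p = (\<kappa> - m) * X" using X X' by (simp add: powr_diff field_simps)
    then show ?thesis using X V by (simp add: powr_mult)
  qed
  ultimately have "(X * V) powr p + M * ((2 / (p - 1))\<^sup>2 * X\<^sup>2 * S) powr (p / (p + 1))
      = (\<kappa> - m) * X * V powr p + (M * grad_const p * X powr ((p - 1) / (p + 1))) * X * S powr (p / (p + 1))"
    by (simp add: mult_ac)
  then show ?thesis unfolding m by (simp add: algebra_simps)
qed

lemma bifurcation_from_branch:
  fixes p :: real
  assumes p: "p > 1" and dim: "DIM('a::euclidean_space) \<ge> 2" and k: "k \<ge> 1"
    and pos: "kappa DIM('a) p - crit_m DIM('a) p k > 0"
  shows "bifurcates_from TYPE('a) p (branch_M DIM('a) p (crit_m DIM('a) p k))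
      (branch_X DIM('a) p (crit_m DIM('a) p k))"
    and "nonradial_separable_solution TYPE('a) p"
proof -
  define N where "N = DIM('a)"
  define \<kappa> where "\<kappa> = kappa N p"
  define m0 where "m0 = crit_m N p k"
  \<comment> \<open>The reciprocal of (2/(p-1))^2, which is taken out of the base of the second
    power.\<close>
  define d where "d = ((p - 1) / 2)\<^sup>2"
  have pos: "\<kappa> - m0 > 0" using pos by (simp add: \<kappa>_def m0_def N_def)
  interpret zonal N k by standard (use dim k in \<open>auto simp: N_def\<close>)
  have crit: "(p - 1) * \<kappa> - p * (p - 1) / (p + 1) * m0 = eig k"
    unfolding \<kappa>_def m0_def eig_def using crit_m_eq(2)[OF p, of N k] by (simp add: angular_eig_def)
  obtain \<epsilon>0 :: real and m V V' V'' where \<epsilon>0: "\<epsilon>0 > 0" and cont_m: "continuous_on {-\<epsilon>0<..<\<epsilon>0} m"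
    and m0: "m 0 = m0"
    and V': "\<And>s t. \<bar>t\<bar> < 2 \<Longrightarrow> (V s has_real_derivative V' s t) (at t)"
    and V'': "\<And>s t. \<bar>t\<bar> < 2 \<Longrightarrow> (V' s has_real_derivative V'' s t) (at t)"
    and cont_V'': "\<And>s. continuous_on {-2<..<2} (V'' s)"
    and V_pos: "\<And>s t. \<bar>s\<bar> < \<epsilon>0 \<Longrightarrow> \<bar>t\<bar> < 2 \<Longrightarrow> V s t > 0"
    and eqn: "\<And>s t. \<bar>s\<bar> < \<epsilon>0 \<Longrightarrow> \<bar>t\<bar> \<le> 1 \<Longrightarrow>
      - ((1 - t\<^sup>2) * V'' s t - (real N - 1) * t * V' s t) + \<kappa> * V s t
        = (\<kappa> - m s) * V s t powr p
          + m s * ((V s t)\<^sup>2 + d * ((1 - t\<^sup>2) * (V' s t)\<^sup>2)) powr (p / (p + 1))"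
    and lim: "\<And>s. \<bar>s\<bar> < \<epsilon>0 \<Longrightarrow> uniform_limit {-1..1} V (V s) (at s)"
      "\<And>s. \<bar>s\<bar> < \<epsilon>0 \<Longrightarrow> uniform_limit {-1..1} V' (V' s) (at s)"
    and V0: "\<And>t. V 0 t = 1"
    and nonconst: "\<And>s. \<bar>s\<bar> < \<epsilon>0 \<Longrightarrow> s \<noteq> 0 \<Longrightarrow> \<not> V s constant_on {-1..1}"
    by (fact ode_branch[OF p crit, where d = d])
  have "isCont m 0" using cont_m \<epsilon>0 by (simp add: continuous_on_eq_continuous_at)
  then have "(m \<longlongrightarrow> m0) (at 0)" by (simp add: isCont_def m0)
  then have "\<forall>\<^sub>F s in at 0. m s < \<kappa>" using pos by (intro order_tendstoD(2)) auto
  \<comment> \<open>Continuity keeps m below \<kappa> near s = 0, where X and M are positive and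
    well defined functions of m, respectively.\<close>
  then obtain \<epsilon>1 where \<epsilon>1: "\<epsilon>1 > 0" "\<And>s. s \<noteq> 0 \<Longrightarrow> \<bar>s\<bar> < \<epsilon>1 \<Longrightarrow> m s < \<kappa>"
    by (auto simp: eventually_at)
  define \<epsilon> where "\<epsilon> = min \<epsilon>0 \<epsilon>1"
  have \<epsilon>: "\<epsilon> > 0" "\<And>s. \<bar>s\<bar> < \<epsilon> \<Longrightarrow> \<bar>s\<bar> < \<epsilon>0" using \<epsilon>0 \<epsilon>1 by (auto simp: \<epsilon>_def)
  have m_pos: "kappa N p - m s > 0" if "\<bar>s\<bar> < \<epsilon>" for s
    using \<epsilon>1(2)[of s] that pos m0 by (cases "s = 0") (auto simp: \<epsilon>_def \<kappa>_def)
  define X where "X s = branch_X N p (m s)" for s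
  define M where "M s = branch_M N p (m s)" for s
  note X = branch_X_pos[OF p m_pos, folded X_def] branch_X_powr[OF p m_pos, folded X_def]
    branch_M_mult[OF p m_pos, folded X_def M_def]
  have cont_m: "continuous_on {-\<epsilon><..<\<epsilon>} m"
    using cont_m by (rule continuous_on_subset) (auto simp: \<epsilon>_def)
  have cont_X: "continuous_on {-\<epsilon><..<\<epsilon>} X"
    unfolding X_def branch_X_def using m_pos
    by (intro continuous_on_powr continuous_intros cont_m) (force simp: abs_less_iff)
  have cont_M: "continuous_on {-\<epsilon><..<\<epsilon>} M"
    unfolding M_def branch_M_def X_def[symmetric] using X(1) grad_const_pos[OF p]
    by (intro continuous_on_powr continuous_intros cont_m cont_X) (force simp: abs_less_iff)+
  obtain e :: 'a where e: "e \<in> Basis" using nonempty_Basis by blast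
  have e1: "norm e = 1" using e by simp
  define w w' w'' where "w s t = X s * V s t" and "w' s t = X s * V' s t" and "w'' s t = X s * V'' s t" for s t
  have zs: "zonal_sphere e (w s) (w' s) (w'' s)" for s
  proof
    show "(w s has_real_derivative w' s t) (at t)" "(w' s has_real_derivative w'' s t) (at t)"
      if "\<bar>t\<bar> < 2" for t
      unfolding w_def[abs_def] w'_def[abs_def] w''_def
      by (auto intro!: derivative_eq_intros V' V'' that)
    show "continuous_on {-2<..<2} (w'' s)"
      unfolding w''_def[abs_def] by (intro continuous_intros cont_V'')
  qed (rule e1)
  have sol: "zonal_solution_at DIM('a) p (M s) (w s) (w' s) (w'' s) t"
    if s: "\<bar>s\<bar> < \<epsilon>" and t: "\<bar>t\<bar> \<le> 1" for s t
    unfolding zonal_solution_at_def N_def[symmetric]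
  proof
    have s0: "\<bar>s\<bar> < \<epsilon>0" using \<epsilon>(2)[OF s] .
    have Vp: "V s t > 0" using V_pos[OF s0] t by simp
    show "w s t > 0" using X(1)[OF s] Vp by (simp add: w_def)
    define S where "S = (V s t)\<^sup>2 + d * ((1 - t\<^sup>2) * (V' s t)\<^sup>2)"
    have "t\<^sup>2 \<le> 1" using t by (simp add: abs_square_le_1)
    then have S: "S \<ge> 0" by (simp add: S_def d_def)
    have S': "(2 / (p - 1))\<^sup>2 * (w s t)\<^sup>2 + (1 - t\<^sup>2) * (w' s t)\<^sup>2 = (2 / (p - 1))\<^sup>2 * (X s)\<^sup>2 * S"
    proof -
      have ad: "(2 / (p - 1))\<^sup>2 * d = 1" using p by (simp add: d_def power_divide)
      have "(2 / (p - 1))\<^sup>2 * (X s)\<^sup>2 * S = (2 / (p - 1))\<^sup>2 * (X s)\<^sup>2 * (V s t)\<^sup>2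
          + ((2 / (p - 1))\<^sup>2 * d) * ((X s)\<^sup>2 * ((1 - t\<^sup>2) * (V' s t)\<^sup>2))"
        unfolding S_def by (simp only: distrib_left mult_ac)
      then have "(2 / (p - 1))\<^sup>2 * (X s)\<^sup>2 * S = (2 / (p - 1))\<^sup>2 * ((X s)\<^sup>2 * (V s t)\<^sup>2)
          + (1 - t\<^sup>2) * ((X s)\<^sup>2 * (V' s t)\<^sup>2)"
        unfolding ad by (simp only: mult_1_left mult_ac)
      then show ?thesis by (simp only: w_def w'_def power_mult_distrib)
    qed
    have "- ((1 - t\<^sup>2) * w'' s t - (real N - 1) * t * w' s t) + 2 * K_const N p / (p - 1) * w s t
        = X s * (- ((1 - t\<^sup>2) * V'' s t - (real N - 1) * t * V' s t) + \<kappa> * V s t)"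
      by (simp add: w_def w'_def w''_def \<kappa>_def kappa_def algebra_simps)
    also have "\<dots> = X s * ((\<kappa> - m s) * V s t powr p + m s * S powr (p / (p + 1)))"
      unfolding eqn[OF s0 t] S_def ..
    also have "\<dots> = (X s * V s t) powr p + M s * ((2 / (p - 1))\<^sup>2 * (X s)\<^sup>2 * S) powr (p / (p + 1))"
      using X(2)[OF s]
      by (intro scaled_nonlinearity[symmetric] p X(1)[OF s] Vp S X(3)[OF s]) (simp add: \<kappa>_def)
    finally show "- ((1 - t\<^sup>2) * w'' s t - (real N - 1) * t * w' s t) + 2 * K_const N p / (p - 1) * w s t
        = w s t powr p + M s * ((2 / (p - 1))\<^sup>2 * (w s t)\<^sup>2 + (1 - t\<^sup>2) * (w' s t)\<^sup>2) powr (p / (p + 1))"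
      unfolding S' by (simp add: w_def)
  qed
  have Xlim: "uniform_limit {-1..1} (\<lambda>s t. X s) (\<lambda>t. X s) (at s)" if s: "\<bar>s\<bar> < \<epsilon>" for s
  proof -
    have "isCont X s" using cont_X s by (auto simp: continuous_on_eq_continuous_at abs_less_iff)
    then show ?thesis by (intro uniform_limit_const_fun) (simp add: isCont_def)
  qed
  have bdd: "bounded (V s ` {-1..1})" "bounded (V' s ` {-1..1})" for s
  proof -
    have "continuous_on {-1..1} (V s)" "continuous_on {-1..1} (V' s)"
      using DERIV_isCont[OF V'] DERIV_isCont[OF V''] by (auto intro!: continuous_at_imp_continuous_on)
    then show "bounded (V s ` {-1..1})" "bounded (V' s ` {-1..1})"
      by (auto intro!: compact_imp_bounded compact_continuous_image)
  qed
  have inner: "\<bar>\<sigma> \<bullet> e\<bar> \<le> 1" if "\<sigma> \<in> sphere 0 1" for \<sigma>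
    using zonal_arg[OF e1, of \<sigma>] that by simp
  have lim_w: "uniform_limit {-1..1} w (w s) (at s)" "uniform_limit {-1..1} w' (w' s) (at s)"
    if s: "\<bar>s\<bar> < \<epsilon>" for s
    unfolding w_def[abs_def] w'_def[abs_def]
    by (intro uniform_lim_mult Xlim[OF s] lim \<epsilon>(2)[OF s] bdd; force simp: bounded_iff)+
  have nonconst_w: "\<not> (\<lambda>\<sigma>. w s (\<sigma> \<bullet> e)) constant_on sphere 0 1" if s: "\<bar>s\<bar> < \<epsilon>" "s \<noteq> 0" for s
  proof
    assume "(\<lambda>\<sigma>. w s (\<sigma> \<bullet> e)) constant_on sphere 0 1"
    then obtain c where c: "\<And>\<sigma>. \<sigma> \<in> sphere 0 1 \<Longrightarrow> w s (\<sigma> \<bullet> e) = c" by (auto simp: constant_on_def)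
    have "V s t = c / X s" if t: "t \<in> {-1..1}" for t
    proof -
      obtain \<sigma> where "\<sigma> \<in> sphere 0 1" "\<sigma> \<bullet> e = t" by (rule sphere_inner_onto[OF dim e t])
      then show ?thesis using c[of \<sigma>] X(1)[OF s(1)] by (simp add: w_def field_simps)
    qed
    then have "V s constant_on {-1..1}" by (auto simp: constant_on_def)
    then show False using nonconst \<epsilon>(2) s by blast
  qed
  have w0: "w 0 t = X 0" for t by (simp add: w_def V0)
  note family = bifurcates_from_zonal_family[of p \<epsilon> e M w w' w'' "X 0",
      OF p \<epsilon>(1) e1 cont_M zs sol[OF _ inner] lim_w w0 nonconst_w]
  show "bifurcates_from TYPE('a) p (branch_M DIM('a) p (crit_m DIM('a) p k))
      (branch_X DIM('a) p (crit_m DIM('a) p k))"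
    using family(1) by (simp add: M_def X_def m0 m0_def N_def)
  show "nonradial_separable_solution TYPE('a) p"
    by (rule family(2))
qed

text \<open>On two points the differential terms vanish, so a solution assigns to each point a
  constant solution for the same M. The curve passes through the double root, where the two
  constants merge.\<close>

lemma two_point_bifurcation:
  fixes p :: real
  assumes p: "p > 1" and dim: "DIM('a::euclidean_space) = 1"
  shows "bifurcates_from TYPE('a) p (branch_M 1 p (crit_m 1 p 1)) (branch_X 1 p (crit_m 1 p 1))"
    and "nonradial_separable_solution TYPE('a) p"
proof -
  define \<kappa> where "\<kappa> = kappa 1 p"
  have \<kappa>: "\<kappa> < 0" using p by (simp add: \<kappa>_def kappa_def K_const_def divide_neg_pos)
  \<comment> \<open>Two roots \<open>y\<close> and \<open>exp s * y\<close> of \<open>y\<^bsup>p+1\<^esup> + M c y = \<kappa>\<close> for the same \<open>M\<close> satisfy \<open>y\<^bsup>p+1\<^esup> = - \<kappa> g(s)\<close>.\<close>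
  define g where "g s = (if s = 0 then 1 / p else (1 - exp (- s)) / (exp (p * s) - 1))" for s :: real
  have e1: "exp (p * s) - 1 \<noteq> 0" if "s \<noteq> 0" for s using that p by simp
  have g_eq: "g s * (exp (p * s) - 1) = 1 - exp (- s)" for s
    using e1[of s] by (simp add: g_def)
  have g_pos: "g s > 0" for s
  proof -
    consider "s = 0" | "s > 0" | "s < 0" by linarith
    then show ?thesis
    proof cases
      case 3
      then have "1 - exp (- s) < 0" "exp (p * s) - 1 < 0" using p by (auto simp: mult_pos_neg)
      then show ?thesis using 3 by (simp add: g_def divide_neg_neg)
    qed (use p in \<open>auto simp: g_def intro!: divide_pos_pos\<close>)
  qed
  have "isCont g s" for s
  proof (cases "s = 0")
    case True
    have "((\<lambda>s. 1 - exp (- s)) has_real_derivative 1) (at 0)"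
      "((\<lambda>s. exp (p * s) - 1) has_real_derivative p) (at 0)"
      by (auto intro!: derivative_eq_intros)
    then have "((\<lambda>s::real. (1 - exp (- s)) / s) \<longlongrightarrow> 1) (at 0)" "((\<lambda>s. (exp (p * s) - 1) / s) \<longlongrightarrow> p) (at 0)"
      by (simp_all add: has_field_derivative_iff)
    then have "((\<lambda>s. ((1 - exp (- s)) / s) / ((exp (p * s) - 1) / s)) \<longlongrightarrow> 1 / p) (at 0)"
      using p by (intro tendsto_divide) auto
    then have "(g \<longlongrightarrow> 1 / p) (at 0)"
      by (rule Lim_transform_eventually) (auto simp: eventually_at_filter g_def)
    then show ?thesis by (simp add: True isCont_def g_def)
  next
    case False
    have "continuous_on (- {0}) (\<lambda>s. (1 - exp (- s)) / (exp (p * s) - 1))"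
      using e1 by (intro continuous_intros) auto
    then have "continuous_on (- {0}) g"
      by (rule continuous_on_eq) (simp add: g_def)
    then show ?thesis using False by (simp add: continuous_on_eq_continuous_at open_Compl)
  qed
  then have cont_g: "continuous_on S g" for S
    by (simp add: continuous_at_imp_continuous_on)
  \<comment> \<open>Chosen so that \<kappa> - m, which is y^(p+1) on the branch, takes the values
    belonging to y and \<open>exp s\<close> y.\<close>
  define m1 m2 where "m1 s = \<kappa> - (- \<kappa>) * g s" and "m2 s = \<kappa> - (- \<kappa>) * (exp ((p + 1) * s) * g s)" for s
  define X1 X2 M where "X1 s = branch_X 1 p (m1 s)" and "X2 s = branch_X 1 p (m2 s)"
    and "M s = branch_M 1 p (m1 s)" for s
  have pos: "kappa 1 p - m1 s > 0" "kappa 1 p - m2 s > 0" for s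
    unfolding m1_def m2_def \<kappa>_def[symmetric] using \<kappa> g_pos[of s] by (simp_all add: mult_neg_pos)
  \<comment> \<open>As m = M c y, equality of the two M amounts to
    \<open>m2 s = exp s * m1 s\<close>.\<close>
  have M2: "branch_M 1 p (m2 s) = M s" for s
  proof -
    have y: "branch_X 1 p m powr ((p - 1) / (p + 1)) = (\<kappa> - m) powr (1 / (p + 1))" for m
      using p by (simp add: branch_X_def powr_powr \<kappa>_def)
    have "(\<kappa> - m2 s) powr (1 / (p + 1)) = (exp ((p + 1) * s) * (\<kappa> - m1 s)) powr (1 / (p + 1))"
      by (simp add: m1_def m2_def mult_ac)
    also have "\<dots> = exp ((p + 1) * s) powr (1 / (p + 1)) * (\<kappa> - m1 s) powr (1 / (p + 1))"
      using pos(1)[of s] by (simp add: powr_mult \<kappa>_def)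
    also have "exp ((p + 1) * s) powr (1 / (p + 1)) = exp s"
      using p by (simp add: powr_def)
    finally have y2: "(\<kappa> - m2 s) powr (1 / (p + 1)) = exp s * (\<kappa> - m1 s) powr (1 / (p + 1))" .
    have "exp ((p + 1) * s) = exp s * exp (p * s)" by (simp add: algebra_simps flip: exp_add)
    then have "1 + exp ((p + 1) * s) * g s = 1 + exp s * (g s * (exp (p * s) - 1)) + exp s * g s"
      by (simp add: algebra_simps)
    also have "\<dots> = exp s * (1 + g s)"
      unfolding g_eq by (simp add: algebra_simps flip: exp_add)
    finally have "\<kappa> * (1 + exp ((p + 1) * s) * g s) = exp s * (\<kappa> * (1 + g s))" by simp
    then have "m2 s = exp s * m1 s" by (simp add: m1_def m2_def algebra_simps)
    then show ?thesis unfolding M_def branch_M_def y y2 by simp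
  qed
  have cont_m: "continuous_on S m1" "continuous_on S m2" for S
    unfolding m1_def m2_def by (intro continuous_intros cont_g)+
  have cont_X: "continuous_on S X1" "continuous_on S X2" for S
    unfolding X1_def X2_def branch_X_def using pos
    by (intro continuous_on_powr continuous_intros cont_m; metis less_irrefl)+
  have X_pos: "X1 s > 0" "X2 s > 0" for s
    using branch_X_pos[OF p pos(1)] branch_X_pos[OF p pos(2)] by (auto simp: X1_def X2_def)
  have cont_M: "continuous_on S M" for S
    unfolding M_def branch_M_def X1_def[symmetric] using X_pos grad_const_pos[OF p]
    by (intro continuous_on_divide continuous_on_mult continuous_on_powr continuous_intros cont_m cont_X)
       (auto simp: less_imp_neq[symmetric])
  obtain e :: 'a where B: "Basis = {e}" using dim by (rule card_1_singletonE)
  then have e: "norm e = 1" by (metis insertI1 norm_Basis)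
  have inner: "\<sigma> \<bullet> e = 1 \<or> \<sigma> \<bullet> e = - 1" if "\<sigma> \<in> sphere 0 1" for \<sigma>
  proof -
    have "\<sigma> = (\<sigma> \<bullet> e) *\<^sub>R e" using euclidean_representation[of \<sigma>] by (simp add: B)
    then have "norm \<sigma> = \<bar>\<sigma> \<bullet> e\<bar>" using e by (metis mult.right_neutral norm_scaleR)
    then show ?thesis using that by auto
  qed
  \<comment> \<open>Affine interpolation of the two values: at t = 1 and t = -1 the factors 1 - t^2
    and N - 1 remove every derivative from the equation.\<close>
  define w w' w'' :: "real \<Rightarrow> real \<Rightarrow> real"
    where "w s t = (X1 s + X2 s) / 2 + (X1 s - X2 s) / 2 * t"
      and "w' s t = (X1 s - X2 s) / 2" and "w'' s t = 0" for s t
  have w_pm: "w s 1 = X1 s" "w s (- 1) = X2 s" for s by (simp_all add: w_def field_simps)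
  have zs: "zonal_sphere e (w s) (w' s) (w'' s)" for s
    by standard (auto simp: e w_def[abs_def] w'_def[abs_def] w''_def[abs_def] intro!: derivative_eq_intros)
  have const: "2 * K_const 1 p / (p - 1) * X = X powr p + M s * ((2 / (p - 1))\<^sup>2 * X\<^sup>2) powr (p / (p + 1))"
    if "X = X1 s \<or> X = X2 s" for X s
  proof -
    have "\<exists>m. X = branch_X 1 p m \<and> M s = branch_M 1 p m \<and> kappa 1 p - m > 0"
      using that
    proof
      assume "X = X1 s"
      then show ?thesis unfolding X1_def M_def using pos(1)[of s] by blast
    next
      assume "X = X2 s"
      then show ?thesis unfolding X2_def M2[symmetric] using pos(2)[of s] by blast
    qed
    then obtain m where m: "X = branch_X 1 p m" "M s = branch_M 1 p m" "kappa 1 p - m > 0" by blast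
    have "(X * 1) powr p + M s * ((2 / (p - 1))\<^sup>2 * X\<^sup>2 * 1) powr (p / (p + 1))
        = X * ((kappa 1 p - m) * 1 powr p + m * 1 powr (p / (p + 1)))"
      unfolding m(1,2)
      by (intro scaled_nonlinearity branch_X_pos branch_X_powr branch_M_mult m(3) p) auto
    then show ?thesis by (simp add: kappa_def algebra_simps)
  qed
  have sol: "zonal_solution_at DIM('a) p (M s) (w s) (w' s) (w'' s) (\<sigma> \<bullet> e)"
    if "\<sigma> \<in> sphere 0 1" for s \<sigma>
    using inner[OF that] const[of "X1 s" s] const[of "X2 s" s] X_pos[of s]
    by (auto simp: zonal_solution_at_def dim w_pm)
  have lim_X: "uniform_limit {-1..1} (\<lambda>s t. f s) (\<lambda>t. f s) (at s)"
    if "continuous_on UNIV f" for f :: "real \<Rightarrow> real" and s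
    using that by (intro uniform_limit_const_fun) (simp add: continuous_on_def)
  have cont_d: "continuous_on UNIV (\<lambda>s. (X1 s + X2 s) / 2)" "continuous_on UNIV (\<lambda>s. (X1 s - X2 s) / 2)"
    by (intro continuous_intros cont_X; simp)+
  have lim_w: "uniform_limit {-1..1} w (w s) (at s)" "uniform_limit {-1..1} w' (w' s) (at s)" for s
  proof -
    have "uniform_limit {-1..1} (\<lambda>s t. (X1 s - X2 s) / 2 * t) (\<lambda>t. (X1 s - X2 s) / 2 * t) (at s)"
      by (rule uniform_lim_mult[OF lim_X[OF cont_d(2)] uniform_limit_const])
         (auto simp: image_constant_conv)
    from uniform_limit_add[OF lim_X[OF cont_d(1)] this]
    show "uniform_limit {-1..1} w (w s) (at s)" by (simp add: w_def[abs_def])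
    show "uniform_limit {-1..1} w' (w' s) (at s)"
      unfolding w'_def[abs_def] by (rule lim_X[OF cont_d(2)])
  qed
  have nonconst: "\<not> (\<lambda>\<sigma>. w s (\<sigma> \<bullet> e)) constant_on sphere 0 1" if "s \<noteq> 0" for s
  proof
    assume "(\<lambda>\<sigma>. w s (\<sigma> \<bullet> e)) constant_on sphere 0 1"
    then obtain c where c: "\<And>\<sigma>. \<sigma> \<in> sphere 0 1 \<Longrightarrow> w s (\<sigma> \<bullet> e) = c" by (auto simp: constant_on_def)
    have "e \<bullet> e = 1" using e by (simp add: norm_eq_1)
    then have "X1 s = X2 s" using c[of e] c[of "- e"] e by (simp add: w_pm)
    then have "kappa 1 p - m1 s = kappa 1 p - m2 s"
      using branch_X_powr[OF p pos(1)] branch_X_powr[OF p pos(2)] by (metis X1_def X2_def)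
    then have "exp ((p + 1) * s) = 1" using \<kappa> g_pos[of s] by (simp add: m1_def m2_def)
    then show False using p that by simp
  qed
  have m0: "m1 0 = crit_m 1 p 1" "m2 0 = crit_m 1 p 1"
  proof -
    have "p \<noteq> 0" "p - 1 \<noteq> 0" using p by auto
    then show "m1 0 = crit_m 1 p 1" "m2 0 = crit_m 1 p 1"
      by (simp_all add: m1_def m2_def g_def \<kappa>_def kappa_def crit_m_def angular_eig_def divide_simps)
         (simp_all add: algebra_simps)
  qed
  have w0: "w 0 t = branch_X 1 p (crit_m 1 p 1)" for t
    by (simp add: w_def X1_def X2_def m0)
  note family = bifurcates_from_zonal_family[of p 1 e M w w' w'',
      OF p zero_less_one e cont_M zs sol lim_w w0 nonconst]
  show "bifurcates_from TYPE('a) p (branch_M 1 p (crit_m 1 p 1)) (branch_X 1 p (crit_m 1 p 1))"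
    using family(1) by (simp add: M_def m0)
  show "nonradial_separable_solution TYPE('a) p"
    by (rule family(2))
qed

text \<open>With n = N - 1, 2K (p-1) = 2n (p-1) - 2(p+1) < 2n (p-1) <= (p+1) n (p-1), so degree one
  is available for every p > 1.\<close>

lemma kappa_crit_pos_first:
  assumes p: "p > 1" and N: "N \<ge> 2"
  shows "kappa N p - crit_m N p 1 > 0"
proof -
  define n where "n = real N - 1"
  have n: "n \<ge> 1" using N by (simp add: n_def)
  have "n * (p - 1) * 2 \<le> n * (p - 1) * (p + 1)" using n p by (intro mult_left_mono) auto
  then have "2 * ((n - 1) * p - (n + 1)) < (p + 1) * n * (p - 1)" using p by (simp add: algebra_simps)
  then have "2 * K_const N p < (p + 1) * angular_eig N 1"
    using p by (simp add: K_const_def angular_eig_def n_def divide_less_eq)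
  then show ?thesis unfolding crit_m_eq(1)[OF p] using p by simp
qed

theorem corollary6p5:
  fixes p :: real and N :: nat
  assumes p: "p > 1" and N: "N = DIM('a::euclidean_space)"
  shows
    "(\<exists>(M::real) (u :: 'a \<Rightarrow> real) (\<omega> :: 'a \<Rightarrow> real).
        emden_solution p M u \<and> (\<forall>x. x \<noteq> 0 \<longrightarrow> u x > 0) \<and>
        nonradial u \<and> singular_at_origin u \<and>
        (\<forall>r>0. \<forall>\<sigma>\<in>sphere 0 1. u (r *\<^sub>R \<sigma>) = r powr (- (2 / (p - 1))) * \<omega> \<sigma>))
     \<and>
     (N \<ge> 4 \<and> p > (real N + 1) / (real N - 3) \<longrightarrow>
        (\<exists>M>0. bifurcates_from TYPE('a) p M (X_M N p M)))
     \<and>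
     (N \<ge> 3 \<and> real N / (real N - 2) \<le> p \<and> (N = 3 \<or> p < (real N + 1) / (real N - 3)) \<longrightarrow>
        (\<exists>M<0. bifurcates_from TYPE('a) p M (X_M N p M)))
     \<and>
     (N = 1 \<or> N = 2 \<or> (N \<ge> 3 \<and> p < real N / (real N - 2)) \<longrightarrow>
        (N \<ge> 2 \<longrightarrow> (\<forall>k\<ge>1. M_k N p k < - mu_star N p \<and>
            bifurcates_from TYPE('a) p (M_k N p k) (X2_M N p (M_k N p k)))) \<and>
        (N = 1 \<longrightarrow> M_k N p 1 = - mu_star N p \<and>
            bifurcates_from TYPE('a) p (M_k N p 1) (X2_M N p (M_k N p 1))))"
proof -
  have N1: "N \<ge> 1" using N by (simp add: Suc_leI)
  have eig1: "angular_eig N 1 = real N - 1" by (simp add: angular_eig_def)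
  have bif: "bifurcates_from TYPE('a) p (branch_M N p (crit_m N p k)) (branch_X N p (crit_m N p k))"
    if "N \<ge> 2" "k \<ge> 1" "kappa N p - crit_m N p k > 0" for k
    using bifurcation_from_branch(1)[OF p, of k, where ?'a = 'a] that by (simp add: N)
  have item1: "nonradial_separable_solution TYPE('a) p"
  proof (cases "N = 1")
    case True
    show ?thesis by (rule two_point_bifurcation(2)[OF p]) (use True N in simp)
  next
    case False
    then have N2: "N \<ge> 2" using N1 by linarith
    show ?thesis
      by (rule bifurcation_from_branch(2)[OF p, of 1])
         (use N2 kappa_crit_pos_first[OF p N2] N in simp_all)
  qed
  have from_X_M: "bifurcates_from TYPE('a) p (branch_M N p (crit_m N p 1)) (X_M N p (branch_M N p (crit_m N p 1)))"
    if "N \<ge> 2" "K_const N p \<ge> 0"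
  proof -
    have "kappa N p \<ge> 0" using that p by (simp add: kappa_def)
    then show ?thesis
      using X_M_branch[OF p _ kappa_crit_pos_first[OF p that(1)]] bif[OF that(1) _ kappa_crit_pos_first[OF p that(1)]]
      by simp
  qed
  \<comment> \<open>This sign separates the second item from the third: 2K > N - 1 is the same as
    (N-3) p > N + 1.\<close>
  have sgn_M: "sgn (branch_M N p (crit_m N p 1)) = sgn (2 * K_const N p - (real N - 1))" if "N \<ge> 2"
  proof -
    have "sgn (crit_m N p 1) = sgn (2 * K_const N p - (real N - 1))"
      unfolding crit_m_def eig1 using p by (simp add: sgn_mult sgn_divide)
    then show ?thesis by (simp only: sgn_branch_M[OF p kappa_crit_pos_first[OF p that]])
  qed
  have item2: "\<exists>M>0. bifurcates_from TYPE('a) p M (X_M N p M)"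
    if "N \<ge> 4" "p > (real N + 1) / (real N - 3)"
  proof -
    have "(real N - 3) * p > real N + 1" using that by (simp add: field_simps)
    then have "(real N - 1) * (p - 1) < 2 * ((real N - 2) * p - real N)" by (simp add: algebra_simps)
    then have K: "2 * K_const N p > real N - 1" using p by (simp add: K_const_def less_divide_eq)
    then have "branch_M N p (crit_m N p 1) > 0"
      using sgn_M that(1) by (simp add: sgn_1_pos)
    then show ?thesis using from_X_M that(1) K by (intro exI[of _ "branch_M N p (crit_m N p 1)"]) auto
  qed
  have item3: "\<exists>M<0. bifurcates_from TYPE('a) p M (X_M N p M)"
    if "N \<ge> 3" "real N / (real N - 2) \<le> p" "N = 3 \<or> p < (real N + 1) / (real N - 3)"
  proof -
    have "(real N - 2) * p \<ge> real N" using that by (simp add: field_simps)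
    then have K0: "K_const N p \<ge> 0" using p by (simp add: K_const_def)
    \<comment> \<open>For \<open>N = 3\<close> the left side is 0, in accordance with the convention
      that the upper bound on p is then infinite.\<close>
    have "(real N - 3) * p < real N + 1"
      using that(3)
    proof
      assume "p < (real N + 1) / (real N - 3)"
      then show ?thesis using that(1) by (cases "N = 3") (auto simp: field_simps)
    qed simp
    then have "(real N - 1) * (p - 1) > 2 * ((real N - 2) * p - real N)" by (simp add: algebra_simps)
    then have K: "2 * K_const N p < real N - 1" using p by (simp add: K_const_def divide_less_eq)
    then have "branch_M N p (crit_m N p 1) < 0"
      using sgn_M that(1) by (simp add: sgn_1_neg)
    then show ?thesis using from_X_M that(1) K0 by (intro exI[of _ "branch_M N p (crit_m N p 1)"]) auto
  qed
  have item4: "(N \<ge> 2 \<longrightarrow> (\<forall>k\<ge>1. M_k N p k < - mu_star N p \<and>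
            bifurcates_from TYPE('a) p (M_k N p k) (X2_M N p (M_k N p k)))) \<and>
        (N = 1 \<longrightarrow> M_k N p 1 = - mu_star N p \<and>
            bifurcates_from TYPE('a) p (M_k N p 1) (X2_M N p (M_k N p 1)))"
    if "N = 1 \<or> N = 2 \<or> (N \<ge> 3 \<and> p < real N / (real N - 2))"
  proof -
    have "(real N - 2) * p < real N" using that p by (auto simp: field_simps)
    \<comment> \<open>With K negative and lambda_k nonnegative, \<kappa> - m_k is positive, so every
      degree \<open>k\<close> yields a bifurcation point when \<open>N >= 2\<close>.\<close>
    then have K: "K_const N p < 0" using p by (simp add: K_const_def divide_neg_pos)
    show ?thesis
    proof (intro conjI impI allI)
      fix k :: nat assume k: "N \<ge> 2" "1 \<le> k"
      have eig: "angular_eig N k > 0" using k by (simp add: angular_eig_def)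
      then have eig0: "angular_eig N k \<ge> 0" by simp
      show "M_k N p k < - mu_star N p"
        unfolding M_k_branch[OF p K eig0] by (rule crit_M_mu_star(2)[OF p K eig0 eig])
      show "bifurcates_from TYPE('a) p (M_k N p k) (X2_M N p (M_k N p k))"
        unfolding M_k_branch[OF p K eig0] X2_M_branch[OF p K eig0]
        by (rule bif[OF k kappa_crit_pos[OF p K eig0]])
    next
      assume N1: "N = 1"
      \<comment> \<open>The eigenvalue vanishes on the two-point sphere, which moves the bifurcation
        point to the fold itself.\<close>
      then have eig: "angular_eig N 1 = 0" by (simp add: angular_eig_def)
      then have eig0: "angular_eig N 1 \<ge> 0" by simp
      show "M_k N p 1 = - mu_star N p"
        unfolding M_k_branch[OF p K eig0] by (rule crit_M_mu_star(1)[OF p K eig0 eig])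
      show "bifurcates_from TYPE('a) p (M_k N p 1) (X2_M N p (M_k N p 1))"
        unfolding M_k_branch[OF p K eig0] X2_M_branch[OF p K eig0]
        using two_point_bifurcation(1)[OF p, where ?'a = 'a] N N1 by simp
    qed
  qed
  show ?thesis using item1 item2 item3 item4 by blast
qed

end
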